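(* Let $f:X\to Y$ be a weak fibration of simplicial categories, where $X$ and $Y$ are fibrant groupoids. Then the induced map of homotopy coherent nerves $\mathfrak{N}(f):\mathfrak{N}(X)\to\mathfrak{N}(Y)$ is a Kan fibration.
   Context: A simplicial category is a simplicially enriched (small) category; $\mathtt{sCat}$ is the category of these. $\mathcal{H}om_{\mathcal C}(x,y)$ denotes the simplicial set of morphisms; its $n$-simplices are called $n$-arrows. For a simplicial category $\mathcal{C}$, $\pi_0(\mathcal{C})$ is the category with the same objects and $\mathrm{Hom}_{\pi_0(\mathcal C)}(x,y)=\pi_0(\mathcal{H}om_{\mathcal C}(x,y))$. A simplicial category is fibrant if all its simplicial sets $\mathcal{H}om(x,y)$ are Kan. A fibrant groupoid is a fibrant simplicial category $\mathcal C$ such that $\pi_0(\mathcal C)$ is a groupoid. A $0$-arrow $\alpha$ is a homotopy equivalence if its class in $\pi_0$ is an isomorphism. A functor $f:\mathcal C\to\mathcal D$ in $\mathtt{sCat}$ is a weak fibration (a fibration in the standard, Dwyer–Hirschhorn–Kan–Bergner, model structure) if (i) for all $x,y\in\mathcal C$ the map $\mathcal{H}om_{\mathcal C}(x,y)\to\mathcal{H}om_{\mathcal D}(fx,fy)$ is a Kan fibration, and (ii) for all $x\in\mathcal C$ any homotopy equivalence $fx\to z$ in $\mathcal D$ can be lifted to a homotopy equivalence $x\to y$ in $\mathcal C$. Homotopy coherent nerve. For $a\le b$ in $\mathbb{N}$ put $(a,b)=\{c\in\mathbb{N}: a<c<b\}$ and $I=\Delta^1$. The simplicial category $\mathbf{\Delta}_{\mathfrak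 N}^n$ has objects $0,\dots,n$; the simplicial set of morphisms from $a$ to $b$ is $I^{(a,b)}$ if $a\le b$ and is empty if $a>b$; the composition $I^{(b,c)}\times I^{(a,b)}\to I^{(a,c)}$ (for $a<b<c$) inserts the constant value $0$ at the coordinate $b$. For $a<b$ let $\phi(a,b)$ be the $0$-simplex of $I^{(a,b)}$ with all coordinates equal to $1$, and let $\phi(a,a)=\mathrm{id}_a$. A nondecreasing map $f:[m]\to[n]$ induces the unique simplicial functor $f_*:\mathbf{\Delta}_{\mathfrak N}^m\to\mathbf{\Delta}_{\mathfrak N}^n$ equal to $f$ on objects with $f_*(\phi(a,b))=\phi(f(a),f(b))$; this makes $n\mapsto\mathbf{\Delta}_{\mathfrak N}^n$ a cosimplicial object of $\mathtt{sCat}$. The homotopy coherent nerve $\mathfrak{N}:\mathtt{sCat}\to\mathtt{sSet}$ is $\mathfrak{N}(\mathcal C)_n=\mathrm{Hom}_{\mathtt{sCat}}(\mathbf{\Delta}_{\mathfrak N}^n,\mathcal C)$. *)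

theory Defs
  imports "HOL-Library.FuncSet"
begin

section \<open>Simplicial sets\<close>

text \<open>
  The object \<open>[n]\<close> of the simplex category is \<open>{..n}\<close>; maps are taken to be
  extensional, so that equality of maps is HOL equality.
\<close>

definition mono_maps :: "nat \<Rightarrow> nat \<Rightarrow> (nat \<Rightarrow> nat) set" where
  "mono_maps m n = {f \<in> {..m} \<rightarrow>\<^sub>E {..n}. mono_on {..m} f}"

text \<open>
  \<open>sact X m n f\<close> is the operator \<open>X\<^sub>n \<Rightarrow> X\<^sub>m\<close> given by \<open>f : [m] \<rightarrow> [n]\<close>.
  The sets \<open>simps X n\<close> for different \<open>n\<close> may overlap; a simplex is always considered together
  with its dimension.
\<close>

record 'a sset =
  simps :: "nat \<Rightarrow> 'a set"
  sact :: "nat \<Rightarrow> nat \<Rightarrow> (nat \<Rightarrow> nat) \<Rightarrow> 'a \<Rightarrow> 'a"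

locale simplicial_set =
  fixes X :: "'a sset"
  assumes act_closed:
      "\<lbrakk>f \<in> mono_maps m n; x \<in> simps X n\<rbrakk> \<Longrightarrow> sact X m n f x \<in> simps X m"
    and act_id: "x \<in> simps X n \<Longrightarrow> sact X n n (\<lambda>i\<in>{..n}. i) x = x"
    and act_comp:
      "\<lbrakk>f \<in> mono_maps l m; g \<in> mono_maps m n; x \<in> simps X n\<rbrakk>
        \<Longrightarrow> sact X l n (compose {..l} g f) x = sact X l m f (sact X m n g x)"

locale simplicial_map =
  X: simplicial_set X + Y: simplicial_set Y
  for X :: "'a sset" and Y :: "'b sset" +
  fixes p :: "nat \<Rightarrow> 'a \<Rightarrow> 'b"
  assumes map_closed: "x \<in> simps X n \<Longrightarrow> p n x \<in> simps Y n"
    and map_natural: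
      "\<lbrakk>f \<in> mono_maps m n; x \<in> simps X n\<rbrakk> \<Longrightarrow> p m (sact X m n f x) = sact Y m n f (p n x)"

definition std_simplex :: "nat \<Rightarrow> (nat \<Rightarrow> nat) sset" where
  "std_simplex n = \<lparr>simps = (\<lambda>m. mono_maps m n), sact = (\<lambda>l m f s. compose {..l} s f)\<rparr>"

text \<open>The union of the faces opposite to the vertices \<open>i \<noteq> k\<close>.\<close>

definition horn :: "nat \<Rightarrow> nat \<Rightarrow> (nat \<Rightarrow> nat) sset" where
  "horn n k = \<lparr>simps = (\<lambda>m. {s \<in> mono_maps m n. \<exists>i\<le>n. i \<noteq> k \<and> i \<notin> s ` {..m}}),
               sact = (\<lambda>l m f s. compose {..l} s f)\<rparr>"

definition empty_sset :: "'a sset" where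
  "empty_sset = \<lparr>simps = (\<lambda>n. {}), sact = (\<lambda>m n f x. undefined)\<rparr>"

definition sset_power :: "'i set \<Rightarrow> 'a sset \<Rightarrow> ('i \<Rightarrow> 'a) sset" where
  "sset_power S X = \<lparr>simps = (\<lambda>n. S \<rightarrow>\<^sub>E simps X n),
                     sact = (\<lambda>m n f x. \<lambda>c\<in>S. sact X m n f (x c))\<rparr>"

subsection \<open>Kan fibrations and Kan simplicial sets\<close>

definition kan_fibration :: "'a sset \<Rightarrow> 'b sset \<Rightarrow> (nat \<Rightarrow> 'a \<Rightarrow> 'b) \<Rightarrow> bool" where
  "kan_fibration X Y p \<longleftrightarrow> simplicial_map X Y p \<and>
    (\<forall>n k u v. 1 \<le> n \<and> k \<le> n \<and>
       simplicial_map (horn n k) X u \<and> simplicial_map (std_simplex n) Y v \<and>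
       (\<forall>m. \<forall>s\<in>simps (horn n k) m. p m (u m s) = v m s) \<longrightarrow>
       (\<exists>w. simplicial_map (std_simplex n) X w \<and>
            (\<forall>m. \<forall>s\<in>simps (horn n k) m. w m s = u m s) \<and>
            (\<forall>m. \<forall>s\<in>simps (std_simplex n) m. p m (w m s) = v m s)))"

definition kan :: "'a sset \<Rightarrow> bool" where
  "kan X \<longleftrightarrow> simplicial_set X \<and>
    (\<forall>n k u. 1 \<le> n \<and> k \<le> n \<and> simplicial_map (horn n k) X u \<longrightarrow>
       (\<exists>w. simplicial_map (std_simplex n) X w \<and>
            (\<forall>m. \<forall>s\<in>simps (horn n k) m. w m s = u m s)))"

subsection \<open>Connected components\<close>

text \<open>The \<open>i\<close>-th vertex of an \<open>n\<close>-simplex.\<close>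

definition vertex :: "'a sset \<Rightarrow> nat \<Rightarrow> nat \<Rightarrow> 'a \<Rightarrow> 'a" where
  "vertex X n i x = sact X 0 n (\<lambda>j\<in>{..0}. i) x"

definition edge_rel :: "'a sset \<Rightarrow> ('a \<times> 'a) set" where
  "edge_rel X = {(vertex X 1 0 e, vertex X 1 1 e) | e. e \<in> simps X 1}"

definition pi0_rel :: "'a sset \<Rightarrow> ('a \<times> 'a) set" where
  "pi0_rel X = (edge_rel X \<union> (edge_rel X)\<inverse>)\<^sup>* \<inter> simps X 0 \<times> simps X 0"

definition pi0 :: "'a sset \<Rightarrow> 'a set set" where
  "pi0 X = simps X 0 // pi0_rel X"


section \<open>Categories\<close>

record ('o, 'm) cat =
  cob :: "'o set"
  chom :: "'o \<Rightarrow> 'o \<Rightarrow> 'm set"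
  ccomp :: "'o \<Rightarrow> 'o \<Rightarrow> 'o \<Rightarrow> 'm \<Rightarrow> 'm \<Rightarrow> 'm"
  cid :: "'o \<Rightarrow> 'm"

text \<open>\<open>ccomp C x y z g f\<close> is the composite \<open>g \<circ> f\<close> of \<open>f : x \<rightarrow> y\<close> and \<open>g : y \<rightarrow> z\<close>.\<close>

locale category =
  fixes C :: "('o, 'm) cat"
  assumes comp_closed:
      "\<lbrakk>x \<in> cob C; y \<in> cob C; z \<in> cob C; g \<in> chom C y z; f \<in> chom C x y\<rbrakk>
        \<Longrightarrow> ccomp C x y z g f \<in> chom C x z"
    and id_closed: "x \<in> cob C \<Longrightarrow> cid C x \<in> chom C x x"
    and comp_assoc:
      "\<lbrakk>w \<in> cob C; x \<in> cob C; y \<in> cob C; z \<in> cob C;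
        h \<in> chom C y z; g \<in> chom C x y; f \<in> chom C w x\<rbrakk>
        \<Longrightarrow> ccomp C w y z h (ccomp C w x y g f) = ccomp C w x z (ccomp C x y z h g) f"
    and comp_id_left:
      "\<lbrakk>x \<in> cob C; y \<in> cob C; f \<in> chom C x y\<rbrakk> \<Longrightarrow> ccomp C x y y (cid C y) f = f"
    and comp_id_right:
      "\<lbrakk>x \<in> cob C; y \<in> cob C; f \<in> chom C x y\<rbrakk> \<Longrightarrow> ccomp C x x y f (cid C x) = f"

definition isomorphism :: "('o, 'm) cat \<Rightarrow> 'o \<Rightarrow> 'o \<Rightarrow> 'm \<Rightarrow> bool" where
  "isomorphism C x y f \<longleftrightarrow> f \<in> chom C x y \<and>
    (\<exists>g\<in>chom C y x. ccomp C x y x g f = cid C x \<and> ccomp C y x y f g = cid C y)"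

definition groupoid :: "('o, 'm) cat \<Rightarrow> bool" where
  "groupoid C \<longleftrightarrow> category C \<and>
    (\<forall>x\<in>cob C. \<forall>y\<in>cob C. \<forall>f\<in>chom C x y. isomorphism C x y f)"


section \<open>Simplicial categories\<close>

text \<open>
  \<open>scomp C x y z n g f\<close> composes the \<open>n\<close>-arrows \<open>f : x \<rightarrow> y\<close> and \<open>g : y \<rightarrow> z\<close>;
  \<open>sid C x\<close> is a 0-arrow, and the identity \<open>n\<close>-arrow of \<open>x\<close> is its degeneracy.
\<close>

record ('o, 'a) scat =
  sob :: "'o set"
  shom :: "'o \<Rightarrow> 'o \<Rightarrow> 'a sset"
  scomp :: "'o \<Rightarrow> 'o \<Rightarrow> 'o \<Rightarrow> nat \<Rightarrow> 'a \<Rightarrow> 'a \<Rightarrow> 'a"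
  sid :: "'o \<Rightarrow> 'a"

definition sidn :: "('o, 'a) scat \<Rightarrow> 'o \<Rightarrow> nat \<Rightarrow> 'a" where
  "sidn C x n = sact (shom C x x) n 0 (\<lambda>i\<in>{..n}. 0) (sid C x)"

locale simplicial_category =
  fixes C :: "('o, 'a) scat"
  assumes hom_sset: "\<lbrakk>x \<in> sob C; y \<in> sob C\<rbrakk> \<Longrightarrow> simplicial_set (shom C x y)"
    and comp_closed:
      "\<lbrakk>x \<in> sob C; y \<in> sob C; z \<in> sob C;
        b \<in> simps (shom C y z) n; a \<in> simps (shom C x y) n\<rbrakk>
        \<Longrightarrow> scomp C x y z n b a \<in> simps (shom C x z) n"
    and comp_natural:
      "\<lbrakk>x \<in> sob C; y \<in> sob C; z \<in> sob C; f \<in> mono_maps m n;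
        b \<in> simps (shom C y z) n; a \<in> simps (shom C x y) n\<rbrakk>
        \<Longrightarrow> sact (shom C x z) m n f (scomp C x y z n b a)
          = scomp C x y z m (sact (shom C y z) m n f b) (sact (shom C x y) m n f a)"
    and id_closed: "x \<in> sob C \<Longrightarrow> sid C x \<in> simps (shom C x x) 0"
    and comp_assoc:
      "\<lbrakk>w \<in> sob C; x \<in> sob C; y \<in> sob C; z \<in> sob C;
        c \<in> simps (shom C y z) n; b \<in> simps (shom C x y) n; a \<in> simps (shom C w x) n\<rbrakk>
        \<Longrightarrow> scomp C w y z n c (scomp C w x y n b a) = scomp C w x z n (scomp C x y z n c b) a"
    and comp_id_left:
      "\<lbrakk>x \<in> sob C; y \<in> sob C; a \<in> simps (shom C x y) n\<rbrakk>
        \<Longrightarrow> scomp C x y y n (sidn C y n) a = a"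
    and comp_id_right:
      "\<lbrakk>x \<in> sob C; y \<in> sob C; a \<in> simps (shom C x y) n\<rbrakk>
        \<Longrightarrow> scomp C x x y n a (sidn C x n) = a"

record ('o, 'a, 'p, 'b) sfun =
  fob :: "'o \<Rightarrow> 'p"
  farr :: "'o \<Rightarrow> 'o \<Rightarrow> nat \<Rightarrow> 'a \<Rightarrow> 'b"

locale simplicial_functor =
  C: simplicial_category C + D: simplicial_category D
  for C :: "('o, 'a) scat" and D :: "('p, 'b) scat" +
  fixes F :: "('o, 'a, 'p, 'b) sfun"
  assumes ob_closed: "x \<in> sob C \<Longrightarrow> fob F x \<in> sob D"
    and arr_map:
      "\<lbrakk>x \<in> sob C; y \<in> sob C\<rbrakk>
        \<Longrightarrow> simplicial_map (shom C x y) (shom D (fob F x) (fob F y)) (farr F x y)"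
    and arr_comp:
      "\<lbrakk>x \<in> sob C; y \<in> sob C; z \<in> sob C;
        b \<in> simps (shom C y z) n; a \<in> simps (shom C x y) n\<rbrakk>
        \<Longrightarrow> farr F x z n (scomp C x y z n b a)
          = scomp D (fob F x) (fob F y) (fob F z) n (farr F y z n b) (farr F x y n a)"
    and arr_id: "x \<in> sob C \<Longrightarrow> farr F x x 0 (sid C x) = sid D (fob F x)"

text \<open>
  Extensional representatives, so that equality in \<open>Hom(C, D)\<close> is equality
  of simplicial functors.
\<close>

definition sfun_hom :: "('o, 'a) scat \<Rightarrow> ('p, 'b) scat \<Rightarrow> ('o, 'a, 'p, 'b) sfun set" where
  "sfun_hom C D = {F. simplicial_functor C D F \<and>
     (\<forall>x. x \<notin> sob C \<longrightarrow> fob F x = undefined) \<and>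
     (\<forall>x y n a. \<not> (x \<in> sob C \<and> y \<in> sob C \<and> a \<in> simps (shom C x y) n)
        \<longrightarrow> farr F x y n a = undefined)}"

definition sfun_comp ::
  "('o, 'a) scat \<Rightarrow> ('p, 'b, 'q, 'c) sfun \<Rightarrow> ('o, 'a, 'p, 'b) sfun \<Rightarrow> ('o, 'a, 'q, 'c) sfun" where
  "sfun_comp C G F =
    \<lparr>fob = (\<lambda>x. if x \<in> sob C then fob G (fob F x) else undefined),
     farr = (\<lambda>x y n a.
       if x \<in> sob C \<and> y \<in> sob C \<and> a \<in> simps (shom C x y) n
       then farr G (fob F x) (fob F y) n (farr F x y n a) else undefined)\<rparr>"

subsection \<open>The category of components, fibrant groupoids and weak fibrations\<close>

definition pi0_cat :: "('o, 'a) scat \<Rightarrow> ('o, 'a set) cat" where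
  "pi0_cat C =
    \<lparr>cob = sob C,
     chom = (\<lambda>x y. pi0 (shom C x y)),
     ccomp = (\<lambda>x y z B A. \<Union>b\<in>B. \<Union>a\<in>A. pi0_rel (shom C x z) `` {scomp C x y z 0 b a}),
     cid = (\<lambda>x. pi0_rel (shom C x x) `` {sid C x})\<rparr>"

definition homotopy_equivalence :: "('o, 'a) scat \<Rightarrow> 'o \<Rightarrow> 'o \<Rightarrow> 'a \<Rightarrow> bool" where
  "homotopy_equivalence C x y a \<longleftrightarrow> a \<in> simps (shom C x y) 0 \<and>
     isomorphism (pi0_cat C) x y (pi0_rel (shom C x y) `` {a})"

definition fibrant :: "('o, 'a) scat \<Rightarrow> bool" where
  "fibrant C \<longleftrightarrow> simplicial_category C \<and> (\<forall>x\<in>sob C. \<forall>y\<in>sob C. kan (shom C x y))"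

definition fibrant_groupoid :: "('o, 'a) scat \<Rightarrow> bool" where
  "fibrant_groupoid C \<longleftrightarrow> fibrant C \<and> groupoid (pi0_cat C)"

definition weak_fibration ::
  "('o, 'a) scat \<Rightarrow> ('p, 'b) scat \<Rightarrow> ('o, 'a, 'p, 'b) sfun \<Rightarrow> bool" where
  "weak_fibration C D F \<longleftrightarrow> simplicial_functor C D F \<and>
    (\<forall>x\<in>sob C. \<forall>y\<in>sob C.
       kan_fibration (shom C x y) (shom D (fob F x) (fob F y)) (farr F x y)) \<and>
    (\<forall>x\<in>sob C. \<forall>z\<in>sob D. \<forall>b. homotopy_equivalence D (fob F x) z b \<longrightarrow>
       (\<exists>y\<in>sob C. \<exists>a. homotopy_equivalence C x y a \<and> fob F y = z \<and> farr F x y 0 a = b))"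


section \<open>The homotopy coherent nerve\<close>

text \<open>
  An \<open>m\<close>-simplex of \<open>I\<^sup>S\<close>, where \<open>S = (a,b)\<close> and \<open>I = \<Delta>\<^sup>1\<close>, is a function assigning to
  each \<open>c \<in> S\<close> a nondecreasing map \<open>[m] \<rightarrow> [1]\<close>.  The formula for the composition covers the
  degenerate cases \<open>a = b\<close> and \<open>b = c\<close>, where no coordinate is inserted.
\<close>

definition nerve_hom :: "nat \<Rightarrow> nat \<Rightarrow> (nat \<Rightarrow> nat \<Rightarrow> nat) sset" where
  "nerve_hom a b = (if a \<le> b then sset_power {a<..<b} (std_simplex 1) else empty_sset)"

definition nerve_comp ::
  "nat \<Rightarrow> nat \<Rightarrow> nat \<Rightarrow> nat \<Rightarrow> (nat \<Rightarrow> nat \<Rightarrow> nat) \<Rightarrow> (nat \<Rightarrow> nat \<Rightarrow> nat) \<Rightarrow> nat \<Rightarrow> nat \<Rightarrow> nat" where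
  "nerve_comp a b c m y x =
    (\<lambda>d\<in>{a<..<c}. if d < b then x d else if d = b then (\<lambda>i\<in>{..m}. 0) else y d)"

definition DeltaN :: "nat \<Rightarrow> (nat, nat \<Rightarrow> nat \<Rightarrow> nat) scat" where
  "DeltaN n = \<lparr>sob = {..n}, shom = nerve_hom, scomp = nerve_comp, sid = (\<lambda>a. \<lambda>c\<in>{}. undefined)\<rparr>"

definition phi :: "nat \<Rightarrow> nat \<Rightarrow> nat \<Rightarrow> nat \<Rightarrow> nat" where
  "phi a b = (\<lambda>c\<in>{a<..<b}. \<lambda>i\<in>{..0}. 1)"

definition DeltaN_map ::
  "nat \<Rightarrow> nat \<Rightarrow> (nat \<Rightarrow> nat) \<Rightarrow> (nat, nat \<Rightarrow> nat \<Rightarrow> nat, nat, nat \<Rightarrow> nat \<Rightarrow> nat) sfun" where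
  "DeltaN_map m n f = (THE F. F \<in> sfun_hom (DeltaN m) (DeltaN n) \<and>
     (\<forall>a\<le>m. fob F a = f a) \<and>
     (\<forall>a b. a \<le> b \<and> b \<le> m \<longrightarrow> farr F a b 0 (phi a b) = phi (f a) (f b)))"

definition nerve ::
  "('o, 'a) scat \<Rightarrow> (nat, nat \<Rightarrow> nat \<Rightarrow> nat, 'o, 'a) sfun sset" where
  "nerve C = \<lparr>simps = (\<lambda>n. sfun_hom (DeltaN n) C),
              sact = (\<lambda>m n f s. sfun_comp (DeltaN m) s (DeltaN_map m n f))\<rparr>"

definition nerve_map ::
  "('o, 'a, 'p, 'b) sfun \<Rightarrow> nat \<Rightarrow>
   (nat, nat \<Rightarrow> nat \<Rightarrow> nat, 'o, 'a) sfun \<Rightarrow> (nat, nat \<Rightarrow> nat \<Rightarrow> nat, 'p, 'b) sfun" where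
  "nerve_map F n s = sfun_comp (DeltaN n) F s"


section \<open>Well-definedness\<close>

text \<open>
  The functor described in the definition of \<open>DeltaN_map\<close> exists and is unique, the nerve is a
  simplicial set, \<open>nerve_map F\<close> is a simplicial map, and \<open>pi0_cat C\<close> is a category.
\<close>

lemma mono_mapsI:
  assumes "\<And>i. i \<le> m \<Longrightarrow> f i \<le> n" "\<And>i j. \<lbrakk>i \<le> j; j \<le> m\<rbrakk> \<Longrightarrow> f i \<le> f j"
  shows "(\<lambda>i\<in>{..m}. f i) \<in> mono_maps m n"
  using assms by (auto simp: mono_maps_def mono_on_def)

lemma mono_maps_le: "\<lbrakk>f \<in> mono_maps m n; i \<le> m\<rbrakk> \<Longrightarrow> f i \<le> n"
  by (auto simp: mono_maps_def PiE_iff)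

lemma mono_maps_mono: "\<lbrakk>f \<in> mono_maps m n; i \<le> j; j \<le> m\<rbrakk> \<Longrightarrow> f i \<le> f j"
  by (auto simp: mono_maps_def mono_on_def)

lemma mono_maps_ext:
  "\<lbrakk>f \<in> mono_maps m n; g \<in> mono_maps m n'; \<And>i. i \<le> m \<Longrightarrow> f i = g i\<rbrakk> \<Longrightarrow> f = g"
  by (rule extensionalityI[of _ "{..m}"]) (auto simp: mono_maps_def PiE_iff)

lemma mono_maps_id: "(\<lambda>i\<in>{..n}. i) \<in> mono_maps n n"
  by (rule mono_mapsI) auto

lemma mono_maps_compose:
  assumes f: "f \<in> mono_maps l m" and g: "g \<in> mono_maps m n"
  shows "compose {..l} g f \<in> mono_maps l n"
  unfolding compose_def
  using mono_maps_le[OF f] mono_maps_le[OF g] mono_maps_mono[OF f] mono_maps_mono[OF g]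
  by (intro mono_mapsI) auto

lemma simplicial_set_std_simplex: "simplicial_set (std_simplex n)"
proof
  show "sact (std_simplex n) m m (\<lambda>i\<in>{..m}. i) x = x" if "x \<in> simps (std_simplex n) m" for x m
    using that
    by (auto simp: std_simplex_def compose_def fun_eq_iff mono_maps_def PiE_iff extensional_def)
  show "sact (std_simplex n) l p (compose {..l} g f) x =
      sact (std_simplex n) l m f (sact (std_simplex n) m p g x)"
    if "f \<in> mono_maps l m" for l m p f g x
    using mono_maps_le[OF that] by (auto simp: std_simplex_def compose_def fun_eq_iff)
qed (auto simp: std_simplex_def mono_maps_compose)

lemma simplicial_set_horn: "simplicial_set (horn n k)"
proof
  show "sact (horn n k) m m (\<lambda>i\<in>{..m}. i) x = x" if "x \<in> simps (horn n k) m" for x m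
    using that
    by (auto simp: horn_def compose_def fun_eq_iff mono_maps_def PiE_iff extensional_def)
  show "sact (horn n k) l p (compose {..l} g f) x =
      sact (horn n k) l m f (sact (horn n k) m p g x)"
    if "f \<in> mono_maps l m" for l m p f g x
    using mono_maps_le[OF that] by (auto simp: horn_def compose_def fun_eq_iff)
  show "sact (horn n k) m p f x \<in> simps (horn n k) m"
    if f: "f \<in> mono_maps m p" and x: "x \<in> simps (horn n k) p" for f m p x
  proof -
    obtain i where i: "i \<le> n" "i \<noteq> k" "i \<notin> x ` {..p}" and xm: "x \<in> mono_maps p n"
      using x by (auto simp: horn_def)
    have "i \<notin> compose {..m} x f ` {..m}"
      using i(3) mono_maps_le[OF f] by (auto simp: compose_def)
    then show ?thesis
      using mono_maps_compose[OF f xm] i by (auto simp: horn_def)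
  qed
qed

lemma simplicial_set_empty: "simplicial_set empty_sset"
  by unfold_locales (auto simp: empty_sset_def)

lemma simplicial_set_power:
  assumes "simplicial_set X"
  shows "simplicial_set (sset_power S X)"
proof -
  interpret simplicial_set X by fact
  show ?thesis
  proof
    show "sact (sset_power S X) n n (\<lambda>i\<in>{..n}. i) x = x"
      if "x \<in> simps (sset_power S X) n" for x n
      using that by (auto simp: sset_power_def fun_eq_iff PiE_iff extensional_def act_id)
  qed (auto simp: sset_power_def act_closed act_comp PiE_iff intro!: restrict_ext)
qed

lemma simplicial_set_nerve_hom: "simplicial_set (nerve_hom a b)"
  by (simp add: nerve_hom_def simplicial_set_power simplicial_set_std_simplex simplicial_set_empty)

lemma simps_nerve_hom:
  "simps (nerve_hom a b) m = (if a \<le> b then {a<..<b} \<rightarrow>\<^sub>E mono_maps m 1 else {})"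
  by (simp add: nerve_hom_def sset_power_def std_simplex_def empty_sset_def)

lemma sact_nerve_hom:
  "a \<le> b \<Longrightarrow> sact (nerve_hom a b) l m f x = (\<lambda>c\<in>{a<..<b}. \<lambda>i\<in>{..l}. x c (f i))"
  by (simp add: nerve_hom_def sset_power_def std_simplex_def compose_def)

lemma nerve_hom_ext:
  assumes x: "x \<in> simps (nerve_hom a b) m" and y: "y \<in> simps (nerve_hom a b) m"
    and eq: "\<And>c i. \<lbrakk>a < c; c < b; i \<le> m\<rbrakk> \<Longrightarrow> x c i = y c i"
  shows "x = y"
proof (rule extensionalityI[of _ "{a<..<b}"])
  show "x c = y c" if "c \<in> {a<..<b}" for c
    using x y eq that
    by (intro mono_maps_ext[of "x c" m 1 "y c" 1]) (auto simp: simps_nerve_hom split: if_splits)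
qed (use x y in \<open>auto simp: simps_nerve_hom PiE_iff split: if_splits\<close>)

lemma zero_mono_maps: "(\<lambda>i\<in>{..m}. 0) \<in> mono_maps m n"
  by (rule mono_mapsI) auto

lemma one_mono_maps: "(\<lambda>i\<in>{..m}. Suc 0) \<in> mono_maps m (Suc 0)"
  by (rule mono_mapsI) auto

lemma nerve_comp_closed:
  "\<lbrakk>y \<in> simps (nerve_hom b c) m; x \<in> simps (nerve_hom a b) m\<rbrakk>
    \<Longrightarrow> nerve_comp a b c m y x \<in> simps (nerve_hom a c) m"
  by (auto simp: simps_nerve_hom nerve_comp_def zero_mono_maps PiE_iff split: if_splits)

lemma sidn_DeltaN: "sidn (DeltaN n) a m = (\<lambda>c\<in>{}. undefined)"
  by (auto simp: sidn_def DeltaN_def sact_nerve_hom fun_eq_iff)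

lemma simplicial_category_DeltaN: "simplicial_category (DeltaN n)"
proof (rule simplicial_category.intro)
  fix x y z f l m b a
  assume f: "f \<in> mono_maps l m"
    and b: "b \<in> simps (shom (DeltaN n) y z) m" and a: "a \<in> simps (shom (DeltaN n) x y) m"
  have le: "x \<le> y" "y \<le> z"
    using a b by (auto simp: DeltaN_def simps_nerve_hom split: if_splits)
  then show "sact (shom (DeltaN n) x z) l m f (scomp (DeltaN n) x y z m b a) =
      scomp (DeltaN n) x y z l (sact (shom (DeltaN n) y z) l m f b)
       (sact (shom (DeltaN n) x y) l m f a)"
    using mono_maps_le[OF f]
    by (auto simp: DeltaN_def sact_nerve_hom nerve_comp_def fun_eq_iff)
next
  show "scomp (DeltaN n) w y z m c (scomp (DeltaN n) w x y m b a) =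
      scomp (DeltaN n) w x z m (scomp (DeltaN n) x y z m c b) a"
    if "c \<in> simps (shom (DeltaN n) y z) m" "b \<in> simps (shom (DeltaN n) x y) m"
      "a \<in> simps (shom (DeltaN n) w x) m" for w x y z m a b c
    using that
    by (auto simp: DeltaN_def simps_nerve_hom nerve_comp_def fun_eq_iff split: if_splits)
next
  show "scomp (DeltaN n) x y y m (sidn (DeltaN n) y m) a = a"
    if "a \<in> simps (shom (DeltaN n) x y) m" for x y m a
    using that unfolding sidn_DeltaN
    by (auto simp: DeltaN_def simps_nerve_hom nerve_comp_def fun_eq_iff PiE_iff extensional_def
        split: if_splits)
next
  show "scomp (DeltaN n) x x y m a (sidn (DeltaN n) x m) = a"
    if "a \<in> simps (shom (DeltaN n) x y) m" for x y m a
    using that unfolding sidn_DeltaN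
    by (auto simp: DeltaN_def simps_nerve_hom nerve_comp_def fun_eq_iff PiE_iff extensional_def
        split: if_splits)
next
  show "scomp (DeltaN n) x y z m b a \<in> simps (shom (DeltaN n) x z) m"
    if "b \<in> simps (shom (DeltaN n) y z) m" "a \<in> simps (shom (DeltaN n) x y) m" for x y z m b a
    using nerve_comp_closed that by (simp add: DeltaN_def)
qed (auto simp: DeltaN_def simplicial_set_nerve_hom simps_nerve_hom)

text \<open>An explicit formula for \<open>DeltaN_map m n f\<close>.\<close>

definition DeltaN_map_arr ::
  "(nat \<Rightarrow> nat) \<Rightarrow> nat \<Rightarrow> nat \<Rightarrow> nat \<Rightarrow> (nat \<Rightarrow> nat \<Rightarrow> nat) \<Rightarrow> nat \<Rightarrow> nat \<Rightarrow> nat" where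
  "DeltaN_map_arr f a b k x =
    (\<lambda>d\<in>{f a<..<f b}. \<lambda>i\<in>{..k}. if \<exists>c\<in>{a<..<b}. f c = d \<and> x c i = 0 then 0 else 1)"

definition DeltaN_map_explicit ::
  "nat \<Rightarrow> (nat \<Rightarrow> nat) \<Rightarrow> (nat, nat \<Rightarrow> nat \<Rightarrow> nat, nat, nat \<Rightarrow> nat \<Rightarrow> nat) sfun" where
  "DeltaN_map_explicit m f =
    \<lparr>fob = (\<lambda>a. if a \<le> m then f a else undefined),
     farr = (\<lambda>a b k x. if a \<le> m \<and> b \<le> m \<and> x \<in> simps (nerve_hom a b) k
                       then DeltaN_map_arr f a b k x else undefined)\<rparr>"

lemma DeltaN_map_arr_closed:
  assumes f: "f \<in> mono_maps m n" and ab: "a \<le> m" "b \<le> m" and x: "x \<in> simps (nerve_hom a b) k"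
  shows "DeltaN_map_arr f a b k x \<in> simps (nerve_hom (f a) (f b)) k"
proof -
  have "a \<le> b" using x by (auto simp: simps_nerve_hom split: if_splits)
  then have "f a \<le> f b" using mono_maps_mono[OF f] ab by auto
  moreover have "x c i \<le> x c j" if "a < c" "c < b" "i \<le> j" "j \<le> k" for c i j
    using x that by (auto simp: simps_nerve_hom split: if_splits intro: mono_maps_mono)
  ultimately show ?thesis
    by (fastforce simp: simps_nerve_hom DeltaN_map_arr_def intro!: mono_mapsI)
qed

lemma DeltaN_map_explicit_hom:
  assumes f: "f \<in> mono_maps m n"
  shows "DeltaN_map_explicit m f \<in> sfun_hom (DeltaN m) (DeltaN n)"
proof -
  have "simplicial_functor (DeltaN m) (DeltaN n) (DeltaN_map_explicit m f)"
  proof (intro simplicial_functor.intro simplicial_functor_axioms.intro simplicial_category_DeltaN)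
    show "fob (DeltaN_map_explicit m f) x \<in> sob (DeltaN n)" if "x \<in> sob (DeltaN m)" for x
      using that mono_maps_le[OF f] by (auto simp: DeltaN_map_explicit_def DeltaN_def)
  next
    fix x y assume xy: "x \<in> sob (DeltaN m)" "y \<in> sob (DeltaN m)"
    have "simplicial_map (nerve_hom x y) (nerve_hom (f x) (f y)) (farr (DeltaN_map_explicit m f) x y)"
    proof (intro simplicial_map.intro simplicial_map_axioms.intro simplicial_set_nerve_hom)
      fix a k assume a: "a \<in> simps (nerve_hom x y) k"
      show "farr (DeltaN_map_explicit m f) x y k a \<in> simps (nerve_hom (f x) (f y)) k"
        using a xy DeltaN_map_arr_closed[OF f] by (auto simp: DeltaN_map_explicit_def DeltaN_def)
    next
      fix g l k a assume g: "g \<in> mono_maps l k" and a: "a \<in> simps (nerve_hom x y) k"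
      have le: "x \<le> y" "f x \<le> f y"
        using a xy mono_maps_mono[OF f]
        by (auto simp: DeltaN_def simps_nerve_hom split: if_splits)
      have "sact (nerve_hom x y) l k g a \<in> simps (nerve_hom x y) l"
        by (rule simplicial_set.act_closed[OF simplicial_set_nerve_hom g a])
      then show "farr (DeltaN_map_explicit m f) x y l (sact (nerve_hom x y) l k g a) =
          sact (nerve_hom (f x) (f y)) l k g (farr (DeltaN_map_explicit m f) x y k a)"
        using a xy le mono_maps_le[OF g]
        by (auto simp: DeltaN_map_explicit_def DeltaN_def DeltaN_map_arr_def sact_nerve_hom fun_eq_iff)
    qed
    then show "simplicial_map (shom (DeltaN m) x y)
        (shom (DeltaN n) (fob (DeltaN_map_explicit m f) x) (fob (DeltaN_map_explicit m f) y))
        (farr (DeltaN_map_explicit m f) x y)"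
      using xy by (simp add: DeltaN_def DeltaN_map_explicit_def)
  next
    fix x y z k b a
    assume xyz: "x \<in> sob (DeltaN m)" "y \<in> sob (DeltaN m)" "z \<in> sob (DeltaN m)"
      and b: "b \<in> simps (shom (DeltaN m) y z) k" and a: "a \<in> simps (shom (DeltaN m) x y) k"
    have bm: "b \<in> simps (nerve_hom y z) k" and am: "a \<in> simps (nerve_hom x y) k"
      and le: "x \<le> y" "y \<le> z" "z \<le> m"
      using a b xyz by (auto simp: DeltaN_def simps_nerve_hom split: if_splits)
    note fm = mono_maps_mono[OF f]
    have "DeltaN_map_arr f x z k (nerve_comp x y z k b a) =
       nerve_comp (f x) (f y) (f z) k (DeltaN_map_arr f y z k b) (DeltaN_map_arr f x y k a)"
      (is "?L = ?R")
    proof (rule nerve_hom_ext)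
      show "?L \<in> simps (nerve_hom (f x) (f z)) k"
        using DeltaN_map_arr_closed[OF f] nerve_comp_closed[OF bm am] le by auto
      show "?R \<in> simps (nerve_hom (f x) (f z)) k"
        using DeltaN_map_arr_closed[OF f] nerve_comp_closed bm am le by auto
      fix d i assume d: "f x < d" "d < f z" and i: "i \<le> k"
      have fle: "f c \<le> f y" if "c \<le> y" for c using fm[of c y] le that by auto
      have fge: "f y \<le> f c" if "y \<le> c" "c < z" for c using fm[of y c] le that by auto
      consider "d < f y" | "d = f y" | "d > f y" by linarith
      then show "?L d i = ?R d i"
      proof cases
        case 1
        have "(\<exists>c\<in>{x<..<z}. f c = d \<and> nerve_comp x y z k b a c i = 0) \<longleftrightarrow>
              (\<exists>c\<in>{x<..<y}. f c = d \<and> a c i = 0)" (is "?P \<longleftrightarrow> ?Q")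
        proof
          assume ?P
          then obtain c where c: "x < c" "c < z" "f c = d" "nerve_comp x y z k b a c i = 0" by auto
          then have "c < y" using fge[of c] 1 by force
          then show ?Q using c by (auto simp: nerve_comp_def)
        qed (use le in \<open>force simp: nerve_comp_def\<close>)
        then show ?thesis using 1 d i by (simp add: DeltaN_map_arr_def nerve_comp_def)
      next
        case 2
        then have "x < y" "y < z" using d le by (metis le_neq_implies_less less_irrefl)+
        then have "\<exists>c\<in>{x<..<z}. f c = d \<and> nerve_comp x y z k b a c i = 0"
          using 2 i by (auto simp: nerve_comp_def intro!: bexI[of _ y])
        then have "?L d i = 0" using d i by (simp add: DeltaN_map_arr_def)
        then show ?thesis using 2 d i by (simp add: nerve_comp_def)
      next
        case 3
        have "(\<exists>c\<in>{x<..<z}. f c = d \<and> nerve_comp x y z k b a c i = 0) \<longleftrightarrow>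
              (\<exists>c\<in>{y<..<z}. f c = d \<and> b c i = 0)" (is "?P \<longleftrightarrow> ?Q")
        proof
          assume ?P
          then obtain c where c: "x < c" "c < z" "f c = d" "nerve_comp x y z k b a c i = 0" by auto
          then have "c > y" using fle[of c] 3 by force
          then show ?Q using c by (auto simp: nerve_comp_def)
        qed (use le in \<open>force simp: nerve_comp_def\<close>)
        then show ?thesis using 3 d i by (simp add: DeltaN_map_arr_def nerve_comp_def)
      qed
    qed
    then show "farr (DeltaN_map_explicit m f) x z k (scomp (DeltaN m) x y z k b a) =
       scomp (DeltaN n) (fob (DeltaN_map_explicit m f) x) (fob (DeltaN_map_explicit m f) y)
        (fob (DeltaN_map_explicit m f) z) k (farr (DeltaN_map_explicit m f) y z k b)
        (farr (DeltaN_map_explicit m f) x y k a)"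
      using xyz am bm nerve_comp_closed[OF bm am]
      by (simp add: DeltaN_def DeltaN_map_explicit_def)
  next
    show "farr (DeltaN_map_explicit m f) x x 0 (sid (DeltaN m) x) =
        sid (DeltaN n) (fob (DeltaN_map_explicit m f) x)" if "x \<in> sob (DeltaN m)" for x
      using that
      by (auto simp: DeltaN_def DeltaN_map_explicit_def DeltaN_map_arr_def simps_nerve_hom fun_eq_iff)
  qed
  then show ?thesis
    by (auto simp: sfun_hom_def DeltaN_map_explicit_def DeltaN_def)
qed

lemma phi_closed: "a \<le> b \<Longrightarrow> phi a b \<in> simps (nerve_hom a b) 0"
  using one_mono_maps[of 0] by (auto simp: phi_def simps_nerve_hom)

lemma DeltaN_map_explicit_phi:
  assumes "f \<in> mono_maps m n" "a \<le> b" "b \<le> m"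
  shows "farr (DeltaN_map_explicit m f) a b 0 (phi a b) = phi (f a) (f b)"
  using assms phi_closed[of a b]
  by (auto simp: DeltaN_map_explicit_def DeltaN_map_arr_def phi_def fun_eq_iff)

text \<open>The 0-arrows of \<open>DeltaN m\<close> are generated under composition by the \<open>phi a b\<close>.\<close>

lemma DeltaN_eq_0:
  assumes F: "simplicial_functor (DeltaN m) C F" and G: "simplicial_functor (DeltaN m) C G"
    and ob: "\<And>a. a \<le> m \<Longrightarrow> fob F a = fob G a"
    and ph: "\<And>a b. \<lbrakk>a \<le> b; b \<le> m\<rbrakk> \<Longrightarrow> farr F a b 0 (phi a b) = farr G a b 0 (phi a b)"
  shows "\<lbrakk>b \<le> m; x \<in> simps (nerve_hom a b) 0\<rbrakk> \<Longrightarrow> farr F a b 0 x = farr G a b 0 x"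
proof (induction "b - a" arbitrary: a b x rule: less_induct)
  case less
  have ab: "a \<le> b" using less.prems by (auto simp: simps_nerve_hom split: if_splits)
  show ?case
  proof (cases "\<exists>c. a < c \<and> c < b \<and> x c 0 = 0")
    case True
    then obtain c where c: "a < c" "c < b" "x c 0 = 0" by auto
    let ?u = "restrict x {a<..<c}" and ?v = "restrict x {c<..<b}"
    have uv: "?u \<in> simps (nerve_hom a c) 0" "?v \<in> simps (nerve_hom c b) 0"
      using less.prems c by (auto simp: simps_nerve_hom PiE_iff split: if_splits)
    have x: "x = nerve_comp a c b 0 ?v ?u"
      using less.prems(2) nerve_comp_closed[OF uv(2,1)]
    proof (rule nerve_hom_ext)
      show "x d i = nerve_comp a c b 0 ?v ?u d i" if "a < d" "d < b" "i \<le> 0" for d i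
        using that c by (auto simp: nerve_comp_def)
    qed
    have IH: "farr F a c 0 ?u = farr G a c 0 ?u" "farr F c b 0 ?v = farr G c b 0 ?v"
      using less.hyps[of c a ?u] less.hyps[of b c ?v] uv c less.prems(1) by auto
    have "farr H a b 0 x = scomp C (fob H a) (fob H c) (fob H b) 0 (farr H c b 0 ?v) (farr H a c 0 ?u)"
      if "simplicial_functor (DeltaN m) C H" for H
      using simplicial_functor.arr_comp[OF that, of a c b ?v 0 ?u] uv c less.prems(1) x
      by (simp add: DeltaN_def)
    then show ?thesis using F G IH ob c less.prems(1) by simp
  next
    case False
    have "x = phi a b"
      using less.prems(2) phi_closed[OF ab]
    proof (rule nerve_hom_ext)
      fix d i assume d: "a < d" "d < b" "i \<le> (0::nat)"
      then have "x d \<in> mono_maps 0 1" using less.prems by (auto simp: simps_nerve_hom split: if_splits)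
      then have "x d 0 \<le> 1" using mono_maps_le by blast
      then show "x d i = phi a b d i" using False d by (auto simp: phi_def le_Suc_eq)
    qed
    then show ?thesis using ph ab less.prems by simp
  qed
qed

lemma nerve_hom_vertex_ext:
  assumes x: "x \<in> simps (nerve_hom a b) k" and y: "y \<in> simps (nerve_hom a b) k"
    and eq: "\<And>i. i \<le> k \<Longrightarrow> vertex (nerve_hom a b) k i x = vertex (nerve_hom a b) k i y"
  shows "x = y"
proof (rule nerve_hom_ext[OF x y])
  fix c i assume c: "a < c" "c < b" "i \<le> k"
  then have "vertex (nerve_hom a b) k i z c 0 = z c i" for z
    by (simp add: vertex_def sact_nerve_hom)
  then show "x c i = y c i" using eq[OF c(3)] by metis
qed

lemma sfun_hom_eqI:
  assumes F: "F \<in> sfun_hom C D" and G: "G \<in> sfun_hom C D"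
    and ob: "\<And>x. x \<in> sob C \<Longrightarrow> fob F x = fob G x"
    and arr: "\<And>x y n a. \<lbrakk>x \<in> sob C; y \<in> sob C; a \<in> simps (shom C x y) n\<rbrakk>
      \<Longrightarrow> farr F x y n a = farr G x y n a"
  shows "F = G"
proof -
  have "fob F x = fob G x" for x
    using F G ob by (cases "x \<in> sob C") (auto simp: sfun_hom_def)
  moreover have "farr F x y n a = farr G x y n a" for x y n a
    using F G arr
    by (cases "x \<in> sob C \<and> y \<in> sob C \<and> a \<in> simps (shom C x y) n") (auto simp: sfun_hom_def)
  ultimately show ?thesis by (intro sfun.equality ext) auto
qed

lemma DeltaN_fun_unique:
  assumes F: "F \<in> sfun_hom (DeltaN m) (DeltaN n)" and G: "G \<in> sfun_hom (DeltaN m) (DeltaN n)"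
    and ob: "\<And>a. a \<le> m \<Longrightarrow> fob F a = fob G a"
    and ph: "\<And>a b. \<lbrakk>a \<le> b; b \<le> m\<rbrakk> \<Longrightarrow> farr F a b 0 (phi a b) = farr G a b 0 (phi a b)"
  shows "F = G"
proof (rule sfun_hom_eqI[OF F G])
  show "fob F x = fob G x" if "x \<in> sob (DeltaN m)" for x
    using ob that by (simp add: DeltaN_def)
next
  fix a b k x
  assume ab: "a \<in> sob (DeltaN m)" "b \<in> sob (DeltaN m)" and x: "x \<in> simps (shom (DeltaN m) a b) k"
  have Ff: "simplicial_functor (DeltaN m) (DeltaN n) F" and Gf: "simplicial_functor (DeltaN m) (DeltaN n) G"
    using F G by (auto simp: sfun_hom_def)
  have xm: "x \<in> simps (nerve_hom a b) k" and le: "a \<le> m" "b \<le> m"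
    using ab x by (auto simp: DeltaN_def)
  have map: "simplicial_map (nerve_hom a b) (nerve_hom (fob H a) (fob H b)) (farr H a b)"
    if "simplicial_functor (DeltaN m) (DeltaN n) H" for H
    using simplicial_functor.arr_map[OF that ab] by (simp add: DeltaN_def)
  show "farr F a b k x = farr G a b k x"
  proof (rule nerve_hom_vertex_ext)
    show "farr F a b k x \<in> simps (nerve_hom (fob F a) (fob F b)) k"
      using simplicial_map.map_closed[OF map[OF Ff] xm] .
    show "farr G a b k x \<in> simps (nerve_hom (fob F a) (fob F b)) k"
      using simplicial_map.map_closed[OF map[OF Gf] xm] ob le by simp
    fix i assume i: "i \<le> k"
    have v: "(\<lambda>j\<in>{..0}. i) \<in> mono_maps 0 k" using i by (intro mono_mapsI) auto
    have "vertex (nerve_hom a b) k i x \<in> simps (nerve_hom a b) 0"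
      unfolding vertex_def using simplicial_set.act_closed[OF simplicial_set_nerve_hom v xm] .
    then have "farr F a b 0 (vertex (nerve_hom a b) k i x) = farr G a b 0 (vertex (nerve_hom a b) k i x)"
      using DeltaN_eq_0[OF Ff Gf ob ph] le by blast
    then show "vertex (nerve_hom (fob F a) (fob F b)) k i (farr F a b k x) =
        vertex (nerve_hom (fob F a) (fob F b)) k i (farr G a b k x)"
      using simplicial_map.map_natural[OF map[OF Ff] v xm] simplicial_map.map_natural[OF map[OF Gf] v xm]
        ob le by (simp add: vertex_def)
  qed
qed

theorem DeltaN_map_ex1:
  assumes f: "f \<in> mono_maps m n"
  shows "\<exists>!F. F \<in> sfun_hom (DeltaN m) (DeltaN n) \<and> (\<forall>a\<le>m. fob F a = f a) \<and>
    (\<forall>a b. a \<le> b \<and> b \<le> m \<longrightarrow> farr F a b 0 (phi a b) = phi (f a) (f b))"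
proof (rule ex_ex1I)
  show "\<exists>F. F \<in> sfun_hom (DeltaN m) (DeltaN n) \<and> (\<forall>a\<le>m. fob F a = f a) \<and>
    (\<forall>a b. a \<le> b \<and> b \<le> m \<longrightarrow> farr F a b 0 (phi a b) = phi (f a) (f b))"
    using DeltaN_map_explicit_hom[OF f] DeltaN_map_explicit_phi[OF f]
    by (intro exI[of _ "DeltaN_map_explicit m f"]) (auto simp: DeltaN_map_explicit_def)
qed (rule DeltaN_fun_unique, auto)

theorem DeltaN_map_eq_explicit:
  assumes f: "f \<in> mono_maps m n"
  shows "DeltaN_map m n f = DeltaN_map_explicit m f"
  unfolding DeltaN_map_def
  using DeltaN_map_explicit_hom[OF f] DeltaN_map_explicit_phi[OF f]
  by (intro the1_equality[OF DeltaN_map_ex1[OF f]]) (auto simp: DeltaN_map_explicit_def)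


lemma simplicial_map_comp:
  assumes "simplicial_map X Y p" "simplicial_map Y Z q"
  shows "simplicial_map X Z (\<lambda>n x. q n (p n x))"
proof -
  interpret p: simplicial_map X Y p by fact
  interpret q: simplicial_map Y Z q by fact
  show ?thesis
    by unfold_locales (auto simp: p.map_closed q.map_closed p.map_natural q.map_natural)
qed

lemma simplicial_map_cong:
  assumes "simplicial_map X Y p" "\<And>n x. x \<in> simps X n \<Longrightarrow> q n x = p n x"
  shows "simplicial_map X Y q"
proof -
  interpret p: simplicial_map X Y p by fact
  show ?thesis
    by unfold_locales (auto simp: p.map_closed p.map_natural p.X.act_closed assms(2))
qed

lemma sfun_comp_hom:
  assumes F: "simplicial_functor C D F" and G: "simplicial_functor D E G"
  shows "sfun_comp C G F \<in> sfun_hom C E"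
proof -
  interpret F: simplicial_functor C D F by fact
  interpret G: simplicial_functor D E G by fact
  have "simplicial_functor C E (sfun_comp C G F)"
  proof (intro simplicial_functor.intro simplicial_functor_axioms.intro
      F.C.simplicial_category_axioms G.D.simplicial_category_axioms)
    fix x y assume xy: "x \<in> sob C" "y \<in> sob C"
    show "simplicial_map (shom C x y) (shom E (fob (sfun_comp C G F) x) (fob (sfun_comp C G F) y))
        (farr (sfun_comp C G F) x y)"
      using xy simplicial_map_comp[OF F.arr_map[OF xy] G.arr_map[OF F.ob_closed F.ob_closed, OF xy]]
      by (auto simp: sfun_comp_def intro: simplicial_map_cong)
  next
    fix x y z n b a
    assume *: "x \<in> sob C" "y \<in> sob C" "z \<in> sob C"
      "b \<in> simps (shom C y z) n" "a \<in> simps (shom C x y) n"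
    then show "farr (sfun_comp C G F) x z n (scomp C x y z n b a) =
       scomp E (fob (sfun_comp C G F) x) (fob (sfun_comp C G F) y) (fob (sfun_comp C G F) z) n
        (farr (sfun_comp C G F) y z n b) (farr (sfun_comp C G F) x y n a)"
      using simplicial_map.map_closed[OF F.arr_map[of y z] *(4)]
        simplicial_map.map_closed[OF F.arr_map[of x y] *(5)]
      by (simp add: sfun_comp_def F.C.comp_closed F.arr_comp G.arr_comp F.ob_closed)
  qed (auto simp: sfun_comp_def F.ob_closed G.ob_closed F.C.id_closed F.arr_id G.arr_id)
  then show ?thesis by (auto simp: sfun_hom_def sfun_comp_def)
qed

lemma sfun_comp_assoc:
  assumes "simplicial_functor C D F"
  shows "sfun_comp C H (sfun_comp C G F) = sfun_comp C (sfun_comp D H G) F"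
proof -
  interpret F: simplicial_functor C D F by fact
  have "farr F x y n a \<in> simps (shom D (fob F x) (fob F y)) n"
    if "x \<in> sob C" "y \<in> sob C" "a \<in> simps (shom C x y) n" for x y n a
    using simplicial_map.map_closed[OF F.arr_map] that by blast
  then show ?thesis by (auto simp: sfun_comp_def fun_eq_iff F.ob_closed)
qed

lemma DeltaN_map_functor:
  "f \<in> mono_maps m n \<Longrightarrow> simplicial_functor (DeltaN m) (DeltaN n) (DeltaN_map m n f)"
  using DeltaN_map_explicit_hom[of f m n] by (simp add: DeltaN_map_eq_explicit sfun_hom_def)

lemma DeltaN_map_id:
  assumes s: "s \<in> sfun_hom (DeltaN n) C"
  shows "sfun_comp (DeltaN n) s (DeltaN_map n n (\<lambda>i\<in>{..n}. i)) = s"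
proof (rule sfun_hom_eqI[OF _ s])
  have S: "simplicial_functor (DeltaN n) C s" using s by (simp add: sfun_hom_def)
  show "sfun_comp (DeltaN n) s (DeltaN_map n n (\<lambda>i\<in>{..n}. i)) \<in> sfun_hom (DeltaN n) C"
    by (rule sfun_comp_hom[OF DeltaN_map_functor[OF mono_maps_id] S])
  fix a b k x
  assume ab: "a \<in> sob (DeltaN n)" "b \<in> sob (DeltaN n)" and x: "x \<in> simps (shom (DeltaN n) a b) k"
  have xm: "x \<in> simps (nerve_hom a b) k" and le: "a \<le> n" "b \<le> n"
    using ab x by (auto simp: DeltaN_def)
  have "DeltaN_map_arr (\<lambda>i\<in>{..n}. i) a b k x = x"
  proof (rule nerve_hom_ext[OF _ xm])
    show "DeltaN_map_arr (\<lambda>i\<in>{..n}. i) a b k x \<in> simps (nerve_hom a b) k"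
      using DeltaN_map_arr_closed[OF mono_maps_id le xm] le by simp
    fix d i assume d: "a < d" "d < b" "i \<le> k"
    then have "x d \<in> mono_maps k 1" using xm by (auto simp: simps_nerve_hom split: if_splits)
    then have "x d i \<le> 1" using mono_maps_le d by blast
    then show "DeltaN_map_arr (\<lambda>i\<in>{..n}. i) a b k x d i = x d i"
      using d le by (auto simp: DeltaN_map_arr_def)
  qed
  then show "farr (sfun_comp (DeltaN n) s (DeltaN_map n n (\<lambda>i\<in>{..n}. i))) a b k x = farr s a b k x"
    using ab x xm le
    by (simp add: sfun_comp_def DeltaN_map_eq_explicit[OF mono_maps_id] DeltaN_map_explicit_def)
qed (auto simp: sfun_comp_def DeltaN_map_eq_explicit[OF mono_maps_id] DeltaN_map_explicit_def DeltaN_def)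

lemma DeltaN_map_compose:
  assumes f: "f \<in> mono_maps l m" and g: "g \<in> mono_maps m n"
  shows "DeltaN_map l n (compose {..l} g f) = sfun_comp (DeltaN l) (DeltaN_map m n g) (DeltaN_map l m f)"
proof (rule DeltaN_fun_unique)
  note gf = mono_maps_compose[OF f g]
  note eqs = DeltaN_map_eq_explicit[OF f] DeltaN_map_eq_explicit[OF g] DeltaN_map_eq_explicit[OF gf]
  show "DeltaN_map l n (compose {..l} g f) \<in> sfun_hom (DeltaN l) (DeltaN n)"
    using DeltaN_map_explicit_hom[OF gf] eqs by simp
  show "sfun_comp (DeltaN l) (DeltaN_map m n g) (DeltaN_map l m f) \<in> sfun_hom (DeltaN l) (DeltaN n)"
    by (rule sfun_comp_hom[OF DeltaN_map_functor[OF f] DeltaN_map_functor[OF g]])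
  show "fob (DeltaN_map l n (compose {..l} g f)) a =
      fob (sfun_comp (DeltaN l) (DeltaN_map m n g) (DeltaN_map l m f)) a" if "a \<le> l" for a
    using that mono_maps_le[OF f]
    unfolding eqs by (simp add: sfun_comp_def DeltaN_map_explicit_def DeltaN_def compose_def)
  show "farr (DeltaN_map l n (compose {..l} g f)) a b 0 (phi a b) =
      farr (sfun_comp (DeltaN l) (DeltaN_map m n g) (DeltaN_map l m f)) a b 0 (phi a b)"
    if ab: "a \<le> b" "b \<le> l" for a b
  proof -
    have "f a \<le> f b" "f b \<le> m" using ab mono_maps_le[OF f] mono_maps_mono[OF f] by auto
    moreover have "fob (DeltaN_map_explicit l f) a = f a" "fob (DeltaN_map_explicit l f) b = f b"
      using ab by (auto simp: DeltaN_map_explicit_def)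
    ultimately show ?thesis
      using ab DeltaN_map_explicit_phi[OF gf ab] DeltaN_map_explicit_phi[OF f ab]
        DeltaN_map_explicit_phi[OF g] phi_closed[OF ab(1)]
      unfolding eqs by (simp add: sfun_comp_def DeltaN_def compose_def)
  qed
qed

theorem simplicial_set_nerve: "simplicial_set (nerve C)"
proof
  show "sact (nerve C) m n f x \<in> simps (nerve C) m"
    if "f \<in> mono_maps m n" "x \<in> simps (nerve C) n" for f m n x
    using that(2) sfun_comp_hom[OF DeltaN_map_functor[OF that(1)], of C x]
    by (simp add: nerve_def) (simp add: sfun_hom_def)
  show "sact (nerve C) n n (\<lambda>i\<in>{..n}. i) x = x" if "x \<in> simps (nerve C) n" for n x
    using that DeltaN_map_id by (auto simp: nerve_def)
  show "sact (nerve C) l n (compose {..l} g f) x = sact (nerve C) l m f (sact (nerve C) m n g x)"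
    if "f \<in> mono_maps l m" "g \<in> mono_maps m n" for l m n f g x
    using that sfun_comp_assoc[OF DeltaN_map_functor[OF that(1)]]
    by (simp add: nerve_def DeltaN_map_compose)
qed

theorem simplicial_map_nerve_map:
  assumes F: "simplicial_functor C D F"
  shows "simplicial_map (nerve C) (nerve D) (nerve_map F)"
proof (intro simplicial_map.intro simplicial_map_axioms.intro simplicial_set_nerve)
  show "nerve_map F n x \<in> simps (nerve D) n" if "x \<in> simps (nerve C) n" for n x
    using that sfun_comp_hom[OF _ F, of "DeltaN n" x]
    by (simp add: nerve_def nerve_map_def) (simp add: sfun_hom_def)
  show "nerve_map F m (sact (nerve C) m n f x) = sact (nerve D) m n f (nerve_map F n x)"
    if "f \<in> mono_maps m n" for m n f x
    using sfun_comp_assoc[OF DeltaN_map_functor[OF that]]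
    by (simp add: nerve_def nerve_map_def)
qed

lemma equiv_pi0_rel: "equiv (simps X 0) (pi0_rel X)"
proof (rule equivI)
  have "sym ((edge_rel X \<union> (edge_rel X)\<inverse>)\<^sup>*)" by (intro sym_rtrancl) (auto simp: sym_def)
  then show "sym (pi0_rel X)" by (auto simp: pi0_rel_def sym_def)
  show "trans (pi0_rel X)" by (auto simp: pi0_rel_def trans_def)
qed (auto simp: pi0_rel_def refl_on_def)

lemma pi0_rel_edge:
  assumes "simplicial_set X" "e \<in> simps X 1"
  shows "(vertex X 1 0 e, vertex X 1 1 e) \<in> pi0_rel X"
proof -
  have "vertex X 1 i e \<in> simps X 0" if "i \<le> 1" for i
    unfolding vertex_def using assms that
    by (intro simplicial_set.act_closed[OF assms(1)] mono_mapsI) auto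
  then show ?thesis using assms(2) by (force simp: pi0_rel_def edge_rel_def)
qed

lemma vertex_degenerate:
  assumes "simplicial_set X" "x \<in> simps X 0" "i \<le> 1"
  shows "vertex X 1 i (sact X 1 0 (\<lambda>j\<in>{..1}. 0) x) = x"
proof -
  have f: "(\<lambda>j\<in>{..0}. i) \<in> mono_maps 0 1" using assms(3) by (intro mono_mapsI) auto
  have "compose {..0} (\<lambda>j\<in>{..1}. 0) (\<lambda>j\<in>{..0}. i) = (\<lambda>j\<in>{..0::nat}. j)"
    using assms(3) by (auto simp: compose_def fun_eq_iff)
  then show ?thesis
    using simplicial_set.act_comp[OF assms(1) f zero_mono_maps[of 1 0] assms(2)]
      simplicial_set.act_id[OF assms(1,2)] by (simp add: vertex_def)
qed

text \<open>A map on vertices that sends edges to edges is compatible with \<open>pi0_rel\<close>.\<close>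

lemma pi0_rel_map:
  assumes X: "simplicial_set X" and Y: "simplicial_set Y"
    and cl: "\<And>x. x \<in> simps X 0 \<Longrightarrow> h x \<in> simps Y 0"
    and ed: "\<And>e. e \<in> simps X 1 \<Longrightarrow> \<exists>e'\<in>simps Y 1.
       vertex Y 1 0 e' = h (vertex X 1 0 e) \<and> vertex Y 1 1 e' = h (vertex X 1 1 e)"
    and xy: "(x, y) \<in> pi0_rel X"
  shows "(h x, h y) \<in> pi0_rel Y"
proof -
  have *: "(x, y) \<in> (edge_rel X \<union> (edge_rel X)\<inverse>)\<^sup>*" using xy by (simp add: pi0_rel_def)
  have edg: "(h u, h v) \<in> edge_rel Y" if uv: "(u, v) \<in> edge_rel X" for u v
  proof -
    obtain e where "e \<in> simps X 1" "u = vertex X 1 0 e" "v = vertex X 1 1 e"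
      using uv unfolding edge_rel_def by blast
    then obtain e' where "e' \<in> simps Y 1" "vertex Y 1 0 e' = h u" "vertex Y 1 1 e' = h v"
      using ed by blast
    then show ?thesis unfolding edge_rel_def by (intro CollectI exI[of _ e']) simp
  qed
  from * have "(h x, h y) \<in> (edge_rel Y \<union> (edge_rel Y)\<inverse>)\<^sup>*"
  proof induction
    case (step y z)
    then have "(h y, h z) \<in> edge_rel Y \<union> (edge_rel Y)\<inverse>"
      using edg by blast
    then show ?case using step.IH by (rule rtrancl_into_rtrancl[rotated])
  qed simp
  then show ?thesis using xy cl by (auto simp: pi0_rel_def)
qed

context simplicial_category
begin

lemma vertex_mono: "i \<le> 1 \<Longrightarrow> (\<lambda>j\<in>{..0}. i) \<in> mono_maps 0 1"
  by (rule mono_mapsI) auto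

lemma comp_pi0_rel:
  assumes o: "x \<in> sob C" "y \<in> sob C" "z \<in> sob C"
    and b: "(b, b') \<in> pi0_rel (shom C y z)" and a: "(a, a') \<in> pi0_rel (shom C x y)"
  shows "(scomp C x y z 0 b a, scomp C x y z 0 b' a') \<in> pi0_rel (shom C x z)"
proof -
  note xy = hom_sset[OF o(1,2)] and yz = hom_sset[OF o(2,3)] and xz = hom_sset[OF o(1,3)]
  have mem: "b \<in> simps (shom C y z) 0" "b' \<in> simps (shom C y z) 0"
    "a \<in> simps (shom C x y) 0" "a' \<in> simps (shom C x y) 0"
    using a b by (auto simp: pi0_rel_def)
  let ?s = "\<lambda>X x. sact X 1 0 (\<lambda>j\<in>{..1}. 0) x"
  have dg: "?s (shom C y z) b \<in> simps (shom C y z) 1" "?s (shom C x y) a' \<in> simps (shom C x y) 1"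
    using simplicial_set.act_closed[OF yz zero_mono_maps] simplicial_set.act_closed[OF xy zero_mono_maps]
      mem by auto
  have v: "vertex (shom C x z) 1 i (scomp C x y z 1 q p) =
      scomp C x y z 0 (vertex (shom C y z) 1 i q) (vertex (shom C x y) 1 i p)"
    if "i \<le> 1" "q \<in> simps (shom C y z) 1" "p \<in> simps (shom C x y) 1" for i p q
    using comp_natural[OF o vertex_mono[OF that(1)] that(2,3)] by (simp add: vertex_def)
  have "(scomp C x y z 0 b a, scomp C x y z 0 b a') \<in> pi0_rel (shom C x z)"
  proof (rule pi0_rel_map[OF xy xz _ _ a])
    show "\<exists>e'\<in>simps (shom C x z) 1.
       vertex (shom C x z) 1 0 e' = scomp C x y z 0 b (vertex (shom C x y) 1 0 e) \<and>
       vertex (shom C x z) 1 1 e' = scomp C x y z 0 b (vertex (shom C x y) 1 1 e)"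
      if "e \<in> simps (shom C x y) 1" for e
      using comp_closed[OF o dg(1) that] v[OF _ dg(1) that] vertex_degenerate[OF yz mem(1)]
      by (intro bexI[of _ "scomp C x y z 1 (?s (shom C y z) b) e"]) auto
  qed (use comp_closed[OF o mem(1)] in auto)
  moreover have "(scomp C x y z 0 b a', scomp C x y z 0 b' a') \<in> pi0_rel (shom C x z)"
  proof (rule pi0_rel_map[OF yz xz _ _ b])
    show "\<exists>e'\<in>simps (shom C x z) 1.
       vertex (shom C x z) 1 0 e' = scomp C x y z 0 (vertex (shom C y z) 1 0 e) a' \<and>
       vertex (shom C x z) 1 1 e' = scomp C x y z 0 (vertex (shom C y z) 1 1 e) a'"
      if "e \<in> simps (shom C y z) 1" for e
      using comp_closed[OF o that dg(2)] v[OF _ that dg(2)] vertex_degenerate[OF xy mem(4)]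
      by (intro bexI[of _ "scomp C x y z 1 e (?s (shom C x y) a')"]) auto
  qed (use comp_closed[OF o _ mem(4)] in auto)
  ultimately show ?thesis
    using equiv_pi0_rel[of "shom C x z"] by (meson equivE transD)
qed

lemma pi0_comp_class:
  assumes o: "x \<in> sob C" "y \<in> sob C" "z \<in> sob C"
    and b: "b \<in> simps (shom C y z) 0" and a: "a \<in> simps (shom C x y) 0"
  shows "ccomp (pi0_cat C) x y z (pi0_rel (shom C y z) `` {b}) (pi0_rel (shom C x y) `` {a}) =
    pi0_rel (shom C x z) `` {scomp C x y z 0 b a}"
proof -
  have *: "pi0_rel (shom C x z) `` {scomp C x y z 0 b' a'} =
      pi0_rel (shom C x z) `` {scomp C x y z 0 b a}"
    if "(b, b') \<in> pi0_rel (shom C y z)" "(a, a') \<in> pi0_rel (shom C x y)" for a' b'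
    using equiv_class_eq[OF equiv_pi0_rel comp_pi0_rel[OF o that]] by simp
  have r: "(b, b) \<in> pi0_rel (shom C y z)" "(a, a) \<in> pi0_rel (shom C x y)"
    using a b by (auto simp: pi0_rel_def)
  have "(\<Union>b'\<in>pi0_rel (shom C y z) `` {b}. \<Union>a'\<in>pi0_rel (shom C x y) `` {a}.
      pi0_rel (shom C x z) `` {scomp C x y z 0 b' a'}) = pi0_rel (shom C x z) `` {scomp C x y z 0 b a}"
    (is "(\<Union>b'\<in>?B. \<Union>a'\<in>?A. ?S b' a') = ?T")
  proof -
    have "?S b' a' = ?T" if "b' \<in> ?B" "a' \<in> ?A" for a' b' using * that by simp
    moreover have "b \<in> ?B" "a \<in> ?A" using r by auto
    ultimately show ?thesis by blast
  qed
  then show ?thesis unfolding pi0_cat_def by simp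
qed

theorem category_pi0_cat: "category (pi0_cat C)"
proof -
  have cl: "\<exists>a\<in>simps (shom C x y) 0. A = pi0_rel (shom C x y) `` {a}"
    if "A \<in> chom (pi0_cat C) x y" for A x y
    using that by (auto simp: pi0_cat_def pi0_def elim!: quotientE)
  have cl': "pi0_rel (shom C x y) `` {a} \<in> chom (pi0_cat C) x y"
    if "a \<in> simps (shom C x y) 0" for a x y
    using that by (auto simp: pi0_cat_def pi0_def quotientI)
  have ob: "cob (pi0_cat C) = sob C" and idd: "cid (pi0_cat C) x = pi0_rel (shom C x x) `` {sid C x}" for x
    by (auto simp: pi0_cat_def)
  have sid0: "sidn C x 0 = sid C x" if "x \<in> sob C" for x
    using simplicial_set.act_id[OF hom_sset[OF that that] id_closed[OF that]]
    by (auto simp: sidn_def restrict_def cong: if_cong)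
  show ?thesis
  proof (rule category.intro; unfold ob idd)
    show "ccomp (pi0_cat C) x y z g f \<in> chom (pi0_cat C) x z"
      if "x \<in> sob C" "y \<in> sob C" "z \<in> sob C" "g \<in> chom (pi0_cat C) y z" "f \<in> chom (pi0_cat C) x y"
      for x y z g f
      using cl[OF that(4)] cl[OF that(5)] that
      by (auto simp: pi0_comp_class intro!: cl' comp_closed)
    show "ccomp (pi0_cat C) w y z h (ccomp (pi0_cat C) w x y g f) =
        ccomp (pi0_cat C) w x z (ccomp (pi0_cat C) x y z h g) f"
      if "w \<in> sob C" "x \<in> sob C" "y \<in> sob C" "z \<in> sob C"
        "h \<in> chom (pi0_cat C) y z" "g \<in> chom (pi0_cat C) x y" "f \<in> chom (pi0_cat C) w x"
      for w x y z h g f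
      using cl[OF that(5)] cl[OF that(6)] cl[OF that(7)] that
      by (auto simp: pi0_comp_class comp_closed comp_assoc)
    show "ccomp (pi0_cat C) x y y (pi0_rel (shom C y y) `` {sid C y}) f = f"
      if "x \<in> sob C" "y \<in> sob C" "f \<in> chom (pi0_cat C) x y" for x y f
      using cl[OF that(3)] that comp_id_left[of x y _ 0]
      by (auto simp: pi0_comp_class id_closed sid0)
    show "ccomp (pi0_cat C) x x y f (pi0_rel (shom C x x) `` {sid C x}) = f"
      if "x \<in> sob C" "y \<in> sob C" "f \<in> chom (pi0_cat C) x y" for x y f
      using cl[OF that(3)] that comp_id_right[of x y _ 0]
      by (auto simp: pi0_comp_class id_closed sid0)
  qed (auto intro!: cl' id_closed)
qed

end

end

theory Submission
  imports Defs
begin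

text \<open>
  A simplex of dimension \<open>n\<close> of the homotopy coherent nerve of \<open>C\<close> consists of objects
  \<open>x\<^sub>0, \<dots>, x\<^sub>n\<close> and of cubes \<open>W a b: I^(a,b) \<rightarrow> Hom(x\<^sub>a, x\<^sub>b)\<close> for \<open>a < b\<close> such that, on the face
  \<open>z\<^sub>c = 0\<close>, the cube \<open>W a b\<close> is the composite of \<open>W c b\<close> and \<open>W a c\<close> (\<open>nerve_simplex\<close>,
  \<open>nerve_fun_hom\<close>).  The face \<open>z\<^sub>c = 1\<close> of \<open>W a b\<close> belongs to the facet of the simplex opposite to the
  vertex \<open>c\<close>.  A horn in the nerve therefore gives some of these cubes and some faces of the others,
  and lifting the horn is a lifting problem for cubes along the Kan fibrations
  \<open>Hom(x, y) \<rightarrow> Hom(F x, F y)\<close>; this is made precise in \<open>assemble\<close>.  Three cases arise.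

  If \<open>0 < k < n\<close>, only \<open>W 0 n\<close> is incomplete, and what is missing is its interior and its face
  \<open>z\<^sub>k = 1\<close>.  Kan fibrations lift such open boxes, because the cube is obtained from the box by
  attaching simplices along horns (\<open>prism_induct\<close>, \<open>box_lift\<close>).

  If \<open>k = 0\<close> and \<open>n \<ge> 2\<close>, the whole facet opposite to the vertex \<open>0\<close> is missing: the cube \<open>W 1 n\<close> is
  known only on its boundary, and \<open>W 0 n\<close> lacks its face \<open>z\<^sub>1 = 0\<close>, which has to be the composite of
  \<open>W 1 n\<close> with the first edge \<open>\<alpha> = W 0 1\<close>.  Since \<open>C\<close> is a fibrant groupoid, \<open>\<alpha>\<close> has a homotopy inverse
  \<open>\<beta>\<close>, and the homotopies \<open>\<eta>: \<alpha>\<beta> \<simeq> 1\<close> and \<open>\<epsilon>: \<beta>\<alpha> \<simeq> 1\<close> can be chosen such that \<open>\<eta>\<alpha>\<close> and \<open>\<alpha>\<epsilon>\<close> are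
  homotopic (\<open>coherent_homotopy_inverse\<close>).  Fill \<open>W 0 n\<close> first as an open box, with some face \<open>H0\<close> in
  the missing place.  Deform \<open>H0 \<beta>\<close> along \<open>\<eta>\<close> to a cube \<open>U\<close> with the right boundary.  By the
  choice of \<open>\<epsilon>\<close>, the cubes \<open>H0\<close> and \<open>U\<alpha>\<close> are homotopic relative to the boundary, and attaching this
  homotopy to the filler makes \<open>U\<alpha>\<close> its face.  All these homotopies are lifted from \<open>D\<close>, so that the
  result lies over the given cubes (\<open>extend_along_equivalence\<close>).  The case \<open>k = n\<close> is dual.

  If \<open>n = 1\<close>, an edge of the nerve of \<open>D\<close> has to be lifted with one end given.  For the source this
  is the lifting of homotopy equivalences in a weak fibration.  For the target, an inverse \<open>\<beta>\<close> of
  the edge is lifted instead, an inverse of the lift lies over the edge up to homotopy, and the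
  homotopy is lifted along a Kan fibration (\<open>kan_fibration_lift_component\<close>).
\<close>

section \<open>Building a prism by filling horns\<close>

definition chains :: "('v \<Rightarrow> 'v \<Rightarrow> bool) \<Rightarrow> 'v set \<Rightarrow> 'v set set" where
  "chains le V = {\<sigma>. \<sigma> \<subseteq> V \<and> \<sigma> \<noteq> {} \<and> (\<forall>A\<in>\<sigma>. \<forall>B\<in>\<sigma>. le A B \<or> le B A)}"

definition down_closed :: "'v set set \<Rightarrow> bool" where
  "down_closed \<A> \<longleftrightarrow> (\<forall>\<sigma>\<in>\<A>. \<forall>\<tau>. \<tau> \<subseteq> \<sigma> \<and> \<tau> \<noteq> {} \<longrightarrow> \<tau> \<in> \<A>)"

text \<open>
  A combinatorial model of a cube with a distinguished direction: \<open>V\<close> are its vertices, \<open>lev\<close>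
  marks those of the upper face, and \<open>flip\<close> moves a vertex of the upper face to the vertex of the
  lower face below it.  Nondegenerate simplices are chains of vertices.  The subcomplex \<open>Box\<close>
  contains the lower face and, with a vertex of the upper face, also its projection to the lower
  face; so it models an open box whose missing face is the upper one.
\<close>

locale prism =
  fixes V :: "'v set" and le :: "'v \<Rightarrow> 'v \<Rightarrow> bool" and lev :: "'v \<Rightarrow> bool" and flip :: "'v \<Rightarrow> 'v"
    and Box :: "'v set set"
  assumes fin: "finite V"
    and le_refl: "A \<in> V \<Longrightarrow> le A A"
    and le_antisym: "\<lbrakk>A \<in> V; B \<in> V; le A B; le B A\<rbrakk> \<Longrightarrow> A = B"
    and le_trans: "\<lbrakk>A \<in> V; B \<in> V; D \<in> V; le A B; le B D\<rbrakk> \<Longrightarrow> le A D"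
    and lev_up: "\<lbrakk>A \<in> V; B \<in> V; le A B; lev A\<rbrakk> \<Longrightarrow> lev B"
    and flip_V: "\<lbrakk>A \<in> V; lev A\<rbrakk> \<Longrightarrow> flip A \<in> V"
    and flip_lev: "\<lbrakk>A \<in> V; lev A\<rbrakk> \<Longrightarrow> \<not> lev (flip A)"
    and flip_le: "\<lbrakk>A \<in> V; lev A\<rbrakk> \<Longrightarrow> le (flip A) A"
    and flip_greatest: "\<lbrakk>A \<in> V; B \<in> V; lev A; \<not> lev B; le B A\<rbrakk> \<Longrightarrow> le B (flip A)"
    and Box_chains: "Box \<subseteq> chains le V"
    and Box_down: "down_closed Box"
    and Box_lev: "\<lbrakk>\<sigma> \<in> chains le V; \<And>A. A \<in> \<sigma> \<Longrightarrow> \<not> lev A\<rbrakk> \<Longrightarrow> \<sigma> \<in> Box"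
    and Box_flip: "\<lbrakk>\<sigma> \<in> Box; A \<in> \<sigma>; lev A; insert (flip A) \<sigma> \<in> chains le V\<rbrakk>
      \<Longrightarrow> insert (flip A) \<sigma> \<in> Box"
begin

definition low :: "'v set \<Rightarrow> 'v \<Rightarrow> bool" where
  "low \<sigma> A \<longleftrightarrow> A \<in> \<sigma> \<and> lev A \<and> (\<forall>B\<in>\<sigma>. lev B \<longrightarrow> le A B)"

lemma chain_finite: "\<sigma> \<in> chains le V \<Longrightarrow> finite \<sigma>"
  using fin finite_subset by (auto simp: chains_def)

lemma low_exists:
  assumes s: "\<sigma> \<in> chains le V" and B0: "B0 \<in> \<sigma>" "lev B0"
  shows "\<exists>A. low \<sigma> A"
proof -
  have sV: "\<sigma> \<subseteq> V" and tot: "\<And>A B. A \<in> \<sigma> \<Longrightarrow> B \<in> \<sigma> \<Longrightarrow> le A B \<or> le B A"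
    using s by (auto simp: chains_def)
  let ?below = "\<lambda>A. {D \<in> \<sigma>. le D A}"
  obtain A where A: "A \<in> \<sigma>" "lev A"
    and least: "\<And>B. B \<in> \<sigma> \<Longrightarrow> lev B \<Longrightarrow> card (?below A) \<le> card (?below B)"
    using ex_has_least_nat[of "\<lambda>A. A \<in> \<sigma> \<and> lev A" B0 "\<lambda>A. card (?below A)"] B0 by auto
  have "le A B" if B: "B \<in> \<sigma>" "lev B" for B
  proof (rule ccontr)
    assume n: "\<not> le A B"
    then have BA: "le B A" using tot A B by blast
    have "?below B \<subset> ?below A"
    proof
      show "?below B \<subseteq> ?below A" using le_trans[OF _ _ _ _ BA] A B sV by auto
      show "?below B \<noteq> ?below A" using n A le_refl sV by auto
    qed
    then have "card (?below B) < card (?below A)"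
      using chain_finite[OF s] by (intro psubset_card_mono) auto
    then show False using least[OF B] by simp
  qed
  then show ?thesis using A by (auto simp: low_def)
qed

lemma low_unique: "\<lbrakk>\<sigma> \<subseteq> V; low \<sigma> A; low \<sigma> B\<rbrakk> \<Longrightarrow> A = B"
  by (auto simp: low_def intro: le_antisym)

text \<open>
  Below the lowest upper vertex \<open>A\<close> the chain runs in the lower face, and \<open>flip A\<close> is the greatest
  vertex of the lower face under \<open>A\<close>; so it fits between these vertices and \<open>A\<close>.
\<close>

lemma insert_flip_chain:
  assumes s: "\<sigma> \<in> chains le V" and l: "low \<sigma> A"
  shows "insert (flip A) \<sigma> \<in> chains le V"
proof -
  have sV: "\<sigma> \<subseteq> V" and tot: "\<And>A B. A \<in> \<sigma> \<Longrightarrow> B \<in> \<sigma> \<Longrightarrow> le A B \<or> le B A"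
    using s by (auto simp: chains_def)
  have A: "A \<in> \<sigma>" "A \<in> V" "lev A" using l sV by (auto simp: low_def)
  have fA: "flip A \<in> V" using A flip_V by blast
  have "le (flip A) B \<or> le B (flip A)" if B: "B \<in> \<sigma>" for B
  proof (cases "lev B")
    case True
    then have "le A B" using l B by (simp add: low_def)
    then show ?thesis using le_trans[OF fA A(2) _ flip_le] A B sV by blast
  next
    case False
    then have "le B A" using tot[OF A(1) B] lev_up A B sV by blast
    then show ?thesis using flip_greatest A B sV False by blast
  qed
  then show ?thesis using s fA le_refl by (auto simp: chains_def)
qed

lemma low_insert_flip: "\<lbrakk>low \<sigma> A; \<sigma> \<subseteq> V\<rbrakk> \<Longrightarrow> low (insert (flip A) \<sigma>) A"
  using flip_lev by (auto simp: low_def)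

text \<open>
  Attaching a simplex \<open>T\<close> along the horn opposite to its vertex \<open>a\<close> adds exactly \<open>T\<close> and its
  facet \<open>T - {a}\<close>.
\<close>

definition attachable :: "'v set set \<Rightarrow> 'v set \<Rightarrow> 'v \<Rightarrow> bool" where
  "attachable \<A> T a \<longleftrightarrow> down_closed \<A> \<and> Box \<subseteq> \<A> \<and> \<A> \<subseteq> chains le V \<and> T \<in> chains le V \<and> a \<in> T \<and>
     T - {a} \<noteq> {} \<and> T \<notin> \<A> \<and> T - {a} \<notin> \<A> \<and> (\<forall>b\<in>T - {a}. T - {b} \<in> \<A>)"

text \<open>
  The simplices outside the box have a lowest upper vertex \<open>A\<close>, and adding or removing \<open>flip A\<close>
  groups them in pairs \<open>\<sigma>\<close>, \<open>T = \<sigma> \<union> {flip A}\<close>.  The pairs are attached in the order of the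
  cardinality of \<open>\<sigma>\<close> and then of the number of its upper vertices.  Then \<open>\<sigma>\<close> is the only facet of
  \<open>T\<close> that is still absent: removing \<open>A\<close> lowers the number of upper vertices, and
  removing another vertex \<open>b\<close> of \<open>\<sigma>\<close> gives the partner of the smaller simplex \<open>\<sigma> - {b}\<close>.
\<close>

theorem prism_induct:
  assumes base: "Q Box"
    and step: "\<And>\<A> T a. \<lbrakk>attachable \<A> T a; Q \<A>\<rbrakk> \<Longrightarrow> Q (\<A> \<union> {T, T - {a}})"
  shows "Q (chains le V)"
proof -
  \<comment> \<open>The last condition of \<open>good\<close> says that the two members of a pair are attached together.\<close>
  define good where "good \<A> \<longleftrightarrow> down_closed \<A> \<and> Box \<subseteq> \<A> \<and> \<A> \<subseteq> chains le V \<and>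
    (\<forall>\<sigma>\<in>\<A>. \<forall>A. low \<sigma> A \<longrightarrow> insert (flip A) \<sigma> \<in> \<A>)" for \<A>
  have finC: "finite (chains le V)"
    by (rule finite_subset[of _ "Pow V"]) (auto simp: chains_def fin)
  have "Q (chains le V)" if "good \<A>" "Q \<A>" for \<A>
    using that
  proof (induction "card (chains le V - \<A>)" arbitrary: \<A> rule: less_induct)
    case less
    have dc: "down_closed \<A>" and Box\<A>: "Box \<subseteq> \<A>" and \<A>C: "\<A> \<subseteq> chains le V"
      and fl: "\<And>\<sigma> A. \<sigma> \<in> \<A> \<Longrightarrow> low \<sigma> A \<Longrightarrow> insert (flip A) \<sigma> \<in> \<A>"
      using less.prems(1) by (auto simp: good_def)
    show ?case
    proof (cases "\<A> = chains le V")
      case True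
      then show ?thesis using less.prems by simp
    next
      case False
      let ?new = "\<lambda>\<sigma>. \<sigma> \<in> chains le V \<and> \<sigma> \<notin> \<A>"
      let ?lev = "\<lambda>\<sigma>. card {B \<in> \<sigma>. lev B}"
      obtain \<sigma>0 where s0: "?new \<sigma>0" using False \<A>C by blast
      obtain \<sigma>1 where s1: "?new \<sigma>1" "\<And>\<tau>. ?new \<tau> \<Longrightarrow> card \<sigma>1 \<le> card \<tau>"
        using ex_has_least_nat[of ?new, OF s0] by blast
      obtain \<sigma> where s: "?new \<sigma>" "card \<sigma> = card \<sigma>1"
        and lv: "\<And>\<tau>. ?new \<tau> \<Longrightarrow> card \<tau> = card \<sigma>1 \<Longrightarrow> ?lev \<sigma> \<le> ?lev \<tau>"
        using ex_has_least_nat[of "\<lambda>\<tau>. ?new \<tau> \<and> card \<tau> = card \<sigma>1" \<sigma>1 ?lev] s1(1) by blast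
      have small: "\<tau> \<in> \<A>" if "\<tau> \<in> chains le V" "card \<tau> < card \<sigma>" for \<tau>
        using s1(2)[of \<tau>] s(2) that by auto
      have sC: "\<sigma> \<in> chains le V" and sV: "\<sigma> \<subseteq> V" using s by (auto simp: chains_def)
      have fs: "finite \<sigma>" using chain_finite[OF sC] .
      have sub: "\<tau> \<in> chains le V" if "\<tau> \<subseteq> \<rho>" "\<tau> \<noteq> {}" "\<rho> \<in> chains le V" for \<tau> \<rho>
        using that by (auto simp: chains_def)
      have "\<exists>B\<in>\<sigma>. lev B" using Box_lev[OF sC] Box\<A> s(1) by blast
      then obtain A where A: "low \<sigma> A" using low_exists[OF sC] by blast
      then have A\<sigma>: "A \<in> \<sigma>" and lA: "lev A" and AV: "A \<in> V" using sV by (auto simp: low_def)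
      have nlf: "\<not> lev (flip A)" using flip_lev AV lA by blast
      have drop: "low (\<sigma> - {b}) A \<and> \<sigma> - {b} \<in> \<A>" if "b \<in> \<sigma>" "b \<noteq> A" for b
      proof
        show "low (\<sigma> - {b}) A" using A that by (auto simp: low_def)
        show "\<sigma> - {b} \<in> \<A>"
        proof (rule small)
          show "\<sigma> - {b} \<in> chains le V" using sub[OF _ _ sC, of "\<sigma> - {b}"] A\<sigma> that by blast
          show "card (\<sigma> - {b}) < card \<sigma>" using fs that by (meson card_Diff1_less)
        qed
      qed
      have fn: "flip A \<notin> \<sigma>"
      proof
        assume f: "flip A \<in> \<sigma>"
        have "flip A \<noteq> A" using nlf lA by auto
        then have "insert (flip A) (\<sigma> - {flip A}) \<in> \<A>" using fl drop[OF f] by blast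
        then show False using f s(1) by (simp add: insert_absorb)
      qed
      let ?T = "insert (flip A) \<sigma>"
      have TC: "?T \<in> chains le V" by (rule insert_flip_chain[OF sC A])
      have Ts: "?T - {flip A} = \<sigma>" using fn by auto
      have facet: "?T - {b} \<in> \<A>" if b: "b \<in> \<sigma>" for b
      proof (cases "b = A")
        case True
        have ne: "b \<noteq> flip A" using b fn by auto
        have c: "?T - {b} \<in> chains le V" using sub[OF _ _ TC, of "?T - {b}"] ne by blast
        have "card (?T - {b}) = card \<sigma>" using b fs fn by simp
        moreover have "{B \<in> ?T - {b}. lev B} = {B \<in> \<sigma>. lev B} - {A}" using nlf True by auto
        then have "?lev (?T - {b}) < ?lev \<sigma>"
          using A\<sigma> lA fs by (intro psubset_card_mono) auto
        ultimately show ?thesis using lv[of "?T - {b}"] c s(2) by auto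
      next
        case False
        then have "insert (flip A) (\<sigma> - {b}) \<in> \<A>" using fl drop[OF b] by blast
        moreover have "insert (flip A) (\<sigma> - {b}) = ?T - {b}" using fn b by auto
        ultimately show ?thesis by simp
      qed
      have Tn: "?T \<notin> \<A>" using dc s(1) A\<sigma> by (auto simp: down_closed_def)
      have att: "attachable \<A> ?T (flip A)"
        unfolding attachable_def Ts using dc Box\<A> \<A>C TC Tn s(1) facet A\<sigma> by auto
      let ?A' = "\<A> \<union> {?T, \<sigma>}"
      have "good ?A'"
        unfolding good_def
      proof (intro conjI)
        show "down_closed ?A'"
          unfolding down_closed_def
        proof (intro ballI allI impI)
          fix \<rho> \<tau> assume r: "\<rho> \<in> ?A'" and t: "\<tau> \<subseteq> \<rho> \<and> \<tau> \<noteq> {}"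
          show "\<tau> \<in> ?A'"
          proof (cases "\<rho> \<in> \<A>")
            case True
            then show ?thesis using dc t by (auto simp: down_closed_def)
          next
            case False
            then have tT: "\<tau> \<subseteq> ?T" using r t by auto
            show ?thesis
            proof (cases "\<sigma> \<subseteq> \<tau>")
              case True
              then have "\<tau> = \<sigma> \<or> \<tau> = ?T" using tT by auto
              then show ?thesis by auto
            next
              case False
              then obtain b where "b \<in> \<sigma>" "\<tau> \<subseteq> ?T - {b}" using tT by auto
              then show ?thesis using dc facet t unfolding down_closed_def by blast
            qed
          qed
        qed
        show "\<forall>\<rho>\<in>?A'. \<forall>B. low \<rho> B \<longrightarrow> insert (flip B) \<rho> \<in> ?A'"
        proof (intro ballI allI impI)
          fix \<rho> B assume r: "\<rho> \<in> ?A'" and B: "low \<rho> B"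
          show "insert (flip B) \<rho> \<in> ?A'"
          proof (cases "\<rho> \<in> \<A>")
            case False
            moreover have "?T \<subseteq> V" using TC by (simp add: chains_def)
            ultimately have "B = A"
              using r B low_unique[of ?T B A] low_unique[of \<sigma> B A] A sV low_insert_flip[OF A sV] by auto
            then show ?thesis using r False by auto
          qed (use fl B in auto)
        qed
      qed (use Box\<A> \<A>C TC sC in auto)
      moreover have "Q ?A'" using step[OF att less.prems(2)] Ts by simp
      moreover have "card (chains le V - ?A') < card (chains le V - \<A>)"
        using s(1) finC by (intro psubset_card_mono) auto
      ultimately show ?thesis using less.hyps by blast
    qed
  qed
  moreover have "good Box"
    unfolding good_def
  proof (intro conjI ballI allI impI)
    fix \<sigma> A assume "\<sigma> \<in> Box" "low \<sigma> A"
    moreover then have "insert (flip A) \<sigma> \<in> chains le V" using insert_flip_chain Box_chains by blast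
    ultimately show "insert (flip A) \<sigma> \<in> Box" using Box_flip by (auto simp: low_def)
  qed (use Box_down Box_chains in auto)
  ultimately show ?thesis using base by blast
qed

end

section \<open>Cubes\<close>

definition cube :: "nat set \<Rightarrow> (nat \<Rightarrow> nat \<Rightarrow> nat) sset" where
  "cube T = sset_power T (std_simplex 1)"

lemma simps_cube: "simps (cube T) m = T \<rightarrow>\<^sub>E mono_maps m 1"
  by (simp add: cube_def sset_power_def std_simplex_def)

lemma sact_cube: "sact (cube T) l m f z = (\<lambda>c\<in>T. compose {..l} (z c) f)"
  by (simp add: cube_def sset_power_def std_simplex_def)

lemma simplicial_set_cube: "simplicial_set (cube T)"
  by (simp add: cube_def simplicial_set_power simplicial_set_std_simplex)

lemma cube_coord: "\<lbrakk>z \<in> simps (cube T) m; c \<in> T\<rbrakk> \<Longrightarrow> z c \<in> mono_maps m 1"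
  by (auto simp: simps_cube)

lemma cube_le1: "\<lbrakk>z \<in> simps (cube T) m; c \<in> T; i \<le> m\<rbrakk> \<Longrightarrow> z c i \<le> 1"
  using cube_coord mono_maps_le by blast

lemma sact_cube_closed:
  "\<lbrakk>f \<in> mono_maps l m; z \<in> simps (cube T) m\<rbrakk> \<Longrightarrow> sact (cube T) l m f z \<in> simps (cube T) l"
  using simplicial_set.act_closed[OF simplicial_set_cube] by blast

text \<open>
  A function that is natural on the simplices of a cube satisfying the predicate \<open>D\<close>.  When \<open>D\<close>
  is stable under the simplicial operators, this is a simplicial map out of a subcomplex.
\<close>

definition natural_on ::
  "nat set \<Rightarrow> (nat \<Rightarrow> (nat \<Rightarrow> nat \<Rightarrow> nat) \<Rightarrow> bool) \<Rightarrow> 'a sset \<Rightarrow>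
    (nat \<Rightarrow> (nat \<Rightarrow> nat \<Rightarrow> nat) \<Rightarrow> 'a) \<Rightarrow> bool" where
  "natural_on T D X \<phi> \<longleftrightarrow> (\<forall>m. \<forall>z\<in>simps (cube T) m. D m z \<longrightarrow>
     \<phi> m z \<in> simps X m \<and>
     (\<forall>l. \<forall>f\<in>mono_maps l m. \<phi> l (sact (cube T) l m f z) = sact X l m f (\<phi> m z)))"

abbreviation whole :: "nat \<Rightarrow> (nat \<Rightarrow> nat \<Rightarrow> nat) \<Rightarrow> bool" where
  "whole \<equiv> \<lambda>m z. True"

text \<open>
  Stable predicates describe subcomplexes of the cube.
\<close>

definition stable :: "nat set \<Rightarrow> (nat \<Rightarrow> (nat \<Rightarrow> nat \<Rightarrow> nat) \<Rightarrow> bool) \<Rightarrow> bool" where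
  "stable T D \<longleftrightarrow> (\<forall>m. \<forall>z\<in>simps (cube T) m. D m z \<longrightarrow>
     (\<forall>l. \<forall>f\<in>mono_maps l m. D l (sact (cube T) l m f z)))"

lemma natural_on_closed: "\<lbrakk>natural_on T D X \<phi>; z \<in> simps (cube T) m; D m z\<rbrakk> \<Longrightarrow> \<phi> m z \<in> simps X m"
  by (auto simp: natural_on_def)

lemma natural_on_sact:
  "\<lbrakk>natural_on T D X \<phi>; z \<in> simps (cube T) m; D m z; f \<in> mono_maps l m\<rbrakk>
    \<Longrightarrow> \<phi> l (sact (cube T) l m f z) = sact X l m f (\<phi> m z)"
  by (auto simp: natural_on_def)

lemma natural_on_whole:
  "simplicial_map (cube T) X \<phi> \<longleftrightarrow> simplicial_set X \<and> natural_on T whole X \<phi>"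
  by (auto simp: natural_on_def simplicial_map_def simplicial_map_axioms_def simplicial_set_cube)

definition face :: "nat \<Rightarrow> nat \<Rightarrow> nat \<Rightarrow> (nat \<Rightarrow> nat \<Rightarrow> nat) \<Rightarrow> bool" where
  "face c e m z \<longleftrightarrow> (\<forall>i\<le>m. z c i = e)"

definition bdry :: "nat set \<Rightarrow> nat \<Rightarrow> (nat \<Rightarrow> nat \<Rightarrow> nat) \<Rightarrow> bool" where
  "bdry T m z \<longleftrightarrow> (\<exists>c\<in>T. face c 0 m z \<or> face c 1 m z)"

text \<open>All the faces of the cube except the face \<open>z\<^sub>k = e\<close>.\<close>

definition obox :: "nat set \<Rightarrow> nat \<Rightarrow> nat \<Rightarrow> nat \<Rightarrow> (nat \<Rightarrow> nat \<Rightarrow> nat) \<Rightarrow> bool" where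
  "obox T k e m z \<longleftrightarrow> bdry (T - {k}) m z \<or> face k (1 - e) m z"

lemma face_sact: "\<lbrakk>face c e m z; c \<in> T; f \<in> mono_maps l m\<rbrakk> \<Longrightarrow> face c e l (sact (cube T) l m f z)"
  by (auto simp: face_def sact_cube compose_def mono_maps_le)

lemma bdry_sact:
  "\<lbrakk>bdry S m z; S \<subseteq> T; f \<in> mono_maps l m\<rbrakk> \<Longrightarrow> bdry S l (sact (cube T) l m f z)"
  unfolding bdry_def using face_sact by blast

subsection \<open>Vertices of a simplex of a cube\<close>

text \<open>
  The vertices of the cube are the subsets of \<open>T\<close>.  A simplex of the cube is a weakly increasing
  sequence of them, and its set of vertices decides to which subcomplexes it belongs.
\<close>

definition vert :: "nat set \<Rightarrow> (nat \<Rightarrow> nat \<Rightarrow> nat) \<Rightarrow> nat \<Rightarrow> nat set" where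
  "vert T z i = {c \<in> T. z c i = 1}"

definition verts :: "nat set \<Rightarrow> nat \<Rightarrow> (nat \<Rightarrow> nat \<Rightarrow> nat) \<Rightarrow> nat set set" where
  "verts T m z = vert T z ` {..m}"

lemma vert_mono: "\<lbrakk>z \<in> simps (cube T) m; i \<le> j; j \<le> m\<rbrakk> \<Longrightarrow> vert T z i \<subseteq> vert T z j"
  unfolding vert_def
proof clarify
  fix c assume z: "z \<in> simps (cube T) m" and ij: "i \<le> j" "j \<le> m" and c: "c \<in> T" "z c i = 1"
  have "z c i \<le> z c j" using mono_maps_mono[OF cube_coord[OF z c(1)] ij] .
  then show "z c j = 1" using cube_le1[OF z c(1) ij(2)] c(2) by simp
qed

lemma chainsI:
  "\<lbrakk>\<sigma> \<subseteq> V; \<sigma> \<noteq> {}; \<And>A B. \<lbrakk>A \<in> \<sigma>; B \<in> \<sigma>\<rbrakk> \<Longrightarrow> le A B \<or> le B A\<rbrakk> \<Longrightarrow> \<sigma> \<in> chains le V"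
  by (simp add: chains_def)

lemma chains_subset: "\<lbrakk>\<sigma> \<in> chains le V; \<tau> \<subseteq> \<sigma>; \<tau> \<noteq> {}\<rbrakk> \<Longrightarrow> \<tau> \<in> chains le V"
  by (auto simp: chains_def)

lemma chainsD:
  assumes "\<sigma> \<in> chains le V"
  shows "\<sigma> \<subseteq> V" "\<lbrakk>A \<in> \<sigma>; B \<in> \<sigma>\<rbrakk> \<Longrightarrow> le A B \<or> le B A"
  using assms by (auto simp: chains_def)

lemma verts_chain: "z \<in> simps (cube T) m \<Longrightarrow> verts T m z \<in> chains (\<subseteq>) (Pow T)"
proof -
  assume z: "z \<in> simps (cube T) m"
  have "vert T z i \<subseteq> vert T z j \<or> vert T z j \<subseteq> vert T z i" if "i \<le> m" "j \<le> m" for i j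
    using vert_mono[OF z, of i j] vert_mono[OF z, of j i] that by linarith
  moreover have "verts T m z \<subseteq> Pow T" "verts T m z \<noteq> {}" by (auto simp: verts_def vert_def)
  ultimately show ?thesis
  proof (intro chainsI)
    fix A B assume "A \<in> verts T m z" "B \<in> verts T m z"
    then obtain i j where "A = vert T z i" "B = vert T z j" "i \<le> m" "j \<le> m"
      unfolding verts_def by blast
    then show "A \<subseteq> B \<or> B \<subseteq> A"
      using \<open>\<And>j i. \<lbrakk>i \<le> m; j \<le> m\<rbrakk> \<Longrightarrow> vert T z i \<subseteq> vert T z j \<or> vert T z j \<subseteq> vert T z i\<close> by simp
  qed
qed

lemma vert_sact: "i \<le> l \<Longrightarrow> vert T (sact (cube T) l m f z) i = vert T z (f i)"
  by (auto simp: vert_def sact_cube compose_def)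

lemma verts_sact: "verts T l (sact (cube T) l m f z) = (\<lambda>i. vert T z (f i)) ` {..l}"
  unfolding verts_def by (intro image_cong) (auto simp: vert_sact)

lemma verts_sact_subset: "f \<in> mono_maps l m \<Longrightarrow> verts T l (sact (cube T) l m f z) \<subseteq> verts T m z"
  unfolding verts_sact by (auto simp: verts_def mono_maps_le)

lemma cube_ext:
  assumes z: "z \<in> simps (cube T) m" and z': "z' \<in> simps (cube T) m"
    and eq: "\<And>i. i \<le> m \<Longrightarrow> vert T z i = vert T z' i"
  shows "z = z'"
proof (rule extensionalityI[of _ T])
  show "z c = z' c" if c: "c \<in> T" for c
  proof (rule mono_maps_ext[OF cube_coord[OF z c] cube_coord[OF z' c]])
    fix i assume i: "i \<le> m"
    have "z c i = 1 \<longleftrightarrow> z' c i = 1" using eq[OF i] c by (auto simp: vert_def)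
    then show "z c i = z' c i" using cube_le1[OF z c i] cube_le1[OF z' c i] by linarith
  qed
qed (use z z' in \<open>auto simp: simps_cube PiE_iff\<close>)

lemma face_verts:
  assumes "z \<in> simps (cube T) m" "c \<in> T"
  shows "face c 0 m z \<longleftrightarrow> (\<forall>A\<in>verts T m z. c \<notin> A)" "face c 1 m z \<longleftrightarrow> (\<forall>A\<in>verts T m z. c \<in> A)"
  using assms cube_le1[OF assms] by (force simp: face_def verts_def vert_def)+

definition box_chains :: "nat set \<Rightarrow> nat \<Rightarrow> nat \<Rightarrow> nat set set set" where
  "box_chains T k e = {\<sigma> \<in> chains (\<subseteq>) (Pow T).
     (\<exists>c\<in>T - {k}. (\<forall>A\<in>\<sigma>. c \<notin> A) \<or> (\<forall>A\<in>\<sigma>. c \<in> A)) \<or> (\<forall>A\<in>\<sigma>. k \<in> A \<longleftrightarrow> e = 0)}"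

lemma obox_verts:
  assumes "z \<in> simps (cube T) m" "k \<in> T" "e \<le> 1"
  shows "obox T k e m z \<longleftrightarrow> verts T m z \<in> box_chains T k e"
proof -
  have "e = 0 \<or> e = 1" using assms(3) by auto
  then show ?thesis
    using verts_chain[OF assms(1)] face_verts[OF assms(1)] assms(2)
    by (auto simp: obox_def bdry_def box_chains_def)
qed

lemma chains_cong:
  assumes "\<And>A B. \<lbrakk>A \<in> V; B \<in> V\<rbrakk> \<Longrightarrow> (le A B \<or> le B A) = (le' A B \<or> le' B A)"
  shows "chains le V = chains le' V"
proof -
  have sub: "chains r V \<subseteq> chains r' V"
    if r: "\<And>A B. \<lbrakk>A \<in> V; B \<in> V\<rbrakk> \<Longrightarrow> r A B \<or> r B A \<Longrightarrow> r' A B \<or> r' B A" for r r' :: "'a \<Rightarrow> 'a \<Rightarrow> bool"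
  proof
    fix \<sigma> assume s: "\<sigma> \<in> chains r V"
    have "r' A B \<or> r' B A" if AB: "A \<in> \<sigma>" "B \<in> \<sigma>" for A B
      using r[of A B] chainsD(1)[OF s] AB chainsD(2)[OF s AB] by auto
    then show "\<sigma> \<in> chains r' V" using s by (simp add: chains_def)
  qed
  show ?thesis by (rule subset_antisym; rule sub) (simp_all add: assms)
qed

text \<open>
  The twist \<open>tw\<close> exchanges the two ends of every coordinate when \<open>e = 0\<close>, so that in both cases the
  missing face of the box becomes the upper face of the prism.
\<close>

lemma prism_cube:
  assumes T: "finite T" and k: "k \<in> T" and e: "e \<le> 1"
  defines "tw \<equiv> \<lambda>A. if e = 1 then A else T - A"
  shows "prism (Pow T) (\<lambda>A B. tw A \<subseteq> tw B) (\<lambda>A. k \<in> tw A) (\<lambda>A. tw (tw A - {k})) (box_chains T k e)"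
    and "chains (\<lambda>A B. tw A \<subseteq> tw B) (Pow T) = chains (\<subseteq>) (Pow T)"
proof -
  have e01: "e = 0 \<or> e = 1" using e by auto
  have tw: "tw (tw A) = A" "tw A \<subseteq> T" if "A \<subseteq> T" for A using that by (auto simp: tw_def)
  have "(T - A \<subseteq> T - B) = (B \<subseteq> A)" if "A \<in> Pow T" "B \<in> Pow T" for A B
    using that by blast
  then have *: "(tw A \<subseteq> tw B \<or> tw B \<subseteq> tw A) = (A \<subseteq> B \<or> B \<subseteq> A)" if "A \<in> Pow T" "B \<in> Pow T" for A B
    using that unfolding tw_def by (cases "e = 1") (simp_all add: disj_commute)
  show ch: "chains (\<lambda>A B. tw A \<subseteq> tw B) (Pow T) = chains (\<subseteq>) (Pow T)"
    by (rule chains_cong[OF *])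
  show "prism (Pow T) (\<lambda>A B. tw A \<subseteq> tw B) (\<lambda>A. k \<in> tw A) (\<lambda>A. tw (tw A - {k})) (box_chains T k e)"
  proof (unfold_locales, unfold ch)
    show "down_closed (box_chains T k e)"
      unfolding down_closed_def
    proof (intro ballI allI impI, elim conjE)
      fix \<sigma> \<tau> assume s: "\<sigma> \<in> box_chains T k e" and t: "\<tau> \<subseteq> \<sigma>" "\<tau> \<noteq> {}"
      have "\<tau> \<in> chains (\<subseteq>) (Pow T)" using s t chains_subset unfolding box_chains_def by blast
      moreover have "(\<exists>c\<in>T - {k}. (\<forall>A\<in>\<sigma>. c \<notin> A) \<or> (\<forall>A\<in>\<sigma>. c \<in> A)) \<or> (\<forall>A\<in>\<sigma>. k \<in> A \<longleftrightarrow> e = 0)"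
        using s by (simp add: box_chains_def)
      then have "(\<exists>c\<in>T - {k}. (\<forall>A\<in>\<tau>. c \<notin> A) \<or> (\<forall>A\<in>\<tau>. c \<in> A)) \<or> (\<forall>A\<in>\<tau>. k \<in> A \<longleftrightarrow> e = 0)"
        using t(1) by (meson subsetD)
      ultimately show "\<tau> \<in> box_chains T k e" by (simp add: box_chains_def)
    qed
    show "\<sigma> \<in> box_chains T k e" if "\<sigma> \<in> chains (\<subseteq>) (Pow T)" "\<And>A. A \<in> \<sigma> \<Longrightarrow> k \<notin> tw A" for \<sigma>
    proof -
      have "k \<in> A \<longleftrightarrow> e = 0" if "A \<in> \<sigma>" for A
        using \<open>\<And>A. A \<in> \<sigma> \<Longrightarrow> k \<notin> tw A\<close>[OF that] k e01 by (cases "e = 1") (auto simp: tw_def)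
      then show ?thesis using that(1) by (simp add: box_chains_def)
    qed
    show "insert (tw (tw A - {k})) \<sigma> \<in> box_chains T k e"
      if s: "\<sigma> \<in> box_chains T k e" and A: "A \<in> \<sigma>" "k \<in> tw A"
        and c: "insert (tw (tw A - {k})) \<sigma> \<in> chains (\<subseteq>) (Pow T)" for \<sigma> A
    proof -
      have AT: "A \<subseteq> T" using s A(1) chainsD(1) unfolding box_chains_def by blast
      have "k \<in> A \<longleftrightarrow> e \<noteq> 0" using A(2) e01 k by (cases "e = 1") (auto simp: tw_def)
      then have "\<not> (\<forall>A\<in>\<sigma>. k \<in> A \<longleftrightarrow> e = 0)" using A(1) by blast
      then obtain c where c': "c \<in> T - {k}" "(\<forall>A\<in>\<sigma>. c \<notin> A) \<or> (\<forall>A\<in>\<sigma>. c \<in> A)"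
        using s unfolding box_chains_def by blast
      have "c \<in> tw (tw A - {k}) \<longleftrightarrow> c \<in> A" using c'(1) AT by (auto simp: tw_def)
      then have "(\<forall>B\<in>insert (tw (tw A - {k})) \<sigma>. c \<notin> B) \<or> (\<forall>B\<in>insert (tw (tw A - {k})) \<sigma>. c \<in> B)"
        using c'(2) A(1) by auto
      then show ?thesis using c c'(1) unfolding box_chains_def by blast
    qed
    have d: "tw (tw (tw A - {k})) = tw A - {k}" "tw (tw A - {k}) \<subseteq> T" if "A \<in> Pow T" for A
    proof -
      have "tw A - {k} \<subseteq> T" using tw(2)[of A] that by blast
      then show "tw (tw (tw A - {k})) = tw A - {k}" "tw (tw A - {k}) \<subseteq> T" using tw by blast+
    qed
    show "A = B" if "A \<in> Pow T" "B \<in> Pow T" "tw A \<subseteq> tw B" "tw B \<subseteq> tw A" for A B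
      using that tw(1)[of A] tw(1)[of B] by (metis PowD subset_antisym)
    show "tw B \<subseteq> tw (tw (tw A - {k}))"
      if "A \<in> Pow T" "B \<in> Pow T" "k \<in> tw A" "k \<notin> tw B" "tw B \<subseteq> tw A" for A B
      using that d(1)[of A] by auto
    show "tw (tw (tw A - {k})) \<subseteq> tw A" if "A \<in> Pow T" "k \<in> tw A" for A
      using that d(1)[of A] by auto
    show "k \<notin> tw (tw (tw A - {k}))" if "A \<in> Pow T" "k \<in> tw A" for A
      using that d(1)[of A] by auto
    show "tw (tw A - {k}) \<in> Pow T" if "A \<in> Pow T" "k \<in> tw A" for A
      using d(2)[OF that(1)] by auto
  qed (use T in \<open>auto simp: box_chains_def\<close>)
qed

subsection \<open>Attaching one simplex\<close>

text \<open>
  Partial lifts over the subcomplex of all simplices whose set of vertices belongs to \<open>\<A>\<close>.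
\<close>

definition lift_on ::
  "'a sset \<Rightarrow> (nat \<Rightarrow> 'a \<Rightarrow> 'b) \<Rightarrow> (nat \<Rightarrow> (nat \<Rightarrow> nat \<Rightarrow> nat) \<Rightarrow> 'b) \<Rightarrow> nat set \<Rightarrow> nat set set set \<Rightarrow>
    (nat \<Rightarrow> (nat \<Rightarrow> nat \<Rightarrow> nat) \<Rightarrow> 'a) \<Rightarrow> bool" where
  "lift_on E p v T \<A> w \<longleftrightarrow> natural_on T (\<lambda>m z. verts T m z \<in> \<A>) E w \<and>
     (\<forall>m. \<forall>z\<in>simps (cube T) m. verts T m z \<in> \<A> \<longrightarrow> p m (w m z) = v m z)"

text \<open>
  Numbering the members of a chain in increasing order makes it a nondegenerate simplex.
\<close>

lemma chain_rank:
  assumes fin: "finite (C :: 'v set set)" and ch: "\<And>A B. A \<in> C \<Longrightarrow> B \<in> C \<Longrightarrow> A \<subseteq> B \<or> B \<subseteq> A"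
  defines "r \<equiv> \<lambda>A. card {B \<in> C. B \<subset> A}"
  shows "bij_betw r C {..<card C}" and "\<And>A B. A \<subseteq> B \<Longrightarrow> r A \<le> r B"
    and "\<And>A B. \<lbrakk>A \<in> C; B \<in> C; r A \<le> r B\<rbrakk> \<Longrightarrow> A \<subseteq> B"
proof -
  show mono: "r A \<le> r B" if "A \<subseteq> B" for A B
    unfolding r_def using that fin by (intro card_mono) auto
  have strict: "r A < r B" if "A \<in> C" "A \<subset> B" for A B
    unfolding r_def using that fin by (intro psubset_card_mono) auto
  show refl: "A \<subseteq> B" if "A \<in> C" "B \<in> C" "r A \<le> r B" for A B
    using ch[OF that(1,2)] strict[of B A] that by auto
  have inj: "inj_on r C" by (rule inj_onI) (metis order.refl refl subset_antisym)
  have "r A < card C" if "A \<in> C" for A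
    unfolding r_def using that fin by (intro psubset_card_mono) auto
  then have "r ` C \<subseteq> {..<card C}" by auto
  moreover have "card (r ` C) = card {..<card C}" using card_image[OF inj] by simp
  ultimately have "r ` C = {..<card C}" by (intro card_subset_eq) auto
  then show "bij_betw r C {..<card C}" using inj by (simp add: bij_betw_def)
qed

lemma kan_fibration_simplicial:
  assumes "kan_fibration E B p"
  shows "simplicial_map E B p" "simplicial_set E" "simplicial_set B"
  using assms by (auto simp: kan_fibration_def simplicial_map_def)

lemma kan_fibrationD:
  assumes "kan_fibration E B p" "1 \<le> n" "k \<le> n"
    "simplicial_map (horn n k) E u" "simplicial_map (std_simplex n) B v"
    "\<forall>m. \<forall>s\<in>simps (horn n k) m. p m (u m s) = v m s"
  shows "\<exists>w. simplicial_map (std_simplex n) E w \<and> (\<forall>m. \<forall>s\<in>simps (horn n k) m. w m s = u m s) \<and>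
    (\<forall>m. \<forall>s\<in>mono_maps m n. p m (w m s) = v m s)"
proof -
  have "mono_maps m n = simps (std_simplex n) m" for m by (simp add: std_simplex_def)
  then show ?thesis using assms unfolding kan_fibration_def by presburger
qed

text \<open>
  The chain \<open>C\<close> is the image of a standard simplex, and \<open>u\<close> restricts to the horn opposite to the
  vertex \<open>a\<close>.  A filler of this horn over \<open>v\<close> extends \<open>u\<close> to \<open>C\<close> and to its facet \<open>C - {a}\<close>, hence
  to all simplices with these sets of vertices, which are degenerations of the two.
\<close>

lemma attach_simplex:
  assumes kan: "kan_fibration E B p" and v: "simplicial_map (cube T) B v"
    and \<A>: "down_closed \<A>" and C: "C \<in> chains (\<subseteq>) (Pow T)" "finite C"
    and a: "a \<in> C" "C - {a} \<noteq> {}" "C \<notin> \<A>" "C - {a} \<notin> \<A>"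
    and facets: "\<And>b. b \<in> C - {a} \<Longrightarrow> C - {b} \<in> \<A>"
    and u: "lift_on E p v T \<A> u"
  shows "\<exists>w. lift_on E p v T (\<A> \<union> {C, C - {a}}) w \<and>
    (\<forall>m. \<forall>z\<in>simps (cube T) m. verts T m z \<in> \<A> \<longrightarrow> w m z = u m z)"
proof -
  interpret p: simplicial_map E B p using kan by (simp add: kan_fibration_def)
  interpret v: simplicial_map "cube T" B v by fact
  have uE: "u m z \<in> simps E m" and uN: "f \<in> mono_maps l m \<Longrightarrow> u l (sact (cube T) l m f z) = sact E l m f (u m z)"
    and up: "p m (u m z) = v m z"
    if "z \<in> simps (cube T) m" "verts T m z \<in> \<A>" for l m z f
    using u that by (auto simp: lift_on_def natural_on_def)
  have CT: "\<And>A. A \<in> C \<Longrightarrow> A \<subseteq> T" and Cc: "\<And>A B. A \<in> C \<Longrightarrow> B \<in> C \<Longrightarrow> A \<subseteq> B \<or> B \<subseteq> A"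
    using chainsD[OF C(1)] by blast+
  define n where "n = card C - 1"
  have "card (C - {a}) > 0" using a(2) C(2) by (simp add: card_gt_0_iff)
  then have n1: "1 \<le> n" and cn: "{..<card C} = {..n}" using a(1) C(2) by (auto simp: n_def)
  define r where "r A = card {B \<in> C. B \<subset> A}" for A
  note rank = chain_rank[OF C(2) Cc, folded r_def]
  have rb: "bij_betw r C {..n}" using rank(1) unfolding cn by blast
  have rC: "r A \<le> n" if "A \<in> C" for A using bij_betwE[OF rb] that by auto
  have rmono: "r A \<le> r B" if "A \<subseteq> B" for A B using rank(2)[OF _ _ that] by blast
  define t where "t = inv_into C r"
  have tC: "t i \<in> C" "r (t i) = i" if "i \<le> n" for i
    using bij_betw_inv_into_right[OF rb] bij_betwE[OF bij_betw_inv_into[OF rb]] that by (auto simp: t_def)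
  have tr: "t (r A) = A" if "A \<in> C" for A
    using bij_betw_inv_into_left[OF rb that] by (simp add: t_def)
  have tm: "t i \<subseteq> t j" if "i \<le> j" "j \<le> n" for i j
    using rank(3)[of "t i" "t j"] tC that by auto
  define k where "k = r a"
  have kn: "k \<le> n" using rC a(1) by (simp add: k_def)
  \<comment> \<open>The simplex of the cube with the vertices \<open>t 0 \<subset> t 1 \<subset> \<dots> \<subset> t n\<close>, the members of \<open>C\<close>.\<close>
  define x where "x = (\<lambda>c\<in>T. \<lambda>i\<in>{..n}. if c \<in> t i then 1 else 0 :: nat)"
  have x: "x \<in> simps (cube T) n"
    unfolding simps_cube x_def using subsetD[OF tm] by (auto intro!: mono_mapsI)
  have vx: "vert T x i = t i" if "i \<le> n" for i
    using that CT[OF tC(1)[OF that]] by (auto simp: vert_def x_def)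
  let ?x = "\<lambda>m s. sact (cube T) m n s x"
  have xs: "?x m s \<in> simps (cube T) m" if "s \<in> mono_maps m n" for m s
    by (rule sact_cube_closed[OF that x])
  have vxs: "verts T m (?x m s) = (\<lambda>i. t (s i)) ` {..m}" if "s \<in> mono_maps m n" for m s
    unfolding verts_sact using mono_maps_le[OF that] vx by (intro image_cong) auto
  have xx: "?x l (compose {..l} s f) = sact (cube T) l m f (?x m s)"
    if "f \<in> mono_maps l m" "s \<in> mono_maps m n" for l m f s
    using simplicial_set.act_comp[OF simplicial_set_cube that x] .
  have hornA: "verts T m (?x m s) \<in> \<A>" if s: "s \<in> simps (horn n k) m" for m s
  proof -
    obtain i where i: "i \<le> n" "i \<noteq> k" "i \<notin> s ` {..m}" and sm: "s \<in> mono_maps m n"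
      using s by (auto simp: horn_def)
    have "t i \<noteq> a" using i tC(2)[OF i(1)] by (auto simp: k_def)
    then have "C - {t i} \<in> \<A>" using facets tC(1)[OF i(1)] by auto
    moreover have "t (s j) \<noteq> t i" if "j \<le> m" for j
      using tC(2)[OF i(1)] tC(2)[OF mono_maps_le[OF sm that]] i(3) that by (metis atMost_iff imageI)
    then have "verts T m (?x m s) \<subseteq> C - {t i}"
      using tC(1)[OF mono_maps_le[OF sm]] by (auto simp: vxs[OF sm])
    moreover have "verts T m (?x m s) \<noteq> {}" by (auto simp: verts_def)
    ultimately show ?thesis using \<A> by (auto simp: down_closed_def)
  qed
  have hm: "s \<in> mono_maps m n" if "s \<in> simps (horn n k) m" for m s using that by (simp add: horn_def)
  have "simplicial_map (horn n k) E (\<lambda>m s. u m (?x m s))"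
  proof (intro simplicial_map.intro simplicial_map_axioms.intro simplicial_set_horn p.X.simplicial_set_axioms)
    show "u m (?x m s) \<in> simps E m" if "s \<in> simps (horn n k) m" for m s
      using uE[OF xs hornA] hm that by blast
    show "u l (?x l (sact (horn n k) l m f s)) = sact E l m f (u m (?x m s))"
      if "f \<in> mono_maps l m" "s \<in> simps (horn n k) m" for l m f s
      using uN[OF xs hornA[OF that(2)] that(1)] hm[OF that(2)] xx[OF that(1)] by (simp add: horn_def)
  qed
  moreover have "simplicial_map (std_simplex n) B (\<lambda>m s. v m (?x m s))"
  proof (intro simplicial_map.intro simplicial_map_axioms.intro simplicial_set_std_simplex
      p.Y.simplicial_set_axioms)
    show "v m (?x m s) \<in> simps B m" if "s \<in> simps (std_simplex n) m" for m s
      using v.map_closed[OF xs] that by (auto simp: std_simplex_def)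
    show "v l (?x l (sact (std_simplex n) l m f s)) = sact B l m f (v m (?x m s))"
      if "f \<in> mono_maps l m" "s \<in> simps (std_simplex n) m" for l m f s
      using that v.map_natural[OF that(1) xs] xx[OF that(1)] by (simp add: std_simplex_def)
  qed
  moreover have "\<forall>m. \<forall>s\<in>simps (horn n k) m. p m (u m (?x m s)) = v m (?x m s)"
    using up[OF xs hornA] hm by blast
  ultimately obtain w where w: "simplicial_map (std_simplex n) E w"
    and wu: "\<And>m s. s \<in> simps (horn n k) m \<Longrightarrow> w m s = u m (?x m s)"
    and wv: "\<And>m s. s \<in> mono_maps m n \<Longrightarrow> p m (w m s) = v m (?x m s)"
    using kan_fibrationD[OF kan n1 kn, of "\<lambda>m s. u m (?x m s)" "\<lambda>m s. v m (?x m s)"] by blast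
  interpret w: simplicial_map "std_simplex n" E w by fact
  \<comment> \<open>A simplex with vertices in \<open>C\<close> is a degeneration of a face of \<open>x\<close>; \<open>cl\<close> recovers the operator.\<close>
  define cl where "cl m z = (\<lambda>i\<in>{..m}. r (vert T z i))" for m z
  have cl: "cl m z \<in> mono_maps m n" "?x m (cl m z) = z"
    if z: "z \<in> simps (cube T) m" and zC: "verts T m z \<subseteq> C" for m z
  proof -
    have vC: "vert T z i \<in> C" if "i \<le> m" for i using that zC by (auto simp: verts_def)
    show m: "cl m z \<in> mono_maps m n"
      unfolding cl_def using rC[OF vC] rmono[OF vert_mono[OF z]] by (intro mono_mapsI) auto
    show "?x m (cl m z) = z"
    proof (rule cube_ext[OF xs[OF m] z])
      fix i assume i: "i \<le> m"
      then show "vert T (?x m (cl m z)) i = vert T z i"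
        using vert_sact[OF i] vx[OF mono_maps_le[OF m i]] tr[OF vC[OF i]] by (simp add: cl_def)
    qed
  qed
  define w' where "w' m z = (if verts T m z \<in> \<A> then u m z else w m (cl m z))" for m z
  \<comment> \<open>A simplex of \<open>\<A>\<close> with vertices in \<open>C\<close> omits a vertex other than \<open>a\<close>, so it lies in the horn, where
    the filler agrees with \<open>u\<close>.\<close>
  have w'C: "w' m z = w m (cl m z)" if z: "z \<in> simps (cube T) m" and zC: "verts T m z \<subseteq> C" for m z
  proof (cases "verts T m z \<in> \<A>")
    case True
    have "\<not> C - {a} \<subseteq> verts T m z"
    proof
      assume "C - {a} \<subseteq> verts T m z"
      then have "verts T m z = C \<or> verts T m z = C - {a}" using zC a(1) by blast
      then show False using True a(3,4) by metis
    qed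
    then obtain b where b: "b \<in> C" "b \<noteq> a" "b \<notin> verts T m z" by auto
    have "r b \<noteq> k" unfolding k_def using b tr[OF b(1)] tr[OF a(1)] by metis
    moreover have "r b \<notin> cl m z ` {..m}"
    proof
      assume "r b \<in> cl m z ` {..m}"
      then obtain i where i: "i \<le> m" "r b = r (vert T z i)" by (auto simp: cl_def)
      have "vert T z i \<in> verts T m z" using i(1) by (auto simp: verts_def)
      then have "vert T z i \<in> C" using zC by blast
      then have "vert T z i = b" using tr[OF b(1)] tr[of "vert T z i"] i(2) by metis
      then show False using b(3) \<open>vert T z i \<in> verts T m z\<close> by metis
    qed
    ultimately have "cl m z \<in> simps (horn n k) m"
      using cl(1)[OF z zC] rC[OF b(1)] by (auto simp: horn_def)
    then show ?thesis using wu cl(2)[OF z zC] True by (simp add: w'_def)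
  qed (simp add: w'_def)
  have wcl: "w m (cl m z) \<in> simps E m" "p m (w m (cl m z)) = v m z"
    if "z \<in> simps (cube T) m" "verts T m z \<subseteq> C" for m z
    using w.map_closed[of "cl m z" m] wv[OF cl(1)[OF that]] cl[OF that] by (auto simp: std_simplex_def)
  have "natural_on T (\<lambda>m z. verts T m z \<in> \<A> \<union> {C, C - {a}}) E w'"
    unfolding natural_on_def
  proof (intro allI ballI impI conjI)
    fix m z assume z: "z \<in> simps (cube T) m" and zA: "verts T m z \<in> \<A> \<union> {C, C - {a}}"
    show "w' m z \<in> simps E m"
      using zA uE[OF z] wcl[OF z] by (auto simp: w'_def)
    fix l f assume f: "f \<in> mono_maps l m"
    let ?z = "sact (cube T) l m f z"
    note sub = verts_sact_subset[OF f, of T z]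
    show "w' l ?z = sact E l m f (w' m z)"
    proof (cases "verts T m z \<in> \<A>")
      case True
      have "verts T l ?z \<noteq> {}" by (auto simp: verts_def)
      then have "verts T l ?z \<in> \<A>" using True sub \<A> unfolding down_closed_def by blast
      then show ?thesis using True uN[OF z True f] by (simp add: w'_def)
    next
      case False
      then have zC: "verts T m z \<subseteq> C" using zA by auto
      then have zC': "verts T l ?z \<subseteq> C" using sub by auto
      have "cl l ?z = compose {..l} (cl m z) f"
        using mono_maps_le[OF f] by (auto simp: cl_def compose_def vert_sact fun_eq_iff)
      then show ?thesis
        using w'C[OF z zC] w'C[OF sact_cube_closed[OF f z] zC'] w.map_natural[OF f, of "cl m z"] cl(1)[OF z zC]
        by (simp add: std_simplex_def)
    qed
  qed
  moreover have "p m (w' m z) = v m z" if "z \<in> simps (cube T) m" "verts T m z \<in> \<A> \<union> {C, C - {a}}" for m z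
    using that up[OF that(1)] wcl(2)[OF that(1)] by (auto simp: w'_def)
  ultimately show ?thesis
    by (intro exI[of _ w']) (auto simp: lift_on_def w'_def)
qed

text \<open>
  The cube arises from the open box by attaching simplices along horns, and each attachment is a
  lifting problem that a Kan fibration solves.
\<close>

theorem box_lift:
  assumes kan: "kan_fibration E B p" and T: "finite T" "k \<in> T" and e: "e \<le> 1"
    and u: "natural_on T (obox T k e) E u"
    and v: "natural_on T whole B v"
    and uv: "\<And>m z. \<lbrakk>z \<in> simps (cube T) m; obox T k e m z\<rbrakk> \<Longrightarrow> p m (u m z) = v m z"
  shows "\<exists>w. natural_on T whole E w \<and>
    (\<forall>m. \<forall>z\<in>simps (cube T) m. p m (w m z) = v m z \<and> (obox T k e m z \<longrightarrow> w m z = u m z))"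
proof -
  have v': "simplicial_map (cube T) B v"
    using v kan_fibration_simplicial(3)[OF kan] natural_on_whole by blast
  note prism = prism_cube[OF T e]
  note box = obox_verts[OF _ T(2) e]
  define Q where "Q \<A> \<longleftrightarrow> (\<exists>w. lift_on E p v T \<A> w \<and> (\<forall>m. \<forall>z\<in>simps (cube T) m.
    verts T m z \<in> box_chains T k e \<longrightarrow> w m z = u m z))" for \<A>
  have "Q (chains (\<subseteq>) (Pow T))"
    unfolding prism(2)[symmetric]
  proof (rule prism.prism_induct[OF prism(1)])
    show "Q (box_chains T k e)"
      unfolding Q_def lift_on_def using u uv box by (intro exI[of _ u]) (auto simp: natural_on_def)
  next
    fix \<A> C a assume att: "prism.attachable (Pow T) (\<lambda>A B. (if e = 1 then A else T - A) \<subseteq> (if e = 1 then B else T - B))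
      (box_chains T k e) \<A> C a" and "Q \<A>"
    then obtain w where w: "lift_on E p v T \<A> w"
      and wu: "\<And>m z. z \<in> simps (cube T) m \<Longrightarrow> verts T m z \<in> box_chains T k e \<Longrightarrow> w m z = u m z"
      by (auto simp: Q_def)
    note att = att[unfolded prism.attachable_def[OF prism(1)] prism(2)]
    have "finite C" using att T(1) chainsD(1) finite_subset[of C "Pow T"] by blast
    then have "\<exists>w'. lift_on E p v T (\<A> \<union> {C, C - {a}}) w' \<and>
      (\<forall>m. \<forall>z\<in>simps (cube T) m. verts T m z \<in> \<A> \<longrightarrow> w' m z = w m z)"
      using att by (intro attach_simplex[OF kan v' _ _ _ _ _ _ _ _ w]) auto
    then obtain w' where w': "lift_on E p v T (\<A> \<union> {C, C - {a}}) w'"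
      and ww: "\<And>m z. z \<in> simps (cube T) m \<Longrightarrow> verts T m z \<in> \<A> \<Longrightarrow> w' m z = w m z" by blast
    have "w' m z = u m z" if "z \<in> simps (cube T) m" "verts T m z \<in> box_chains T k e" for m z
    proof -
      have "verts T m z \<in> \<A>" using att that(2) by blast
      then show ?thesis using ww wu that by simp
    qed
    then show "Q (\<A> \<union> {C, C - {a}})" unfolding Q_def using w' by blast
  qed
  then obtain w where w: "lift_on E p v T (chains (\<subseteq>) (Pow T)) w"
    and wu: "\<And>m z. z \<in> simps (cube T) m \<Longrightarrow> verts T m z \<in> box_chains T k e \<Longrightarrow> w m z = u m z"
    unfolding Q_def by blast
  have "natural_on T whole E w"
    using w verts_chain unfolding lift_on_def natural_on_def by blast
  moreover have "p m (w m z) = v m z" if "z \<in> simps (cube T) m" for m z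
    using w verts_chain[OF that] that unfolding lift_on_def by blast
  ultimately show ?thesis using wu box by blast
qed

section \<open>Filling boxes given face by face\<close>

text \<open>
  A piece of a map on a cube: a predicate that describes a subcomplex, and the values on it.
\<close>

type_synonym 'a piece = "(nat \<Rightarrow> (nat \<Rightarrow> nat \<Rightarrow> nat) \<Rightarrow> bool) \<times> (nat \<Rightarrow> (nat \<Rightarrow> nat \<Rightarrow> nat) \<Rightarrow> 'a)"

text \<open>
  Equality on the overlap, which makes a list of pieces a map on the union of its subcomplexes.
\<close>

definition agree :: "nat set \<Rightarrow> 'a piece \<Rightarrow> 'a piece \<Rightarrow> bool" where
  "agree T P Q \<longleftrightarrow> (\<forall>m. \<forall>z\<in>simps (cube T) m. fst P m z \<and> fst Q m z \<longrightarrow> snd P m z = snd Q m z)"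

lemma sorted_wrt_agreeD:
  assumes "sorted_wrt (agree T) Ps" "P \<in> set Ps" "Q \<in> set Ps"
    "z \<in> simps (cube T) m" "fst P m z" "fst Q m z"
  shows "snd P m z = snd Q m z"
  using assms
proof (induction Ps)
  case (Cons R Ps)
  consider "P = R" "Q = R" | "P = R" "Q \<in> set Ps" | "P \<in> set Ps" "Q = R" | "P \<in> set Ps" "Q \<in> set Ps"
    using Cons.prems(2,3) by auto
  then show ?case
  proof cases
    case 2
    then have "agree T P Q" using Cons.prems(1) by auto
    then show ?thesis using Cons.prems(4-6) unfolding agree_def by blast
  next
    case 3
    then have "agree T Q P" using Cons.prems(1) by auto
    then show ?thesis using Cons.prems(4-6) unfolding agree_def by metis
  next
    case 4
    then show ?thesis using Cons.IH Cons.prems by simp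
  qed simp
qed simp

lemma stableD: "\<lbrakk>stable T D; z \<in> simps (cube T) m; D m z; f \<in> mono_maps l m\<rbrakk> \<Longrightarrow> D l (sact (cube T) l m f z)"
  by (simp add: stable_def)

lemma glue:
  assumes st: "\<And>P. P \<in> set Ps \<Longrightarrow> stable T (fst P)"
    and nat: "\<And>P. P \<in> set Ps \<Longrightarrow> natural_on T (fst P) X (snd P)"
    and ag: "sorted_wrt (agree T) Ps"
  shows "\<exists>\<phi>. natural_on T (\<lambda>m z. \<exists>P\<in>set Ps. fst P m z) X \<phi> \<and>
    (\<forall>P\<in>set Ps. \<forall>m. \<forall>z\<in>simps (cube T) m. fst P m z \<longrightarrow> \<phi> m z = snd P m z)"
proof -
  define \<phi> where "\<phi> m z = snd (SOME P. P \<in> set Ps \<and> fst P m z) m z" for m z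
  have \<phi>: "\<phi> m z = snd P m z" if "P \<in> set Ps" "z \<in> simps (cube T) m" "fst P m z" for P m z
  proof -
    define R where "R = (SOME P. P \<in> set Ps \<and> fst P m z)"
    have R: "R \<in> set Ps \<and> fst R m z"
      unfolding R_def by (rule someI[of "\<lambda>P. P \<in> set Ps \<and> fst P m z" P]) (use that in simp)
    show ?thesis
      using sorted_wrt_agreeD[OF ag conjunct1[OF R] that(1,2) conjunct2[OF R] that(3)] by (simp add: \<phi>_def R_def)
  qed
  have "natural_on T (\<lambda>m z. \<exists>P\<in>set Ps. fst P m z) X \<phi>"
    unfolding natural_on_def
  proof (intro allI ballI impI)
    fix m z assume z: "z \<in> simps (cube T) m" and "\<exists>P\<in>set Ps. fst P m z"
    then obtain P where P: "P \<in> set Ps" "fst P m z" by blast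
    have "\<phi> l (sact (cube T) l m f z) = sact X l m f (\<phi> m z)" if f: "f \<in> mono_maps l m" for l f
    proof -
      have "fst P l (sact (cube T) l m f z)" by (rule stableD[OF st[OF P(1)], OF z P(2) f])
      then show ?thesis
        using \<phi>[OF P(1) sact_cube_closed[OF f z]] \<phi>[OF P(1) z P(2)] natural_on_sact[OF nat[OF P(1)], OF z P(2) f]
        by simp
    qed
    moreover have "\<phi> m z \<in> simps X m"
      using \<phi>[OF P(1) z P(2)] natural_on_closed[OF nat[OF P(1)], OF z P(2)] by simp
    ultimately show "\<phi> m z \<in> simps X m \<and>
       (\<forall>l. \<forall>f\<in>mono_maps l m. \<phi> l (sact (cube T) l m f z) = sact X l m f (\<phi> m z))" by blast
  qed
  then show ?thesis using \<phi> by blast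
qed

theorem box_fill:
  assumes kan: "kan_fibration E B p" and T: "finite T" "k \<in> T" and e: "e \<le> 1"
    and v: "natural_on T whole B v"
    and st: "\<And>P. P \<in> set Ps \<Longrightarrow> stable T (fst P)"
    and nat: "\<And>P. P \<in> set Ps \<Longrightarrow> natural_on T (fst P) E (snd P)"
    and lift: "\<And>P m z. \<lbrakk>P \<in> set Ps; z \<in> simps (cube T) m; fst P m z\<rbrakk> \<Longrightarrow> p m (snd P m z) = v m z"
    and ag: "sorted_wrt (agree T) Ps"
    and cover: "\<And>m z. z \<in> simps (cube T) m \<Longrightarrow> obox T k e m z \<longleftrightarrow> (\<exists>P\<in>set Ps. fst P m z)"
  shows "\<exists>w. natural_on T whole E w \<and> (\<forall>m. \<forall>z\<in>simps (cube T) m. p m (w m z) = v m z) \<and>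
    (\<forall>P\<in>set Ps. \<forall>m. \<forall>z\<in>simps (cube T) m. fst P m z \<longrightarrow> w m z = snd P m z)"
proof -
  obtain \<phi> where \<phi>: "natural_on T (\<lambda>m z. \<exists>P\<in>set Ps. fst P m z) E \<phi>"
    and \<phi>P: "\<And>P m z. \<lbrakk>P \<in> set Ps; z \<in> simps (cube T) m; fst P m z\<rbrakk> \<Longrightarrow> \<phi> m z = snd P m z"
    using glue[OF st nat ag] by blast
  have "natural_on T (obox T k e) E \<phi>"
    using \<phi> cover unfolding natural_on_def by blast
  moreover have "p m (\<phi> m z) = v m z" if z: "z \<in> simps (cube T) m" "obox T k e m z" for m z
  proof -
    obtain P where "P \<in> set Ps" "fst P m z" using cover z by blast
    then show ?thesis using \<phi>P lift z(1) by simp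
  qed
  ultimately obtain w where w: "natural_on T whole E w"
    "\<And>m z. z \<in> simps (cube T) m \<Longrightarrow> p m (w m z) = v m z"
    "\<And>m z. z \<in> simps (cube T) m \<Longrightarrow> obox T k e m z \<Longrightarrow> w m z = \<phi> m z"
    using box_lift[OF kan T e _ v] by blast
  have "w m z = snd P m z" if "P \<in> set Ps" "z \<in> simps (cube T) m" "fst P m z" for P m z
  proof -
    have "obox T k e m z" using cover[OF that(2)] that(1,3) by blast
    then show ?thesis using w(3)[OF that(2)] \<phi>P[OF that] by simp
  qed
  then show ?thesis using w(1,2) by blast
qed

text \<open>
  Fillers in a Kan simplicial set are lifts over the point.
\<close>

lemma kan_fibration_point:
  assumes "kan X"
  shows "kan_fibration X (std_simplex 0) (\<lambda>m x. \<lambda>i\<in>{..m}. 0)"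
proof -
  have X: "simplicial_set X" using assms by (simp add: kan_def)
  have pt: "s = (\<lambda>i\<in>{..m}. 0)" if "s \<in> mono_maps m 0" for s m
    using mono_maps_ext[OF that zero_mono_maps] mono_maps_le[OF that] by simp
  have m: "simplicial_map X (std_simplex 0) (\<lambda>m x. \<lambda>i\<in>{..m}. 0)"
    using X simplicial_set_std_simplex zero_mono_maps mono_maps_le
    by (auto simp: simplicial_map_def simplicial_map_axioms_def std_simplex_def compose_def fun_eq_iff)
  have "v m s = (\<lambda>i\<in>{..m}. 0)"
    if "simplicial_map (std_simplex n) (std_simplex 0) v" "s \<in> simps (std_simplex n) m" for n v m s
    using simplicial_map.map_closed[OF that] pt by (auto simp: std_simplex_def)
  then show ?thesis
    using assms m unfolding kan_fibration_def kan_def by metis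
qed

corollary box_fill_kan:
  assumes kan: "kan X" and T: "finite T" "k \<in> T" and e: "e \<le> 1"
    and st: "\<And>P. P \<in> set Ps \<Longrightarrow> stable T (fst P)"
    and nat: "\<And>P. P \<in> set Ps \<Longrightarrow> natural_on T (fst P) X (snd P)"
    and ag: "sorted_wrt (agree T) Ps"
    and cover: "\<And>m z. z \<in> simps (cube T) m \<Longrightarrow> obox T k e m z \<longleftrightarrow> (\<exists>P\<in>set Ps. fst P m z)"
  shows "\<exists>w. natural_on T whole X w \<and>
    (\<forall>P\<in>set Ps. \<forall>m. \<forall>z\<in>simps (cube T) m. fst P m z \<longrightarrow> w m z = snd P m z)"
proof -
  have "natural_on T whole (std_simplex 0) (\<lambda>m z. \<lambda>i\<in>{..m}. 0)"
    using zero_mono_maps mono_maps_le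
    by (auto simp: natural_on_def std_simplex_def compose_def fun_eq_iff)
  from box_fill[OF kan_fibration_point[OF kan] T e this st nat _ ag cover] show ?thesis by blast
qed

subsection \<open>Rules for naturality\<close>

text \<open>
  \<open>ct e m\<close> and \<open>cst X m a\<close> are the \<open>m\<close>-simplices that are degenerate at the vertex \<open>e\<close> of the
  interval and at the vertex \<open>a\<close> of \<open>X\<close>.  Maps out of the interval and the square are written as
  functions of one and two coordinates, which can be plugged into the coordinates of any cube.
\<close>

definition ct :: "nat \<Rightarrow> nat \<Rightarrow> nat \<Rightarrow> nat" where
  "ct e m = (\<lambda>i\<in>{..m}. e)"

definition cst :: "'a sset \<Rightarrow> nat \<Rightarrow> 'a \<Rightarrow> 'a" where
  "cst X m a = sact X m 0 (\<lambda>i\<in>{..m}. 0) a"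

definition path :: "'a sset \<Rightarrow> (nat \<Rightarrow> (nat \<Rightarrow> nat) \<Rightarrow> 'a) \<Rightarrow> bool" where
  "path X \<gamma> \<longleftrightarrow> (\<forall>m. \<forall>s\<in>mono_maps m 1. \<gamma> m s \<in> simps X m \<and>
    (\<forall>l. \<forall>f\<in>mono_maps l m. \<gamma> l (compose {..l} s f) = sact X l m f (\<gamma> m s)))"

definition square :: "'a sset \<Rightarrow> (nat \<Rightarrow> (nat \<Rightarrow> nat) \<Rightarrow> (nat \<Rightarrow> nat) \<Rightarrow> 'a) \<Rightarrow> bool" where
  "square X \<theta> \<longleftrightarrow> (\<forall>m. \<forall>s\<in>mono_maps m 1. \<forall>r\<in>mono_maps m 1. \<theta> m s r \<in> simps X m \<and>
    (\<forall>l. \<forall>f\<in>mono_maps l m. \<theta> l (compose {..l} s f) (compose {..l} r f) = sact X l m f (\<theta> m s r)))"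

lemma ct_mono [simp]: "e \<le> 1 \<Longrightarrow> ct e m \<in> mono_maps m 1"
  unfolding ct_def by (rule mono_mapsI) auto

lemma ct_mono' [simp]: "ct 0 m \<in> mono_maps m (Suc 0)" "ct (Suc 0) m \<in> mono_maps m (Suc 0)"
  using ct_mono[of 0] ct_mono[of 1] by auto

lemma compose_ct [simp]: "f \<in> mono_maps l m \<Longrightarrow> compose {..l} (ct e m) f = ct e l"
  using mono_maps_le[of f l m] by (auto simp: compose_def ct_def fun_eq_iff)

lemma face_eq: "\<lbrakk>face c e m z; z \<in> simps (cube T) m; c \<in> T\<rbrakk> \<Longrightarrow> z c = ct e m"
  using cube_coord[of z T m c] unfolding face_def ct_def
  by (auto simp: mono_maps_def PiE_iff extensional_def fun_eq_iff)

lemma face_ct: "z c = ct e m \<Longrightarrow> face c e m z"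
  by (simp add: face_def ct_def)

lemma path_closed [simp]: "\<lbrakk>path X \<gamma>; s \<in> mono_maps m 1\<rbrakk> \<Longrightarrow> \<gamma> m s \<in> simps X m"
  by (auto simp: path_def)

lemma square_closed [simp]:
  "\<lbrakk>square X \<theta>; s \<in> mono_maps m 1; r \<in> mono_maps m 1\<rbrakk> \<Longrightarrow> \<theta> m s r \<in> simps X m"
  by (auto simp: square_def)

lemma cst_closed: "\<lbrakk>simplicial_set X; a \<in> simps X 0\<rbrakk> \<Longrightarrow> cst X m a \<in> simps X m"
  unfolding cst_def by (rule simplicial_set.act_closed[OF _ zero_mono_maps])

lemma sact_cst:
  assumes "simplicial_set X" "a \<in> simps X 0" "f \<in> mono_maps l m"
  shows "sact X l m f (cst X m a) = cst X l a"
proof -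
  have "compose {..l} (\<lambda>i\<in>{..m}. 0) f = (\<lambda>i\<in>{..l}. 0 :: nat)"
    using mono_maps_le[OF assms(3)] by (auto simp: compose_def fun_eq_iff)
  then show ?thesis
    using simplicial_set.act_comp[OF assms(1,3) zero_mono_maps assms(2)] by (simp add: cst_def)
qed

lemma natural_on_cst: "\<lbrakk>simplicial_set X; a \<in> simps X 0\<rbrakk> \<Longrightarrow> natural_on T D X (\<lambda>m z. cst X m a)"
  by (simp add: natural_on_def cst_closed sact_cst)

lemma natural_on_path: "\<lbrakk>path X \<gamma>; c \<in> T\<rbrakk> \<Longrightarrow> natural_on T D X (\<lambda>m z. \<gamma> m (z c))"
  unfolding natural_on_def path_def using cube_coord[of _ T _ c] by (simp add: sact_cube)

lemma natural_on_square:
  "\<lbrakk>square X \<theta>; c \<in> T; d \<in> T\<rbrakk> \<Longrightarrow> natural_on T D X (\<lambda>m z. \<theta> m (z c) (z d))"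
  unfolding natural_on_def square_def using cube_coord[of _ T] by (simp add: sact_cube)

lemma restrict_cube: "\<lbrakk>z \<in> simps (cube T) m; S \<subseteq> T\<rbrakk> \<Longrightarrow> restrict z S \<in> simps (cube S) m"
  by (auto simp: simps_cube)

lemma sact_restrict:
  "S \<subseteq> T \<Longrightarrow> restrict (sact (cube T) l m f z) S = sact (cube S) l m f (restrict z S)"
  by (auto simp: sact_cube fun_eq_iff)

lemma natural_on_restrict:
  assumes "natural_on S D' X \<phi>" "S \<subseteq> T"
    and "\<And>m z. \<lbrakk>z \<in> simps (cube T) m; D m z\<rbrakk> \<Longrightarrow> D' m (restrict z S)"
  shows "natural_on T D X (\<lambda>m z. \<phi> m (restrict z S))"
  unfolding natural_on_def
  using natural_on_closed[OF assms(1), OF restrict_cube[OF _ assms(2)] assms(3)]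
    natural_on_sact[OF assms(1), OF restrict_cube[OF _ assms(2)] assms(3)]
  by (simp add: sact_restrict[OF assms(2)])

lemma natural_on_subset:
  "\<lbrakk>natural_on T D' X \<phi>; \<And>m z. \<lbrakk>z \<in> simps (cube T) m; D m z\<rbrakk> \<Longrightarrow> D' m z\<rbrakk> \<Longrightarrow> natural_on T D X \<phi>"
  unfolding natural_on_def by blast

lemma (in simplicial_category) natural_on_comp:
  assumes "x \<in> sob C" "y \<in> sob C" "z \<in> sob C"
    and "natural_on T D (shom C y z) \<psi>" "natural_on T D (shom C x y) \<phi>"
  shows "natural_on T D (shom C x z) (\<lambda>m t. scomp C x y z m (\<psi> m t) (\<phi> m t))"
  unfolding natural_on_def
  using comp_closed[OF assms(1-3)] comp_natural[OF assms(1-3)] natural_on_closed[OF assms(4)]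
    natural_on_closed[OF assms(5)] natural_on_sact[OF assms(4)] natural_on_sact[OF assms(5)]
  by simp

lemma stable_face: "c \<in> T \<Longrightarrow> stable T (face c e)"
  unfolding stable_def using face_sact by blast

lemma stable_bdry: "S \<subseteq> T \<Longrightarrow> stable T (bdry S)"
  unfolding stable_def using bdry_sact by blast

subsection \<open>Squares and cubes in a Kan simplicial set\<close>

definition cub2 :: "'s \<Rightarrow> 's \<Rightarrow> nat \<Rightarrow> 's" where
  "cub2 s r = (\<lambda>c\<in>{0, 1}. if c = 0 then s else r)"

definition cub3 :: "'s \<Rightarrow> 's \<Rightarrow> 's \<Rightarrow> nat \<Rightarrow> 's" where
  "cub3 s r q = (\<lambda>c\<in>{0, 1, 2}. if c = 0 then s else if c = 1 then r else q)"

lemma cub2_cube: "\<lbrakk>s \<in> mono_maps m 1; r \<in> mono_maps m 1\<rbrakk> \<Longrightarrow> cub2 s r \<in> simps (cube {0, 1}) m"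
  by (auto simp: simps_cube cub2_def)

lemma cub3_cube:
  "\<lbrakk>s \<in> mono_maps m 1; r \<in> mono_maps m 1; q \<in> mono_maps m 1\<rbrakk> \<Longrightarrow> cub3 s r q \<in> simps (cube {0, 1, 2}) m"
  by (auto simp: simps_cube cub3_def)

lemma sact_cub2:
  "sact (cube {0, 1}) l m f (cub2 s r) = cub2 (compose {..l} s f) (compose {..l} r f)"
  by (auto simp: sact_cube cub2_def fun_eq_iff)

lemma sact_cub3:
  "sact (cube {0, 1, 2}) l m f (cub3 s r q) =
    cub3 (compose {..l} s f) (compose {..l} r f) (compose {..l} q f)"
  by (auto simp: sact_cube cub3_def fun_eq_iff)

lemma path_of_square: "\<lbrakk>square X \<theta>; e \<le> 1\<rbrakk> \<Longrightarrow> path X (\<lambda>m s. \<theta> m s (ct e m))"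
  "\<lbrakk>square X \<theta>; e \<le> 1\<rbrakk> \<Longrightarrow> path X (\<lambda>m s. \<theta> m (ct e m) s)"
  unfolding square_def path_def using ct_mono compose_ct by (metis (no_types, lifting))+

text \<open>
  The square is filled from the three sides \<open>a\<close>, \<open>c\<close> (first coordinate \<open>0\<close>, \<open>1\<close>) and \<open>b\<close> (second
  coordinate \<open>1 - e\<close>).  Up to homotopy, its fourth side is a composite of these paths and their inverses.
\<close>

lemma square_fill:
  assumes kan: "kan X" and e: "e \<le> 1" and p: "path X a" "path X c" "path X b"
    and ab: "\<And>m. a m (ct (1 - e) m) = b m (ct 0 m)" and cb: "\<And>m. c m (ct (1 - e) m) = b m (ct 1 m)"
  shows "\<exists>Q. square X Q \<and> (\<forall>m. \<forall>s\<in>mono_maps m 1. Q m (ct 0 m) s = a m s \<and> Q m (ct 1 m) s = c m s \<and>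
    Q m s (ct (1 - e) m) = b m s)"
proof -
  let ?T = "{0, 1 :: nat}"
  let ?Ps = "[(face 0 0, \<lambda>m z. a m (z 1)), (face 0 1, \<lambda>m z. c m (z 1)), (face 1 (1 - e), \<lambda>m z. b m (z 0))]"
  have "\<exists>w. natural_on ?T whole X w \<and>
    (\<forall>P\<in>set ?Ps. \<forall>m. \<forall>z\<in>simps (cube ?T) m. fst P m z \<longrightarrow> w m z = snd P m z)"
  proof (rule box_fill_kan[OF kan, where k = 1 and e = e])
    show "stable ?T (fst P)" if "P \<in> set ?Ps" for P using that by (auto intro: stable_face)
    show "natural_on ?T (fst P) X (snd P)" if "P \<in> set ?Ps" for P
      using that p by (auto intro: natural_on_path)
    show "sorted_wrt (agree ?T) ?Ps"
      using ab cb by (auto simp: agree_def face_eq) (auto simp: face_def)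
    show "obox ?T 1 e m z \<longleftrightarrow> (\<exists>P\<in>set ?Ps. fst P m z)" for m z
      by (auto simp: obox_def bdry_def)
  qed (use e in auto)
  then obtain w where w: "natural_on ?T whole X w"
    and wP: "\<And>P m z. P \<in> set ?Ps \<Longrightarrow> z \<in> simps (cube ?T) m \<Longrightarrow> fst P m z \<Longrightarrow> w m z = snd P m z" by blast
  have "square X (\<lambda>m s r. w m (cub2 s r))"
    unfolding square_def
    using natural_on_closed[OF w, OF cub2_cube] natural_on_sact[OF w, OF cub2_cube]
    by (simp add: sact_cub2 del: One_nat_def)
  moreover have "w m (cub2 (ct 0 m) s) = a m s" "w m (cub2 (ct 1 m) s) = c m s"
    "w m (cub2 s (ct (1 - e) m)) = b m s" if s: "s \<in> mono_maps m 1" for m s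
    using wP[of "(face 0 0, \<lambda>m z. a m (z 1))" "cub2 (ct 0 m) s" m]
      wP[of "(face 0 1, \<lambda>m z. c m (z 1))" "cub2 (ct 1 m) s" m]
      wP[of "(face 1 (1 - e), \<lambda>m z. b m (z 0))" "cub2 s (ct (1 - e) m)" m]
      cub2_cube[OF _ s, of "ct 0 m"] cub2_cube[OF _ s, of "ct 1 m"] cub2_cube[OF s ct_mono[of "1 - e" m]] e
    by (auto simp: cub2_def face_ct)
  ultimately show ?thesis by (intro exI[of _ "\<lambda>m s r. w m (cub2 s r)"]) auto
qed

text \<open>
  The faces of the box are \<open>fl\<close>, \<open>fr\<close> (first coordinate \<open>0\<close>, \<open>1\<close>), \<open>gl\<close>, \<open>gr\<close> (second coordinate \<open>0\<close>,
  \<open>1\<close>) and \<open>c\<close> (third coordinate \<open>1 - e\<close>).  The square \<open>Q\<close> is the sixth face of a filler.  So a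
  homotopy \<open>c\<close> is transported along the third coordinate.
\<close>

lemma cube_fill:
  assumes kan: "kan X" and e: "e \<le> 1"
    and sq: "square X fl" "square X fr" "square X gl" "square X gr" "square X c"
    and ab: "\<And>m r. r \<in> mono_maps m 1 \<Longrightarrow> fl m (ct 0 m) r = gl m (ct 0 m) r \<and>
      fl m (ct 1 m) r = gr m (ct 0 m) r \<and> fr m (ct 0 m) r = gl m (ct 1 m) r \<and>
      fr m (ct 1 m) r = gr m (ct 1 m) r"
    and abc: "\<And>m s. s \<in> mono_maps m 1 \<Longrightarrow> fl m s (ct (1 - e) m) = c m (ct 0 m) s \<and>
      fr m s (ct (1 - e) m) = c m (ct 1 m) s \<and> gl m s (ct (1 - e) m) = c m s (ct 0 m) \<and>
      gr m s (ct (1 - e) m) = c m s (ct 1 m)"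
  shows "\<exists>Q. square X Q \<and> (\<forall>m. \<forall>s\<in>mono_maps m 1.
    Q m (ct 0 m) s = fl m s (ct e m) \<and> Q m (ct 1 m) s = fr m s (ct e m) \<and>
    Q m s (ct 0 m) = gl m s (ct e m) \<and> Q m s (ct 1 m) = gr m s (ct e m))"
proof -
  let ?T = "{0, 1, 2 :: nat}"
  let ?Ps = "[(face 0 0, \<lambda>m z. fl m (z 1) (z 2)), (face 0 1, \<lambda>m z. fr m (z 1) (z 2)),
    (face 1 0, \<lambda>m z. gl m (z 0) (z 2)), (face 1 1, \<lambda>m z. gr m (z 0) (z 2)),
    (face 2 (1 - e), \<lambda>m z. c m (z 0) (z 1))]"
  have zT: "z 0 \<in> mono_maps m 1 \<and> z 1 \<in> mono_maps m 1 \<and> z 2 \<in> mono_maps m 1"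
    if "z \<in> simps (cube ?T) m" for z m
    using cube_coord[OF that] by blast
  have "\<exists>w. natural_on ?T whole X w \<and>
    (\<forall>P\<in>set ?Ps. \<forall>m. \<forall>z\<in>simps (cube ?T) m. fst P m z \<longrightarrow> w m z = snd P m z)"
  proof (rule box_fill_kan[OF kan, where k = 2 and e = e])
    show "stable ?T (fst P)" if "P \<in> set ?Ps" for P using that by (auto intro: stable_face)
    show "natural_on ?T (fst P) X (snd P)" if "P \<in> set ?Ps" for P
      using that sq by (auto intro: natural_on_square)
    show "sorted_wrt (agree ?T) ?Ps"
      using ab abc zT by (auto simp: agree_def face_eq) (auto simp: face_def)
    show "obox ?T 2 e m z \<longleftrightarrow> (\<exists>P\<in>set ?Ps. fst P m z)" for m z
      by (auto simp: obox_def bdry_def)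
  qed (use e in auto)
  then obtain w where w: "natural_on ?T whole X w"
    and wP: "\<And>P m z. P \<in> set ?Ps \<Longrightarrow> z \<in> simps (cube ?T) m \<Longrightarrow> fst P m z \<Longrightarrow> w m z = snd P m z" by blast
  define Q where "Q m s r = w m (cub3 s r (ct e m))" for m s r
  have "square X Q"
    unfolding square_def Q_def
    using natural_on_closed[OF w, OF cub3_cube[OF _ _ ct_mono[OF e]]]
      natural_on_sact[OF w, OF cub3_cube[OF _ _ ct_mono[OF e]]]
    by (simp add: sact_cub3 del: One_nat_def)
  moreover have "Q m (ct 0 m) s = fl m s (ct e m) \<and> Q m (ct 1 m) s = fr m s (ct e m) \<and>
    Q m s (ct 0 m) = gl m s (ct e m) \<and> Q m s (ct 1 m) = gr m s (ct e m)" if s: "s \<in> mono_maps m 1" for m s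
    using wP[of "(face 0 0, \<lambda>m z. fl m (z 1) (z 2))" "cub3 (ct 0 m) s (ct e m)" m]
      wP[of "(face 0 1, \<lambda>m z. fr m (z 1) (z 2))" "cub3 (ct 1 m) s (ct e m)" m]
      wP[of "(face 1 0, \<lambda>m z. gl m (z 0) (z 2))" "cub3 s (ct 0 m) (ct e m)" m]
      wP[of "(face 1 1, \<lambda>m z. gr m (z 0) (z 2))" "cub3 s (ct 1 m) (ct e m)" m]
      cub3_cube[OF _ s ct_mono[OF e], of "ct 0 m"] cub3_cube[OF _ s ct_mono[OF e], of "ct 1 m"]
      cub3_cube[OF s _ ct_mono[OF e], of "ct 0 m"] cub3_cube[OF s _ ct_mono[OF e], of "ct 1 m"]
    unfolding Q_def by (auto simp: cub3_def face_ct)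
  ultimately show ?thesis by blast
qed

subsection \<open>Edges\<close>

lemma path_of_edge:
  assumes X: "simplicial_set X" and x: "x \<in> simps X 1"
  shows "path X (\<lambda>m s. sact X m 1 s x)"
  unfolding path_def
  using simplicial_set.act_closed[OF X _ x] simplicial_set.act_comp[OF X _ _ x] by blast

lemma vertex_path:
  assumes X: "simplicial_set X" and x: "x \<in> simps X 1" and e: "e \<le> 1"
  shows "sact X m 1 (ct e m) x = cst X m (vertex X 1 e x)"
proof -
  have f: "(\<lambda>j\<in>{..0}. e) \<in> mono_maps 0 1" using e by (intro mono_mapsI) auto
  have "compose {..m} (\<lambda>j\<in>{..0}. e) (\<lambda>i\<in>{..m}. 0 :: nat) = ct e m"
    by (auto simp: compose_def ct_def fun_eq_iff)
  then show ?thesis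
    using simplicial_set.act_comp[OF X zero_mono_maps f x, of m] by (simp add: cst_def vertex_def)
qed

lemma path_cst: "\<lbrakk>simplicial_set X; a \<in> simps X 0\<rbrakk> \<Longrightarrow> path X (\<lambda>m s. cst X m a)"
  by (simp add: path_def cst_closed sact_cst)

lemma cst_0: "\<lbrakk>simplicial_set X; a \<in> simps X 0\<rbrakk> \<Longrightarrow> cst X 0 a = a"
  using simplicial_set.act_id[of X a 0] by (auto simp: cst_def restrict_def cong: if_cong)

text \<open>
  Being in one component means being connected by a zigzag of edges.  In a Kan simplicial set the
  edges of the zigzag can be composed one after the other by filling squares, whichever way they point.
\<close>

lemma kan_path:
  assumes kan: "kan X" and ab: "(a, b) \<in> pi0_rel X"
  shows "\<exists>\<gamma>. path X \<gamma> \<and> (\<forall>m. \<gamma> m (ct 0 m) = cst X m a \<and> \<gamma> m (ct 1 m) = cst X m b)"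
proof -
  have X: "simplicial_set X" using kan by (simp add: kan_def)
  have a: "a \<in> simps X 0" and "(a, b) \<in> (edge_rel X \<union> (edge_rel X)\<inverse>)\<^sup>*"
    using ab by (auto simp: pi0_rel_def)
  from this(2) show ?thesis
  proof induction
    case base
    show ?case using path_cst[OF X a] by blast
  next
    case (step y z)
    then obtain \<gamma> where \<gamma>: "path X \<gamma>"
      and \<gamma>0: "\<And>m. \<gamma> m (ct 0 m) = cst X m a" and \<gamma>1: "\<And>m. \<gamma> m (ct 1 m) = cst X m y" by blast
    obtain x e where x: "x \<in> simps X 1" and e: "e \<le> 1"
      and v: "vertex X 1 (1 - e) x = y" "vertex X 1 e x = z"
    proof -
      have "(y, z) \<in> edge_rel X \<or> (z, y) \<in> edge_rel X" using step.hyps(2) by auto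
      then show ?thesis
      proof
        assume "(y, z) \<in> edge_rel X"
        then show ?thesis using that[of _ 1] unfolding edge_rel_def by auto
      next
        assume "(z, y) \<in> edge_rel X"
        then show ?thesis using that[of _ 0] unfolding edge_rel_def by auto
      qed
    qed
    have "\<exists>Q. square X Q \<and> (\<forall>m. \<forall>s\<in>mono_maps m 1. Q m (ct 0 m) s = cst X m a \<and>
       Q m (ct 1 m) s = sact X m 1 s x \<and> Q m s (ct (1 - e) m) = \<gamma> m s)"
      using e v \<gamma>0 \<gamma>1 by (intro square_fill[OF kan e path_cst[OF X a] path_of_edge[OF X x] \<gamma>])
        (simp_all add: vertex_path[OF X x] del: One_nat_def)
    then obtain Q where Q: "square X Q" "\<And>m s. s \<in> mono_maps m 1 \<Longrightarrow> Q m (ct 0 m) s = cst X m a"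
      "\<And>m s. s \<in> mono_maps m 1 \<Longrightarrow> Q m (ct 1 m) s = sact X m 1 s x" by blast
    show ?case
      using path_of_square(1)[OF Q(1) e] Q(2,3)[OF ct_mono[OF e]] vertex_path[OF X x e] v(2)
      by (intro exI[of _ "\<lambda>m s. Q m s (ct e m)"]) simp
  qed
qed

section \<open>Coherent homotopy inverses\<close>

text \<open>
  The vertex \<open>1\<close> of the interval has to keep its form, since the rules about constant coordinates
  match the term \<open>ct 1 m\<close>.
\<close>

declare One_nat_def [simp del]

text \<open>
  The connection \<open>(s, r) \<mapsto> max s r\<close> of the interval, which contracts a path to its end point.
\<close>

definition mx :: "nat \<Rightarrow> (nat \<Rightarrow> nat) \<Rightarrow> (nat \<Rightarrow> nat) \<Rightarrow> nat \<Rightarrow> nat" where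
  "mx m s r = (\<lambda>i\<in>{..m}. max (s i) (r i))"

lemma mx_mono: "\<lbrakk>s \<in> mono_maps m 1; r \<in> mono_maps m 1\<rbrakk> \<Longrightarrow> mx m s r \<in> mono_maps m 1"
  unfolding mx_def using mono_maps_le[of _ m 1] mono_maps_mono[of _ m 1]
  by (intro mono_mapsI) (auto simp: max.coboundedI1 max.coboundedI2)

lemma mx_ct:
  assumes "s \<in> mono_maps m 1"
  shows "mx m s (ct 0 m) = s" "mx m (ct 0 m) s = s" "mx m s (ct 1 m) = ct 1 m" "mx m (ct 1 m) s = ct 1 m"
proof -
  have "s i \<le> 1" if "i \<le> m" for i using mono_maps_le[OF assms that] .
  then show "mx m s (ct 1 m) = ct 1 m" "mx m (ct 1 m) s = ct 1 m"
    by (auto simp: mx_def ct_def fun_eq_iff max_def intro: le_antisym)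
  have "s \<in> extensional {..m}" using assms by (auto simp: mono_maps_def PiE_iff)
  then show "mx m s (ct 0 m) = s" "mx m (ct 0 m) s = s"
    by (auto simp: mx_def ct_def fun_eq_iff extensional_def)
qed

lemma compose_mx: "f \<in> mono_maps l m \<Longrightarrow> compose {..l} (mx m s r) f = mx l (compose {..l} s f) (compose {..l} r f)"
  by (auto simp: mx_def compose_def fun_eq_iff mono_maps_le)

lemma square_fst: "path X \<gamma> \<Longrightarrow> square X (\<lambda>m s r. \<gamma> m s)"
  and square_snd: "path X \<gamma> \<Longrightarrow> square X (\<lambda>m s r. \<gamma> m r)"
  and square_mx: "path X \<gamma> \<Longrightarrow> square X (\<lambda>m s r. \<gamma> m (mx m s r))"
  unfolding square_def path_def using mx_mono by (auto simp: compose_mx[symmetric])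

context simplicial_category
begin

lemma path_comp:
  assumes "x \<in> sob C" "y \<in> sob C" "z \<in> sob C" "path (shom C y z) \<psi>" "path (shom C x y) \<phi>"
  shows "path (shom C x z) (\<lambda>m s. scomp C x y z m (\<psi> m s) (\<phi> m s))"
  unfolding path_def using assms comp_closed[OF assms(1-3)] comp_natural[OF assms(1-3)] 
  by (simp add: path_def)

lemma square_comp:
  assumes "x \<in> sob C" "y \<in> sob C" "z \<in> sob C" "square (shom C y z) \<psi>" "square (shom C x y) \<phi>"
  shows "square (shom C x z) (\<lambda>m s r. scomp C x y z m (\<psi> m s r) (\<phi> m s r))"
  unfolding square_def using assms comp_closed[OF assms(1-3)] comp_natural[OF assms(1-3)] 
  by (simp add: square_def)

lemma cst_comp:
  assumes "x \<in> sob C" "y \<in> sob C" "z \<in> sob C" "b \<in> simps (shom C y z) 0" "a \<in> simps (shom C x y) 0"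
  shows "cst (shom C x z) m (scomp C x y z 0 b a) = scomp C x y z m (cst (shom C y z) m b) (cst (shom C x y) m a)"
  unfolding cst_def by (rule comp_natural[OF assms(1-3) zero_mono_maps assms(4,5)])

lemma cst_sid: "cst (shom C x x) m (sid C x) = sidn C x m"
  by (simp add: cst_def sidn_def)

lemma sidn_closed: "x \<in> sob C \<Longrightarrow> sidn C x m \<in> simps (shom C x x) m"
  unfolding cst_sid[symmetric] by (intro cst_closed hom_sset id_closed)

lemma comp_assoc_right:
  "\<lbrakk>w \<in> sob C; x \<in> sob C; y \<in> sob C; z \<in> sob C;
    c \<in> simps (shom C y z) n; b \<in> simps (shom C x y) n; a \<in> simps (shom C w x) n\<rbrakk>
    \<Longrightarrow> scomp C w x z n (scomp C x y z n c b) a = scomp C w y z n c (scomp C w x y n b a)"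
  by (simp add: comp_assoc)

lemmas comp_simps = comp_closed comp_assoc_right comp_id_left comp_id_right

definition homotopy_inverse :: "'o \<Rightarrow> 'o \<Rightarrow> 'a \<Rightarrow> 'a \<Rightarrow> bool" where
  "homotopy_inverse x y \<alpha> \<beta> \<longleftrightarrow> \<alpha> \<in> simps (shom C x y) 0 \<and> \<beta> \<in> simps (shom C y x) 0 \<and>
    (scomp C x y x 0 \<beta> \<alpha>, sid C x) \<in> pi0_rel (shom C x x) \<and>
    (scomp C y x y 0 \<alpha> \<beta>, sid C y) \<in> pi0_rel (shom C y y)"

text \<open>
  Homotopies \<open>\<eta>: \<alpha>\<beta> \<simeq> 1\<close> and \<open>\<zeta>: \<beta>\<alpha> \<simeq> 1\<close> chosen independently give two unrelated homotopies \<open>\<eta>\<alpha>\<close>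
  and \<open>\<alpha>\<zeta>\<close> from \<open>\<alpha>\<beta>\<alpha>\<close> to \<open>\<alpha>\<close>.  They become homotopic when \<open>\<zeta>\<close> is replaced by the conjugate \<open>\<epsilon>\<close> of
  \<open>\<beta>\<eta>\<alpha>\<close> by \<open>\<zeta>\<close>, the correction that turns an equivalence of categories into an adjoint one; \<open>\<theta>\<close> is the
  homotopy between \<open>\<alpha>\<epsilon>\<close> and \<open>\<eta>\<alpha>\<close>, relative to the end points.
\<close>

theorem coherent_homotopy_inverse:
  assumes o: "x \<in> sob C" "y \<in> sob C" and kan: "kan (shom C x x)" "kan (shom C x y)" "kan (shom C y y)"
    and inv: "homotopy_inverse x y \<alpha> \<beta>"
  defines "A \<equiv> cst (shom C x y)" and "B \<equiv> cst (shom C y x)"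
  shows "\<exists>\<eta> \<epsilon> \<theta>. path (shom C y y) \<eta> \<and> path (shom C x x) \<epsilon> \<and> square (shom C x y) \<theta> \<and>
    (\<forall>m. \<eta> m (ct 0 m) = scomp C y x y m (A m \<alpha>) (B m \<beta>) \<and> \<eta> m (ct 1 m) = sidn C y m \<and>
      \<epsilon> m (ct 0 m) = scomp C x y x m (B m \<beta>) (A m \<alpha>) \<and> \<epsilon> m (ct 1 m) = sidn C x m) \<and>
    (\<forall>m. \<forall>s\<in>mono_maps m 1.
      \<theta> m (ct 0 m) s = scomp C x y y m (scomp C y x y m (A m \<alpha>) (B m \<beta>)) (A m \<alpha>) \<and>
      \<theta> m (ct 1 m) s = A m \<alpha> \<and>
      \<theta> m s (ct 0 m) = scomp C x x y m (A m \<alpha>) (\<epsilon> m s) \<and>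
      \<theta> m s (ct 1 m) = scomp C x y y m (\<eta> m s) (A m \<alpha>))"
proof -
  have \<alpha>: "\<alpha> \<in> simps (shom C x y) 0" and \<beta>: "\<beta> \<in> simps (shom C y x) 0" using inv by (auto simp: homotopy_inverse_def)
  obtain \<eta> where \<eta>: "path (shom C y y) \<eta>"
    and \<eta>e: "\<And>m. \<eta> m (ct 0 m) = cst (shom C y y) m (scomp C y x y 0 \<alpha> \<beta>)"
      "\<And>m. \<eta> m (ct 1 m) = cst (shom C y y) m (sid C y)"
    using kan_path[OF kan(3)] inv unfolding homotopy_inverse_def by blast
  obtain \<zeta> where \<zeta>: "path (shom C x x) \<zeta>"
    and \<zeta>e: "\<And>m. \<zeta> m (ct 0 m) = cst (shom C x x) m (scomp C x y x 0 \<beta> \<alpha>)"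
      "\<And>m. \<zeta> m (ct 1 m) = cst (shom C x x) m (sid C x)"
    using kan_path[OF kan(1)] inv unfolding homotopy_inverse_def by blast
  define a b where "a m = A m \<alpha>" and "b m = B m \<beta>" for m
  have pa: "path (shom C x y) (\<lambda>m s. a m)" and pb: "path (shom C y x) (\<lambda>m s. b m)"
    unfolding a_def b_def A_def B_def
    by (rule path_cst[OF hom_sset[OF o] \<alpha>], rule path_cst[OF hom_sset[OF o(2,1)] \<beta>])
  have ac: "a m \<in> simps (shom C x y) m" and bc: "b m \<in> simps (shom C y x) m" for m
    unfolding a_def b_def A_def B_def
    by (rule cst_closed[OF hom_sset[OF o] \<alpha>], rule cst_closed[OF hom_sset[OF o(2,1)] \<beta>])
  have e: "\<eta> m (ct 0 m) = scomp C y x y m (a m) (b m)" "\<eta> m (ct 1 m) = sidn C y m"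
    "\<zeta> m (ct 0 m) = scomp C x y x m (b m) (a m)" "\<zeta> m (ct 1 m) = sidn C x m" for m
    using o \<alpha> \<beta> by (simp_all add: \<eta>e \<zeta>e cst_sid cst_comp a_def b_def A_def B_def)
  note closed = path_closed[OF \<eta>] path_closed[OF \<zeta>] ac bc mx_mono sidn_closed
  note nf = o closed comp_simps e mx_ct
  note sq = o path_comp square_comp square_fst square_snd square_mx \<eta> \<zeta> pa pb
  \<comment> \<open>\<open>Z\<close> is a homotopy between the paths \<open>\<alpha>\<beta>\<eta>(t)\<alpha>\<close> and \<open>\<eta>(t)\<alpha>\<beta>\<alpha>\<close> with fixed end points.  They are
    the two edges \<open>\<eta>(0)\<eta>(t)\<alpha>\<close> and \<open>\<eta>(t)\<eta>(0)\<alpha>\<close> of the square \<open>\<eta>(s)\<eta>(r)\<alpha>\<close>, and this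
    square contracts both paths to its vertex \<open>\<alpha>\<close>, where \<open>s = r = 1\<close>.\<close>
  define N where "N m s r = scomp C x y y m (\<eta> m s) (scomp C x y y m (\<eta> m r) (a m))" for m s r
  have "\<exists>Z. square (shom C x y) Z \<and> (\<forall>m. \<forall>s\<in>mono_maps m 1.
    Z m (ct 0 m) s = N m (ct 0 m) (ct 0 m) \<and>
    Z m (ct 1 m) s = scomp C x y y m (\<eta> m (ct 0 m)) (a m) \<and>
    Z m s (ct 0 m) = N m (ct 0 m) (mx m s (ct 0 m)) \<and> Z m s (ct 1 m) = N m (mx m s (ct 0 m)) (ct 0 m))"
  proof (rule cube_fill[OF kan(2), where e = 0 and fl = "\<lambda>m w s. N m s s"
        and fr = "\<lambda>m w s. scomp C x y y m (\<eta> m s) (a m)" and gl = "\<lambda>m t s. N m s (mx m t s)"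
        and gr = "\<lambda>m t s. N m (mx m t s) s" and c = "\<lambda>m t w. a m"])
    show "square (shom C x y) (\<lambda>m w s. N m s s)" "square (shom C x y) (\<lambda>m t s. N m s (mx m t s))"
      "square (shom C x y) (\<lambda>m t s. N m (mx m t s) s)"
      "square (shom C x y) (\<lambda>m w s. scomp C x y y m (\<eta> m s) (a m))"
      "square (shom C x y) (\<lambda>m t w. a m)"
      unfolding N_def by (intro sq)+
  qed (simp_all add: N_def nf)
  then obtain Z where Z: "square (shom C x y) Z"
    and Ze: "\<And>m s. s \<in> mono_maps m 1 \<Longrightarrow> Z m (ct 0 m) s = N m (ct 0 m) (ct 0 m) \<and>
      Z m (ct 1 m) s = scomp C x y y m (\<eta> m (ct 0 m)) (a m) \<and>
      Z m s (ct 0 m) = N m (ct 0 m) s \<and> Z m s (ct 1 m) = N m s (ct 0 m)"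
    using mx_ct(1) by fastforce
  \<comment> \<open>The side \<open>r = 1\<close> of \<open>Q(t, r)\<close> is \<open>\<epsilon>(t)\<close>; the others are \<open>\<beta>\<eta>(t)\<alpha>\<close> at \<open>r = 0\<close>, \<open>\<beta>\<alpha>\<zeta>(r)\<close> and \<open>\<zeta>(r)\<close>.\<close>
  have "\<exists>Q. square (shom C x x) Q \<and> (\<forall>m. \<forall>s\<in>mono_maps m 1.
    Q m (ct 0 m) s = scomp C x y x m (b m) (scomp C x x y m (a m) (\<zeta> m s)) \<and> Q m (ct 1 m) s = \<zeta> m s \<and>
    Q m s (ct (1 - 1) m) = scomp C x y x m (b m) (scomp C x y y m (\<eta> m s) (a m)))"
  proof (rule square_fill[OF kan(1)])
    show "path (shom C x x) (\<lambda>m s. scomp C x y x m (b m) (scomp C x x y m (a m) (\<zeta> m s)))"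
      "path (shom C x x) (\<lambda>m s. scomp C x y x m (b m) (scomp C x y y m (\<eta> m s) (a m)))"
      by (intro sq)+
  qed (simp_all add: nf \<zeta>)
  then obtain Q where Q: "square (shom C x x) Q"
    and Qe: "\<And>m s. s \<in> mono_maps m 1 \<Longrightarrow>
      Q m (ct 0 m) s = scomp C x y x m (b m) (scomp C x x y m (a m) (\<zeta> m s)) \<and> Q m (ct 1 m) s = \<zeta> m s \<and>
      Q m s (ct 0 m) = scomp C x y x m (b m) (scomp C x y y m (\<eta> m s) (a m))"
    by auto
  define \<epsilon> where "\<epsilon> m s = Q m s (ct 1 m)" for m s
  have \<epsilon>: "path (shom C x x) \<epsilon>" unfolding \<epsilon>_def by (rule path_of_square[OF Q]) simp
  \<comment> \<open>The squares \<open>\<alpha>Q(t, r)\<close> and \<open>\<eta>(t)\<alpha>\<zeta>(r)\<close> have the same sides \<open>t = 0\<close> and \<open>t = 1\<close>; since \<open>Z\<close> joins their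
    sides \<open>r = 0\<close>, there is a homotopy \<open>\<theta>\<close> between their sides \<open>r = 1\<close>.\<close>
  have "\<exists>\<theta>. square (shom C x y) \<theta> \<and> (\<forall>m. \<forall>s\<in>mono_maps m 1.
    \<theta> m (ct 0 m) s = scomp C x x y m (a m) (scomp C x y x m (b m) (scomp C x x y m (a m) (\<zeta> m (ct 1 m)))) \<and>
    \<theta> m (ct 1 m) s = scomp C x x y m (a m) (\<zeta> m (ct 1 m)) \<and>
    \<theta> m s (ct 0 m) = scomp C x x y m (a m) (Q m s (ct 1 m)) \<and>
    \<theta> m s (ct 1 m) = scomp C x y y m (\<eta> m s) (scomp C x x y m (a m) (\<zeta> m (ct 1 m))))"
  proof (rule cube_fill[OF kan(2), where e = 1 and c = Z and gl = "\<lambda>m t r. scomp C x x y m (a m) (Q m t r)"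
        and fl = "\<lambda>m w r. scomp C x x y m (a m) (scomp C x y x m (b m) (scomp C x x y m (a m) (\<zeta> m r)))"
        and fr = "\<lambda>m w r. scomp C x x y m (a m) (\<zeta> m r)"
        and gr = "\<lambda>m t r. scomp C x y y m (\<eta> m t) (scomp C x x y m (a m) (\<zeta> m r))"])
    show "square (shom C x y) (\<lambda>m w r. scomp C x x y m (a m) (scomp C x y x m (b m) (scomp C x x y m (a m) (\<zeta> m r))))"
      "square (shom C x y) (\<lambda>m w r. scomp C x x y m (a m) (\<zeta> m r))"
      "square (shom C x y) (\<lambda>m t r. scomp C x x y m (a m) (Q m t r))"
      "square (shom C x y) (\<lambda>m t r. scomp C x y y m (\<eta> m t) (scomp C x x y m (a m) (\<zeta> m r)))"
      by (intro sq Q)+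
  qed (simp_all add: Z Ze Qe N_def nf)
  then obtain \<theta> where \<theta>: "square (shom C x y) \<theta>"
    and \<theta>e: "\<And>m s. s \<in> mono_maps m 1 \<Longrightarrow>
      \<theta> m (ct 0 m) s = scomp C x y y m (scomp C y x y m (a m) (b m)) (a m) \<and> \<theta> m (ct 1 m) s = a m \<and>
      \<theta> m s (ct 0 m) = scomp C x x y m (a m) (\<epsilon> m s) \<and> \<theta> m s (ct 1 m) = scomp C x y y m (\<eta> m s) (a m)"
    by (auto simp: \<epsilon>_def nf)
  have "\<epsilon> m (ct 0 m) = scomp C x y x m (b m) (a m)" "\<epsilon> m (ct 1 m) = sidn C x m" for m
    unfolding \<epsilon>_def by (simp_all add: Qe nf)
  then show ?thesis
    using \<eta> \<epsilon> \<theta> \<theta>e e(1,2) unfolding a_def b_def by (intro exI[of _ \<eta>] exI[of _ \<epsilon>] exI[of _ \<theta>]) simp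
qed

end

section \<open>Extension along a homotopy equivalence\<close>

subsection \<open>Restricting and setting coordinates\<close>

lemma restrict_self: "z \<in> simps (cube S) m \<Longrightarrow> restrict z S = z"
  by (auto simp: simps_cube)

lemma restrict_upd: "t \<notin> S \<Longrightarrow> restrict (z(t := a)) S = restrict z S"
  "t \<notin> S \<Longrightarrow> restrict (z(t := a)) (insert t S) = (restrict z S)(t := a)"
  "\<lbrakk>t \<notin> S; w \<noteq> t\<rbrakk> \<Longrightarrow> restrict (z(t := a)) (insert w S) = restrict z (insert w S)"
  by (auto simp: restrict_def fun_eq_iff)

lemma restrict_insert: "t \<notin> S \<Longrightarrow> restrict z (insert t S) = (restrict z S)(t := z t)"
  by (auto simp: restrict_def fun_eq_iff)

lemma upd_cube: "\<lbrakk>z \<in> simps (cube S) m; e \<le> 1\<rbrakk> \<Longrightarrow> z(t := ct e m) \<in> simps (cube (insert t S)) m"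
  using ct_mono[of e m] unfolding simps_cube by (auto simp: PiE_iff extensional_def)

lemma upd_sact:
  "f \<in> mono_maps l m \<Longrightarrow> t \<notin> S \<Longrightarrow>
    sact (cube (insert t S)) l m f (z(t := ct e m)) = (sact (cube S) l m f z)(t := ct e l)"
  by (auto simp: sact_cube fun_eq_iff)

lemma natural_on_upd:
  assumes "natural_on (insert t S) whole X \<phi>" "t \<notin> S" "e \<le> 1"
  shows "natural_on S whole X (\<lambda>m z. \<phi> m (z(t := ct e m)))"
  unfolding natural_on_def
  using natural_on_closed[OF assms(1), OF upd_cube[OF _ assms(3)]]
    natural_on_sact[OF assms(1), OF upd_cube[OF _ assms(3)]] by (simp add: upd_sact assms(2))

lemma face_upd: "c \<noteq> t \<Longrightarrow> face c e m (z(t := a)) \<longleftrightarrow> face c e m z" "face t e m (z(t := ct e m))"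
  by (auto simp: face_def ct_def)

lemma bdry_upd: "t \<notin> S \<Longrightarrow> bdry S m (z(t := a)) \<longleftrightarrow> bdry S m z"
  unfolding bdry_def using face_upd(1)[of _ t] by metis

lemma face_restrict: "c \<in> T \<Longrightarrow> face c e m (restrict z T) \<longleftrightarrow> face c e m z"
  by (simp add: face_def)

lemma bdry_restrict: "S \<subseteq> T \<Longrightarrow> bdry S m (restrict z T) \<longleftrightarrow> bdry S m z"
  unfolding bdry_def using face_restrict by blast

lemma obox_insert: "q \<notin> S \<Longrightarrow> obox (insert q S) q e m z \<longleftrightarrow> bdry S m z \<or> face q (1 - e) m z"
  by (simp add: obox_def)

lemma natural_on_map:
  assumes "simplicial_map X Y p" "natural_on T D X \<phi>"
  shows "natural_on T D Y (\<lambda>m z. p m (\<phi> m z))"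
  unfolding natural_on_def
  using simplicial_map.map_closed[OF assms(1) natural_on_closed[OF assms(2)]]
    simplicial_map.map_natural[OF assms(1) _ natural_on_closed[OF assms(2)]]
    natural_on_sact[OF assms(2)] by simp

text \<open>
  Composition with the homotopy equivalence \<open>\<alpha>: x \<rightarrow> y\<close> is a homotopy equivalence from \<open>Hom(y,z)\<close> to
  \<open>Hom(x,z)\<close>, so an open box \<open>h\<close> in \<open>Hom(x,z)\<close> can be filled in such a way that its missing face
  becomes \<open>U\<alpha>\<close>, for some extension \<open>U\<close> of the given map \<open>u\<close> on the boundary of that face.  The
  filling lies over prescribed cubes \<open>v\<close> and \<open>g\<close>, which is why it cannot be found by homotopy theory
  in \<open>C\<close> alone: every homotopy used must be a lift of its image in \<open>D\<close>.
\<close>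

theorem (in simplicial_functor) extend_along_equivalence:
  fixes x y z and S :: "nat set"
  defines "A \<equiv> cst (shom C x y)"
  assumes o: "x \<in> sob C" "y \<in> sob C" "z \<in> sob C"
    and kan: "kan (shom C x x)" "kan (shom C x y)" "kan (shom C y y)"
    and p: "kan_fibration (shom C y z) (shom D (fob F y) (fob F z)) (farr F y z)"
    and r: "kan_fibration (shom C x z) (shom D (fob F x) (fob F z)) (farr F x z)"
    and inv: "C.homotopy_inverse x y \<alpha> \<beta>"
    and S: "finite S" "q \<notin> S"
    and u: "natural_on S (bdry S) (shom C y z) u"
    and v: "natural_on S whole (shom D (fob F y) (fob F z)) v"
    and uv: "\<And>m t. \<lbrakk>t \<in> simps (cube S) m; bdry S m t\<rbrakk> \<Longrightarrow> farr F y z m (u m t) = v m t"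
    and h: "natural_on (insert q S) (obox (insert q S) q 0) (shom C x z) h"
    and g: "natural_on (insert q S) whole (shom D (fob F x) (fob F z)) g"
    and hg: "\<And>m t. \<lbrakk>t \<in> simps (cube (insert q S)) m; obox (insert q S) q 0 m t\<rbrakk> \<Longrightarrow> farr F x z m (h m t) = g m t"
    and hu: "\<And>m t. \<lbrakk>t \<in> simps (cube (insert q S)) m; face q 0 m t; bdry S m t\<rbrakk>
      \<Longrightarrow> h m t = scomp C x y z m (u m (restrict t S)) (A m \<alpha>)"
    and gv: "\<And>m t. \<lbrakk>t \<in> simps (cube (insert q S)) m; face q 0 m t\<rbrakk>
      \<Longrightarrow> g m t = scomp D (fob F x) (fob F y) (fob F z) m (v m (restrict t S)) (farr F x y m (A m \<alpha>))"
  shows "\<exists>U H. natural_on S whole (shom C y z) U \<and>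
      (\<forall>m. \<forall>t\<in>simps (cube S) m. farr F y z m (U m t) = v m t \<and> (bdry S m t \<longrightarrow> U m t = u m t)) \<and>
      natural_on (insert q S) whole (shom C x z) H \<and>
      (\<forall>m. \<forall>t\<in>simps (cube (insert q S)) m. farr F x z m (H m t) = g m t \<and>
        (obox (insert q S) q 0 m t \<longrightarrow> H m t = h m t) \<and>
        (face q 0 m t \<longrightarrow> H m t = scomp C x y z m (U m (restrict t S)) (A m \<alpha>)))"
proof -
  let ?B = "cst (shom C y x)"
  have \<alpha>: "\<alpha> \<in> simps (shom C x y) 0" and \<beta>: "\<beta> \<in> simps (shom C y x) 0"
    using inv by (auto simp: C.homotopy_inverse_def)
  define a b where "a m = A m \<alpha>" and "b m = ?B m \<beta>" for m
  have ac: "a m \<in> simps (shom C x y) m" and bc: "b m \<in> simps (shom C y x) m" for m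
    unfolding a_def b_def A_def
    by (rule cst_closed[OF C.hom_sset[OF o(1,2)] \<alpha>], rule cst_closed[OF C.hom_sset[OF o(2,1)] \<beta>])
  have na: "natural_on T P (shom C x y) (\<lambda>m z. a m)" and nb: "natural_on T P (shom C y x) (\<lambda>m z. b m)" for T P
    unfolding a_def b_def A_def
    by (rule natural_on_cst[OF C.hom_sset[OF o(1,2)] \<alpha>], rule natural_on_cst[OF C.hom_sset[OF o(2,1)] \<beta>])
  obtain \<eta> \<epsilon> \<theta> where \<eta>: "path (shom C y y) \<eta>" and \<epsilon>: "path (shom C x x) \<epsilon>" and \<theta>: "square (shom C x y) \<theta>"
    and e: "\<And>m. \<eta> m (ct 0 m) = scomp C y x y m (a m) (b m)" "\<And>m. \<eta> m (ct 1 m) = sidn C y m"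
      "\<And>m. \<epsilon> m (ct 0 m) = scomp C x y x m (b m) (a m)" "\<And>m. \<epsilon> m (ct 1 m) = sidn C x m"
    and \<theta>e: "\<And>m s. s \<in> mono_maps m 1 \<Longrightarrow>
        \<theta> m (ct 0 m) s = scomp C x y y m (scomp C y x y m (a m) (b m)) (a m)"
      "\<And>m s. s \<in> mono_maps m 1 \<Longrightarrow> \<theta> m (ct 1 m) s = a m"
      "\<And>m s. s \<in> mono_maps m 1 \<Longrightarrow> \<theta> m s (ct 0 m) = scomp C x x y m (a m) (\<epsilon> m s)"
      "\<And>m s. s \<in> mono_maps m 1 \<Longrightarrow> \<theta> m s (ct 1 m) = scomp C x y y m (\<eta> m s) (a m)"
    using C.coherent_homotopy_inverse[OF o(1,2) kan inv] unfolding a_def b_def A_def by blast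
  \<comment> \<open>Two further coordinates, for homotopies.\<close>
  obtain t where t: "t \<notin> insert q S" using ex_new_if_finite[of "insert q S"] S(1) by auto
  obtain w where w: "w \<notin> insert t (insert q S)" using ex_new_if_finite[of "insert t (insert q S)"] S(1) by auto
  have fresh: "t \<notin> S" "w \<notin> S" "t \<noteq> q" "w \<noteq> q" "w \<noteq> t" "t \<noteq> w" "q \<noteq> t" "q \<noteq> w" using t w by auto
  note o' = ob_closed[OF o(1)] ob_closed[OF o(2)] ob_closed[OF o(3)]
  have fc: "farr F i j m c \<in> simps (shom D (fob F i) (fob F j)) m"
    if "i \<in> sob C" "j \<in> sob C" "c \<in> simps (shom C i j) m" for i j m c
    using simplicial_map.map_closed[OF arr_map[OF that(1,2)] that(3)] .
  have fid: "farr F y y m (sidn C y m) = sidn D (fob F y) m" for m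
    using simplicial_map.map_natural[OF arr_map[OF o(2,2)] zero_mono_maps C.id_closed[OF o(2)]]
      arr_id[OF o(2)] by (simp add: sidn_def)
  note ug = natural_on_closed[OF u] and vg = natural_on_closed[OF v, OF _ TrueI]
  note closed = path_closed[OF \<eta>] path_closed[OF \<epsilon>] square_closed[OF \<theta>] ac bc C.sidn_closed ug vg fc
  note nf = o o' C.comp_simps D.comp_simps e \<theta>e closed
  note rs = restrict_self restrict_upd face_upd bdry_upd face_restrict bdry_restrict
    restrict_cube upd_cube cube_coord
  note nat = natural_on_path natural_on_square natural_on_restrict
  \<comment> \<open>\<open>Ht\<close> fills the box as if its missing face were free.  This face, \<open>H0\<close>, need not be a composite
    with \<open>\<alpha>\<close>.\<close>
  have "\<exists>Ht. natural_on (insert q S) whole (shom C x z) Ht \<and> (\<forall>m. \<forall>s\<in>simps (cube (insert q S)) m.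
    farr F x z m (Ht m s) = g m s \<and> (obox (insert q S) q 0 m s \<longrightarrow> Ht m s = h m s))"
    by (rule box_lift[OF r, of "insert q S" q 0 h g]) (use S(1) h g hg in simp_all)
  then obtain Ht where Ht: "natural_on (insert q S) whole (shom C x z) Ht"
    and Htg: "\<And>m s. s \<in> simps (cube (insert q S)) m \<Longrightarrow> farr F x z m (Ht m s) = g m s"
    and Hth: "\<And>m s. s \<in> simps (cube (insert q S)) m \<Longrightarrow> obox (insert q S) q 0 m s \<Longrightarrow> Ht m s = h m s"
    by blast
  define H0 where "H0 m s = Ht m (s(q := ct 0 m))" for m s
  have H0: "natural_on S whole (shom C x z) H0"
    unfolding H0_def using natural_on_upd[OF Ht S(2)] by simp
  note H0c = natural_on_closed[OF H0, OF _ TrueI]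
  have H0u: "H0 m s = scomp C x y z m (u m s) (a m)" if "s \<in> simps (cube S) m" "bdry S m s" for m s
    using that S(2) Hth[OF upd_cube[OF that(1), of 0 q]] hu[OF upd_cube[OF that(1), of 0 q]]
    by (simp add: H0_def rs obox_insert a_def)
  have H0v: "farr F x z m (H0 m s) = scomp D (fob F x) (fob F y) (fob F z) m (v m s) (farr F x y m (a m))"
    if "s \<in> simps (cube S) m" for m s
    using that S(2) Htg[OF upd_cube[OF that(1), of 0 q]] gv[OF upd_cube[OF that(1), of 0 q]]
    by (simp add: H0_def rs a_def)
  \<comment> \<open>On the boundary, \<open>H0 \<beta> = u\<alpha>\<beta>\<close>, and \<open>\<eta>\<close> deforms this to \<open>u\<close>.  The deformation extends to a
    deformation \<open>L\<close> of \<open>H0 \<beta>\<close>, and \<open>U\<close> is its end.\<close>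
  let ?T = "insert t S"
  let ?v2 = "\<lambda>m s. scomp D (fob F y) (fob F y) (fob F z) m (v m (restrict s S)) (farr F y y m (\<eta> m (s t)))"
  let ?P2 = "[(face t 0, \<lambda>m s. scomp C y x z m (H0 m (restrict s S)) (b m)),
    (bdry S, \<lambda>m s. scomp C y y z m (u m (restrict s S)) (\<eta> m (s t)))]"
  have "\<exists>L. natural_on ?T whole (shom C y z) L \<and> (\<forall>m. \<forall>s\<in>simps (cube ?T) m. farr F y z m (L m s) = ?v2 m s) \<and>
    (\<forall>P\<in>set ?P2. \<forall>m. \<forall>s\<in>simps (cube ?T) m. fst P m s \<longrightarrow> L m s = snd P m s)"
  proof (rule box_fill[OF p, where k = t and e = 1])
    show "natural_on ?T whole (shom D (fob F y) (fob F z)) ?v2"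
      by (intro D.natural_on_comp o' natural_on_map[OF arr_map] o natural_on_path[OF \<eta>] natural_on_restrict[OF v]) auto
    show "stable ?T (fst P)" if "P \<in> set ?P2" for P
      using that by (auto intro: stable_face stable_bdry)
    have "natural_on ?T (face t 0) (shom C y z) (\<lambda>m s. scomp C y x z m (H0 m (restrict s S)) (b m))"
      by (intro C.natural_on_comp o nb natural_on_restrict[OF H0]) auto
    moreover have "natural_on ?T (bdry S) (shom C y z) (\<lambda>m s. scomp C y y z m (u m (restrict s S)) (\<eta> m (s t)))"
      by (intro C.natural_on_comp o natural_on_path[OF \<eta>] natural_on_restrict[OF u]) (auto simp: bdry_restrict)
    ultimately show "natural_on ?T (fst P) (shom C y z) (snd P)" if "P \<in> set ?P2" for P
      using that by auto
    show "farr F y z m (snd P m s) = ?v2 m s" if "P \<in> set ?P2" "s \<in> simps (cube ?T) m" "fst P m s" for P m s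
    proof -
      have sS: "restrict s S \<in> simps (cube S) m" "s t \<in> mono_maps m 1" using that(2) by (auto intro: rs)
      show ?thesis
        using that sS uv[OF sS(1)] H0v[OF sS(1)] H0c[OF sS(1)]
        by (auto simp: face_eq[of t _ m s ?T] bdry_restrict nf arr_comp)
    qed
    show "sorted_wrt (agree ?T) ?P2"
    proof -
      have "scomp C y x z m (H0 m (restrict s S)) (b m) = scomp C y y z m (u m (restrict s S)) (\<eta> m (s t))"
        if s: "s \<in> simps (cube ?T) m" "face t 0 m s" "bdry S m s" for m s
      proof -
        have sS: "restrict s S \<in> simps (cube S) m" using s(1) by (auto intro: rs)
        show ?thesis using s sS H0u[OF sS] by (simp add: face_eq[of t _ m s ?T] bdry_restrict nf)
      qed
      then show ?thesis by (auto simp: agree_def)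
    qed
    show "obox ?T t 1 m s \<longleftrightarrow> (\<exists>P\<in>set ?P2. fst P m s)" for m s
      using fresh by (auto simp: obox_insert)
  qed (use S in auto)
  then obtain L where L: "natural_on ?T whole (shom C y z) L"
    and Lv: "\<And>m s. s \<in> simps (cube ?T) m \<Longrightarrow> farr F y z m (L m s) = ?v2 m s"
    and L0: "\<And>m s. s \<in> simps (cube ?T) m \<Longrightarrow> face t 0 m s \<Longrightarrow> L m s = scomp C y x z m (H0 m (restrict s S)) (b m)"
    and Lu: "\<And>m s. s \<in> simps (cube ?T) m \<Longrightarrow> bdry S m s \<Longrightarrow> L m s = scomp C y y z m (u m (restrict s S)) (\<eta> m (s t))"
    by auto
  define U where "U m s = L m (s(t := ct 1 m))" for m s
  have U: "natural_on S whole (shom C y z) U"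
    unfolding U_def using natural_on_upd[OF L fresh(1)] by simp
  note Lc = natural_on_closed[OF L, OF _ TrueI]
  have Uu: "U m s = u m s" if s: "s \<in> simps (cube S) m" "bdry S m s" for m s
    using Lu[OF upd_cube[OF s(1), of 1 t]] s fresh by (simp add: U_def rs nf)
  have Uv: "farr F y z m (U m s) = v m s" if s: "s \<in> simps (cube S) m" for m s
    using Lv[OF upd_cube[OF s, of 1 t]] s fresh fid by (simp add: U_def rs nf)
  \<comment> \<open>\<open>H0 \<epsilon>\<close> deforms \<open>H0 \<beta>\<alpha>\<close> to \<open>H0\<close>, and \<open>L\<alpha>\<close> deforms it to \<open>U\<alpha>\<close>; on the boundary these are \<open>u\<alpha>\<epsilon>\<close>
    and \<open>u\<eta>\<alpha>\<close>, which \<open>\<theta>\<close> joins.  Filling gives a homotopy \<open>K\<close> from \<open>H0\<close> to \<open>U\<alpha>\<close>, in the coordinate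
    \<open>w\<close>, that is constant on the boundary and after application of \<open>F\<close>.\<close>
  let ?T = "insert t (insert w S)"
  let ?v3 = "\<lambda>m s. scomp D (fob F x) (fob F y) (fob F z) m (v m (restrict s S)) (farr F x y m (\<theta> m (s t) (s w)))"
  let ?P3 = "[(face w 0, \<lambda>m s. scomp C x x z m (H0 m (restrict s S)) (\<epsilon> m (s t))),
    (face w 1, \<lambda>m s. scomp C x y z m (L m (restrict s (insert t S))) (a m)),
    (face t 0, \<lambda>m s. scomp C x x z m (H0 m (restrict s S)) (scomp C x y x m (b m) (a m))),
    (bdry S, \<lambda>m s. scomp C x y z m (u m (restrict s S)) (\<theta> m (s t) (s w)))]"
  have "\<exists>M. natural_on ?T whole (shom C x z) M \<and> (\<forall>m. \<forall>s\<in>simps (cube ?T) m. farr F x z m (M m s) = ?v3 m s) \<and>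
    (\<forall>P\<in>set ?P3. \<forall>m. \<forall>s\<in>simps (cube ?T) m. fst P m s \<longrightarrow> M m s = snd P m s)"
  proof (rule box_fill[OF r, where k = t and e = 1])
    have sS: "restrict s S \<in> simps (cube S) m" "s t \<in> mono_maps m 1" "s w \<in> mono_maps m 1"
      "restrict s (insert t S) \<in> simps (cube (insert t S)) m" if "s \<in> simps (cube ?T) m" for m s
      using that by (auto intro: rs)
    have rr: "insert t S \<inter> S = S" by auto
    show "natural_on ?T whole (shom D (fob F x) (fob F z)) ?v3"
      by (intro D.natural_on_comp o' natural_on_map[OF arr_map] o natural_on_square[OF \<theta>] natural_on_restrict[OF v]) auto
    show "stable ?T (fst P)" if "P \<in> set ?P3" for P
      using that by (auto intro: stable_face stable_bdry)
    have "natural_on ?T (face w 0) (shom C x z) (\<lambda>m s. scomp C x x z m (H0 m (restrict s S)) (\<epsilon> m (s t)))"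
      by (intro C.natural_on_comp o natural_on_path[OF \<epsilon>] natural_on_restrict[OF H0]) auto
    moreover have "natural_on ?T (face w 1) (shom C x z) (\<lambda>m s. scomp C x y z m (L m (restrict s (insert t S))) (a m))"
      by (intro C.natural_on_comp o na natural_on_restrict[OF L]) auto
    moreover have "natural_on ?T (face t 0) (shom C x z) (\<lambda>m s. scomp C x x z m (H0 m (restrict s S)) (scomp C x y x m (b m) (a m)))"
      by (intro C.natural_on_comp o na nb natural_on_restrict[OF H0]) auto
    moreover have "natural_on ?T (bdry S) (shom C x z) (\<lambda>m s. scomp C x y z m (u m (restrict s S)) (\<theta> m (s t) (s w)))"
      by (intro C.natural_on_comp o natural_on_square[OF \<theta>] natural_on_restrict[OF u]) (auto simp: bdry_restrict)
    ultimately show "natural_on ?T (fst P) (shom C x z) (snd P)" if "P \<in> set ?P3" for P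
      using that by auto
    show "farr F x z m (snd P m s) = ?v3 m s" if "P \<in> set ?P3" "s \<in> simps (cube ?T) m" "fst P m s" for P m s
      using that sS[OF that(2)] uv[OF sS(1)[OF that(2)]] H0v[OF sS(1)[OF that(2)]] H0c[OF sS(1)[OF that(2)]]
        Lv[OF sS(4)[OF that(2)]] Lc[OF sS(4)[OF that(2)]]
      by (auto simp: face_eq[of t _ m s ?T] face_eq[of w _ m s ?T] bdry_restrict nf arr_comp rr)
    show "sorted_wrt (agree ?T) ?P3"
    proof -
      have 1: "scomp C x x z m (H0 m (restrict s S)) (\<epsilon> m (s t)) =
          scomp C x y z m (L m (restrict s (insert t S))) (a m)"
        if "face w 0 m s" "face w 1 m s" for m s using that by (auto simp: face_def)
      have 2: "scomp C x x z m (H0 m (restrict s S)) (\<epsilon> m (s t)) =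
          scomp C x x z m (H0 m (restrict s S)) (scomp C x y x m (b m) (a m))"
        if s: "s \<in> simps (cube ?T) m" "face t 0 m s" for m s
        using face_eq[OF s(2,1)] e(3) by simp
      have 3: "scomp C x x z m (H0 m (restrict s S)) (\<epsilon> m (s t)) =
          scomp C x y z m (u m (restrict s S)) (\<theta> m (s t) (s w))"
        if s: "s \<in> simps (cube ?T) m" "face w 0 m s" "bdry S m s" for m s
        using face_eq[OF s(2,1)] H0u[OF sS(1)[OF s(1)]] s(3) sS[OF s(1)] by (simp add: bdry_restrict nf)
      have 4: "scomp C x y z m (L m (restrict s (insert t S))) (a m) =
          scomp C x x z m (H0 m (restrict s S)) (scomp C x y x m (b m) (a m))"
        if s: "s \<in> simps (cube ?T) m" "face t 0 m s" for m s
        using L0[OF sS(4)[OF s(1)]] s(2) sS[OF s(1)] H0c[OF sS(1)[OF s(1)]] by (simp add: face_restrict nf rr)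
      have 5: "scomp C x y z m (L m (restrict s (insert t S))) (a m) =
          scomp C x y z m (u m (restrict s S)) (\<theta> m (s t) (s w))"
        if s: "s \<in> simps (cube ?T) m" "face w 1 m s" "bdry S m s" for m s
        using face_eq[OF s(2,1)] Lu[OF sS(4)[OF s(1)]] s(3) sS[OF s(1)]
        by (simp add: bdry_restrict subset_insertI nf rr)
      have 6: "scomp C x x z m (H0 m (restrict s S)) (scomp C x y x m (b m) (a m)) =
          scomp C x y z m (u m (restrict s S)) (\<theta> m (s t) (s w))"
        if s: "s \<in> simps (cube ?T) m" "face t 0 m s" "bdry S m s" for m s
        using face_eq[OF s(2,1)] H0u[OF sS(1)[OF s(1)]] s(3) sS[OF s(1)] by (simp add: bdry_restrict nf)
      show ?thesis
        unfolding sorted_wrt.simps agree_def using 1 2 3 4 5 6 by simp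
    qed
    show "obox ?T t 1 m s \<longleftrightarrow> (\<exists>P\<in>set ?P3. fst P m s)" for m s
      using fresh by (auto simp: obox_insert) (auto simp: bdry_def)
  qed (use S in auto)
  then obtain M where M: "natural_on ?T whole (shom C x z) M"
    and Mv: "\<And>m s. s \<in> simps (cube ?T) m \<Longrightarrow> farr F x z m (M m s) = ?v3 m s"
    and Mw0: "\<And>m s. s \<in> simps (cube ?T) m \<Longrightarrow> face w 0 m s \<Longrightarrow> M m s = scomp C x x z m (H0 m (restrict s S)) (\<epsilon> m (s t))"
    and Mw1: "\<And>m s. s \<in> simps (cube ?T) m \<Longrightarrow> face w 1 m s \<Longrightarrow> M m s = scomp C x y z m (L m (restrict s (insert t S))) (a m)"
    and Mu: "\<And>m s. s \<in> simps (cube ?T) m \<Longrightarrow> bdry S m s \<Longrightarrow> M m s = scomp C x y z m (u m (restrict s S)) (\<theta> m (s t) (s w))"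
    by auto
  define K where "K m s = M m (s(t := ct 1 m))" for m s
  have K: "natural_on (insert w S) whole (shom C x z) K"
    unfolding K_def using natural_on_upd[OF M] fresh by simp
  have Kc: "s(t := ct 1 m) \<in> simps (cube ?T) m" "restrict s S \<in> simps (cube S) m" "s w \<in> mono_maps m 1"
    "(restrict s S)(t := ct 1 m) \<in> simps (cube (insert t S)) m"
    if "s \<in> simps (cube (insert w S)) m" for m s
    using that upd_cube[OF that, of 1 t] upd_cube[OF restrict_cube[OF that, of S], of 1 t] by (auto intro: rs)
  have rt: "restrict (s(t := c)) S = restrict s S" "(s(t := c)) w = s w"
    "restrict (s(t := c)) (insert t S) = (restrict s S)(t := c)" for s and c :: "nat \<Rightarrow> nat"
    using restrict_upd(1,2)[OF fresh(1)] fresh(5) by simp_all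
  have K0: "K m s = H0 m (restrict s S)" if s: "s \<in> simps (cube (insert w S)) m" "face w 0 m s" for m s
  proof -
    have "face w 0 m (s(t := ct 1 m))" using s(2) face_upd(1)[OF fresh(5)] by blast
    from Mw0[OF Kc(1)[OF s(1)] this] show ?thesis
      unfolding K_def rt fun_upd_same e by (simp only: C.comp_id_right[OF o(1,3) H0c[OF Kc(2)[OF s(1)]]])
  qed
  have K1: "K m s = scomp C x y z m (U m (restrict s S)) (a m)"
    if s: "s \<in> simps (cube (insert w S)) m" "face w 1 m s" for m s
  proof -
    have "face w 1 m (s(t := ct 1 m))" using s(2) face_upd(1)[OF fresh(5)] by blast
    from Mw1[OF Kc(1)[OF s(1)] this] show ?thesis unfolding K_def U_def rt .
  qed
  have Ku: "K m s = scomp C x y z m (u m (restrict s S)) (a m)"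
    if s: "s \<in> simps (cube (insert w S)) m" "bdry S m s" for m s
  proof -
    have "bdry S m (s(t := ct 1 m))" using s(2) bdry_upd[OF fresh(1)] by blast
    from Mu[OF Kc(1)[OF s(1)] this] show ?thesis
      unfolding K_def rt fun_upd_same \<theta>e(2)[OF Kc(3)[OF s(1)]] .
  qed
  have Kv: "farr F x z m (K m s) = scomp D (fob F x) (fob F y) (fob F z) m (v m (restrict s S)) (farr F x y m (a m))"
    if s: "s \<in> simps (cube (insert w S)) m" for m s
    using Mv[OF Kc(1)[OF s]] unfolding K_def rt fun_upd_same \<theta>e(2)[OF Kc(3)[OF s]] .
  \<comment> \<open>The homotopy \<open>K\<close> of the face \<open>q = 0\<close> of \<open>Ht\<close>, extended constantly to the other faces, spreads to a
    homotopy \<open>N\<close> of \<open>Ht\<close>; its end \<open>H\<close> has the face \<open>U\<alpha>\<close>.\<close>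
  let ?R = "insert q S" and ?T = "insert w (insert q S)"
  let ?P4 = "[(face w 0, \<lambda>m s. Ht m (restrict s ?R)), (face q 0, \<lambda>m s. K m (restrict s (insert w S))),
    (obox ?R q 0, \<lambda>m s. h m (restrict s ?R))]"
  have "\<exists>N. natural_on ?T whole (shom C x z) N \<and>
    (\<forall>m. \<forall>s\<in>simps (cube ?T) m. farr F x z m (N m s) = g m (restrict s ?R)) \<and>
    (\<forall>P\<in>set ?P4. \<forall>m. \<forall>s\<in>simps (cube ?T) m. fst P m s \<longrightarrow> N m s = snd P m s)"
  proof (rule box_fill[OF r, where k = w and e = 1])
    have sS: "restrict s S \<in> simps (cube S) m" "restrict s ?R \<in> simps (cube ?R) m"
      "restrict s (insert w S) \<in> simps (cube (insert w S)) m" if "s \<in> simps (cube ?T) m" for m s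
      using that by (auto intro: rs)
    have rr: "?R \<inter> S = S" "insert w S \<inter> S = S" by auto
    have ob: "obox ?R q 0 m (restrict s ?R) \<longleftrightarrow> obox ?R q 0 m s" for m s
      using S(2) by (simp add: obox_insert face_restrict bdry_restrict subset_insertI)
    show "natural_on ?T whole (shom D (fob F x) (fob F z)) (\<lambda>m s. g m (restrict s ?R))"
      by (rule natural_on_restrict[OF g]) auto
    have "stable ?T (obox ?R q 0)"
      using S(2) stable_face[of q ?T 1] stable_bdry[of S ?T] unfolding stable_def by (auto simp: obox_insert)
    then show "stable ?T (fst P)" if "P \<in> set ?P4" for P
      using that by (auto intro: stable_face)
    have "natural_on ?T (face w 0) (shom C x z) (\<lambda>m s. Ht m (restrict s ?R))"
      "natural_on ?T (face q 0) (shom C x z) (\<lambda>m s. K m (restrict s (insert w S)))"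
      "natural_on ?T (obox ?R q 0) (shom C x z) (\<lambda>m s. h m (restrict s ?R))"
      by (rule natural_on_restrict[OF Ht] natural_on_restrict[OF K] natural_on_restrict[OF h]; auto simp: ob)+
    then show "natural_on ?T (fst P) (shom C x z) (snd P)" if "P \<in> set ?P4" for P
      using that by auto
    show "farr F x z m (snd P m s) = g m (restrict s ?R)"
      if "P \<in> set ?P4" "s \<in> simps (cube ?T) m" "fst P m s" for P m s
      using that Htg[OF sS(2)[OF that(2)]] hg[OF sS(2)[OF that(2)]] Kv[OF sS(3)[OF that(2)]]
        gv[OF sS(2)[OF that(2)]] by (auto simp: rr ob face_restrict a_def)
    show "sorted_wrt (agree ?T) ?P4"
    proof -
      have "Ht m (restrict s ?R) = K m (restrict s (insert w S))"
        if s: "s \<in> simps (cube ?T) m" "face w 0 m s" "face q 0 m s" for m s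
        using K0[OF sS(3)[OF s(1)]] s fresh face_eq[OF s(3,1)]
        by (simp add: H0_def rr face_restrict restrict_insert[OF S(2)])
      moreover have "K m (restrict s (insert w S)) = h m (restrict s ?R)"
        if s: "s \<in> simps (cube ?T) m" "face q 0 m s" "obox ?R q 0 m s" for m s
      proof -
        have "bdry S m s" using s(2,3) S(2) by (auto simp: obox_insert face_def)
        then show ?thesis
          using s Ku[OF sS(3)[OF s(1)]] hu[OF sS(2)[OF s(1)]]
          by (simp add: rr face_restrict bdry_restrict subset_insertI a_def)
      qed
      ultimately show ?thesis using Hth sS by (auto simp: agree_def ob)
    qed
    show "obox ?T w 1 m s \<longleftrightarrow> (\<exists>P\<in>set ?P4. fst P m s)" for m s
      using fresh S(2) by (auto simp: obox_insert) (auto simp: bdry_def)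
  qed (use S in auto)
  then obtain N where N: "natural_on ?T whole (shom C x z) N"
    and Ng: "\<And>m s. s \<in> simps (cube ?T) m \<Longrightarrow> farr F x z m (N m s) = g m (restrict s ?R)"
    and Nq: "\<And>m s. s \<in> simps (cube ?T) m \<Longrightarrow> face q 0 m s \<Longrightarrow> N m s = K m (restrict s (insert w S))"
    and Nh: "\<And>m s. s \<in> simps (cube ?T) m \<Longrightarrow> obox ?R q 0 m s \<Longrightarrow> N m s = h m (restrict s ?R)"
    by auto
  define H where "H m s = N m (s(w := ct 1 m))" for m s
  have H: "natural_on ?R whole (shom C x z) H"
    unfolding H_def using natural_on_upd[OF N] fresh by simp
  have "farr F x z m (H m s) = g m s \<and> (obox ?R q 0 m s \<longrightarrow> H m s = h m s) \<and>
      (face q 0 m s \<longrightarrow> H m s = scomp C x y z m (U m (restrict s S)) (A m \<alpha>))"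
    if s: "s \<in> simps (cube ?R) m" for m s
  proof -
    let ?s = "s(w := ct 1 m)"
    have T: "?s \<in> simps (cube ?T) m" using upd_cube[OF s, of 1 w] by simp
    have R: "restrict ?s ?R = s" using fresh restrict_self[OF s] by (simp add: restrict_upd)
    have W: "restrict ?s (insert w S) = (restrict s S)(w := ct 1 m)"
      by (rule restrict_upd(2)[OF fresh(2)])
    have sS: "restrict s S \<in> simps (cube S) m" using s by (auto intro: rs)
    have W': "restrict ((restrict s S)(w := ct 1 m)) S = restrict s S"
      unfolding restrict_upd(1)[OF fresh(2)] by (rule restrict_self[OF sS])
    have "K m ((restrict s S)(w := ct 1 m)) = scomp C x y z m (U m (restrict s S)) (a m)"
      using K1[OF upd_cube[OF sS, of 1 w]] by (simp add: face_upd W')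
    moreover have fq: "face q c m ?s \<longleftrightarrow> face q c m s" for c by (rule face_upd(1)[OF fresh(8)])
    moreover have "obox ?R q 0 m ?s \<longleftrightarrow> obox ?R q 0 m s"
      unfolding obox_insert[OF S(2)] fq bdry_upd[OF fresh(2)] ..
    ultimately show ?thesis
      using Ng[OF T] Nq[OF T] Nh[OF T] unfolding H_def R W a_def by metis
  qed
  then show ?thesis using U Uu Uv H by (intro exI[of _ U] exI[of _ H]) simp
qed

subsection \<open>The dual statement\<close>

definition op_cat :: "('o, 'a) scat \<Rightarrow> ('o, 'a) scat" where
  "op_cat C = \<lparr>sob = sob C, shom = (\<lambda>x y. shom C y x), scomp = (\<lambda>x y z n b a. scomp C z y x n a b),
     sid = sid C\<rparr>"

definition op_fun :: "('o, 'a, 'p, 'b) sfun \<Rightarrow> ('o, 'a, 'p, 'b) sfun" where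
  "op_fun F = \<lparr>fob = fob F, farr = (\<lambda>x y. farr F y x)\<rparr>"

lemma op_cat_simps [simp]:
  "sob (op_cat C) = sob C" "shom (op_cat C) x y = shom C y x"
  "scomp (op_cat C) x y z n b a = scomp C z y x n a b" "sid (op_cat C) = sid C"
  "fob (op_fun F) = fob F" "farr (op_fun F) x y = farr F y x"
  by (simp_all add: op_cat_def op_fun_def)

lemma sidn_op_cat [simp]: "sidn (op_cat C) x n = sidn C x n"
  by (simp add: sidn_def)

lemma (in simplicial_category) simplicial_category_op: "simplicial_category (op_cat C)"
  by (rule simplicial_category.intro)
    (simp_all add: hom_sset comp_closed comp_natural id_closed comp_assoc comp_id_left comp_id_right)

lemma (in simplicial_functor) simplicial_functor_op: "simplicial_functor (op_cat C) (op_cat D) (op_fun F)"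
  by (intro simplicial_functor.intro simplicial_functor_axioms.intro C.simplicial_category_op
      D.simplicial_category_op) (simp_all add: ob_closed arr_map arr_comp arr_id)

text \<open>
  Composition with \<open>\<alpha>\<close> on the other side, obtained by passing to opposite categories.
\<close>

theorem (in simplicial_functor) extend_along_equivalence_op:
  fixes x y z and S :: "nat set"
  defines "A \<equiv> cst (shom C x y)"
  assumes o: "x \<in> sob C" "y \<in> sob C" "z \<in> sob C"
    and kan: "kan (shom C x x)" "kan (shom C x y)" "kan (shom C y y)"
    and p: "kan_fibration (shom C z x) (shom D (fob F z) (fob F x)) (farr F z x)"
    and r: "kan_fibration (shom C z y) (shom D (fob F z) (fob F y)) (farr F z y)"
    and inv: "C.homotopy_inverse x y \<alpha> \<beta>"
    and S: "finite S" "q \<notin> S"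
    and u: "natural_on S (bdry S) (shom C z x) u"
    and v: "natural_on S whole (shom D (fob F z) (fob F x)) v"
    and uv: "\<And>m t. \<lbrakk>t \<in> simps (cube S) m; bdry S m t\<rbrakk> \<Longrightarrow> farr F z x m (u m t) = v m t"
    and h: "natural_on (insert q S) (obox (insert q S) q 0) (shom C z y) h"
    and g: "natural_on (insert q S) whole (shom D (fob F z) (fob F y)) g"
    and hg: "\<And>m t. \<lbrakk>t \<in> simps (cube (insert q S)) m; obox (insert q S) q 0 m t\<rbrakk> \<Longrightarrow> farr F z y m (h m t) = g m t"
    and hu: "\<And>m t. \<lbrakk>t \<in> simps (cube (insert q S)) m; face q 0 m t; bdry S m t\<rbrakk>
      \<Longrightarrow> h m t = scomp C z x y m (A m \<alpha>) (u m (restrict t S))"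
    and gv: "\<And>m t. \<lbrakk>t \<in> simps (cube (insert q S)) m; face q 0 m t\<rbrakk>
      \<Longrightarrow> g m t = scomp D (fob F z) (fob F x) (fob F y) m (farr F x y m (A m \<alpha>)) (v m (restrict t S))"
  shows "\<exists>U H. natural_on S whole (shom C z x) U \<and>
      (\<forall>m. \<forall>t\<in>simps (cube S) m. farr F z x m (U m t) = v m t \<and> (bdry S m t \<longrightarrow> U m t = u m t)) \<and>
      natural_on (insert q S) whole (shom C z y) H \<and>
      (\<forall>m. \<forall>t\<in>simps (cube (insert q S)) m. farr F z y m (H m t) = g m t \<and>
        (obox (insert q S) q 0 m t \<longrightarrow> H m t = h m t) \<and>
        (face q 0 m t \<longrightarrow> H m t = scomp C z x y m (A m \<alpha>) (U m (restrict t S))))"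
proof -
  interpret op: simplicial_functor "op_cat C" "op_cat D" "op_fun F" by (rule simplicial_functor_op)
  have "op.C.homotopy_inverse y x \<alpha> \<beta>"
    using inv by (simp add: C.homotopy_inverse_def op.C.homotopy_inverse_def)
  from op.extend_along_equivalence[of y x z, simplified, OF o(2,1,3) kan(3,2,1) p r this S u v uv h g hg]
  show ?thesis using hu gv unfolding A_def by blast
qed

section \<open>Simplices of the homotopy coherent nerve\<close>

lemma nerve_hom_cube: "a \<le> b \<Longrightarrow> nerve_hom a b = cube {a<..<b}"
  by (simp add: nerve_hom_def cube_def)

text \<open>
  The functor from \<open>DeltaN n\<close> with given objects and mapping cubes.  Values outside the domain are
  fixed because functors are compared as functions.
\<close>

definition nerve_fun ::
  "('o, 'a) scat \<Rightarrow> nat \<Rightarrow> (nat \<Rightarrow> 'o) \<Rightarrow> (nat \<Rightarrow> nat \<Rightarrow> nat \<Rightarrow> (nat \<Rightarrow> nat \<Rightarrow> nat) \<Rightarrow> 'a) \<Rightarrow>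
    (nat, nat \<Rightarrow> nat \<Rightarrow> nat, 'o, 'a) sfun" where
  "nerve_fun C n ob W = \<lparr>fob = (\<lambda>a. if a \<le> n then ob a else undefined),
     farr = (\<lambda>a b m z. if a \<le> n \<and> b \<le> n \<and> z \<in> simps (nerve_hom a b) m
       then (if a = b then sidn C (ob a) m else W a b m z) else undefined)\<rparr>"

lemma (in simplicial_category) sact_sidn:
  "\<lbrakk>x \<in> sob C; f \<in> mono_maps l m\<rbrakk> \<Longrightarrow> sact (shom C x x) l m f (sidn C x m) = sidn C x l"
  unfolding cst_sid[symmetric] by (intro sact_cst hom_sset id_closed)

text \<open>
  A composite over an intermediate vertex \<open>b\<close> has the coordinate \<open>b\<close> constantly \<open>0\<close>, and every such
  arrow is a composite; so functoriality is a condition on the faces \<open>z\<^sub>b = 0\<close> of the cubes.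
\<close>

lemma (in simplicial_category) nerve_fun_hom:
  assumes ob: "\<And>a. a \<le> n \<Longrightarrow> ob a \<in> sob C"
    and W: "\<And>a b. \<lbrakk>a < b; b \<le> n\<rbrakk> \<Longrightarrow> natural_on {a<..<b} whole (shom C (ob a) (ob b)) (W a b)"
    and comp: "\<And>a b c m z. \<lbrakk>a < b; b < c; c \<le> n; z \<in> simps (cube {a<..<c}) m; face b 0 m z\<rbrakk> \<Longrightarrow>
      W a c m z = scomp C (ob a) (ob b) (ob c) m (W b c m (restrict z {b<..<c})) (W a b m (restrict z {a<..<b}))"
  shows "nerve_fun C n ob W \<in> sfun_hom (DeltaN n) C"
proof -
  let ?F = "nerve_fun C n ob W"
  have le: "a \<le> b" if "z \<in> simps (nerve_hom a b) m" for a b m z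
    using that by (auto simp: simps_nerve_hom split: if_splits)
  have "simplicial_functor (DeltaN n) C ?F"
  proof (intro simplicial_functor.intro simplicial_functor_axioms.intro simplicial_category_DeltaN
      simplicial_category_axioms)
    show "fob ?F a \<in> sob C" if "a \<in> sob (DeltaN n)" for a
      using that ob by (simp add: DeltaN_def nerve_fun_def)
  next
    fix a b assume ab: "a \<in> sob (DeltaN n)" "b \<in> sob (DeltaN n)"
    have abn: "a \<le> n" "b \<le> n" using ab by (auto simp: DeltaN_def)
    have "simplicial_map (nerve_hom a b) (shom C (ob a) (ob b)) (farr ?F a b)"
    proof (intro simplicial_map.intro simplicial_map_axioms.intro simplicial_set_nerve_hom hom_sset ob abn)
      fix m z assume z: "z \<in> simps (nerve_hom a b) m"
      have ab: "a \<le> b" using le[OF z] .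
      have zc: "z \<in> simps (cube {a<..<b}) m" using z by (simp add: nerve_hom_cube[OF ab])
      show "farr ?F a b m z \<in> simps (shom C (ob a) (ob b)) m"
        using abn z ab sidn_closed[OF ob[OF abn(1)]] natural_on_closed[OF W, OF _ abn(2) zc TrueI]
        by (auto simp: nerve_fun_def)
      fix l f assume f: "f \<in> mono_maps l m"
      have fz: "sact (nerve_hom a b) l m f z \<in> simps (nerve_hom a b) l"
        by (rule simplicial_set.act_closed[OF simplicial_set_nerve_hom f z])
      show "farr ?F a b l (sact (nerve_hom a b) l m f z) = sact (shom C (ob a) (ob b)) l m f (farr ?F a b m z)"
      proof (cases "a = b")
        case True
        then show ?thesis using abn z fz sact_sidn[OF ob f] by (simp add: nerve_fun_def)
      next
        case False
        then show ?thesis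
          using abn z fz ab natural_on_sact[OF W, OF _ abn(2) zc TrueI f]
          by (simp add: nerve_fun_def nerve_hom_cube)
      qed
    qed
    then show "simplicial_map (shom (DeltaN n) a b) (shom C (fob ?F a) (fob ?F b)) (farr ?F a b)"
      using abn by (simp add: DeltaN_def nerve_fun_def)
  next
    fix a b c m y x
    assume abc: "a \<in> sob (DeltaN n)" "b \<in> sob (DeltaN n)" "c \<in> sob (DeltaN n)"
      and y: "y \<in> simps (shom (DeltaN n) b c) m" and x: "x \<in> simps (shom (DeltaN n) a b) m"
    have abn: "a \<le> n" "b \<le> n" "c \<le> n" using abc by (auto simp: DeltaN_def)
    have y': "y \<in> simps (nerve_hom b c) m" and x': "x \<in> simps (nerve_hom a b) m"
      using x y by (auto simp: DeltaN_def)
    have abc: "a \<le> b" "b \<le> c" using le[OF y'] le[OF x'] by auto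
    let ?z = "nerve_comp a b c m y x"
    have z: "?z \<in> simps (nerve_hom a c) m" by (rule nerve_comp_closed[OF y' x'])
    have "farr ?F a c m ?z = scomp C (ob a) (ob b) (ob c) m (farr ?F b c m y) (farr ?F a b m x)"
    proof (cases "a < b \<and> b < c")
      case True
      have f: "face b 0 m ?z" using True by (auto simp: face_def nerve_comp_def)
      have r: "restrict ?z {b<..<c} = y" "restrict ?z {a<..<b} = x"
        using x' y' abc True by (auto simp: simps_nerve_hom nerve_comp_def fun_eq_iff PiE_iff extensional_def)
      show ?thesis
        using comp[OF _ _ abn(3) _ f] True abc z x' y' abn r by (simp add: nerve_fun_def nerve_hom_cube)
    next
      case False
      have xW: "farr ?F a b m x \<in> simps (shom C (ob a) (ob b)) m"
        using x' abn abc sidn_closed[OF ob[OF abn(1)]] natural_on_closed[OF W, OF _ abn(2), of a x m]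
        by (auto simp: nerve_fun_def nerve_hom_cube)
      have yW: "farr ?F b c m y \<in> simps (shom C (ob b) (ob c)) m"
        using y' abn abc sidn_closed[OF ob[OF abn(2)]] natural_on_closed[OF W, OF _ abn(3), of b y m]
        by (auto simp: nerve_fun_def nerve_hom_cube)
      have "a = b \<or> b = c" using False abc by auto
      then show ?thesis
      proof
        assume e: "a = b"
        then have "?z = y" using x' y' abc
          by (auto simp: simps_nerve_hom nerve_comp_def fun_eq_iff PiE_iff extensional_def)
        moreover have "farr ?F a b m x = sidn C (ob a) m" using e x' abn by (simp add: nerve_fun_def)
        ultimately show ?thesis using comp_id_right[OF ob[OF abn(2)] ob[OF abn(3)] yW] e by simp
      next
        assume e: "b = c"
        then have "?z = x" using x' y' abc
          by (auto simp: simps_nerve_hom nerve_comp_def fun_eq_iff PiE_iff extensional_def)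
        moreover have "farr ?F b c m y = sidn C (ob b) m" using e y' abn by (simp add: nerve_fun_def)
        ultimately show ?thesis using comp_id_left[OF ob[OF abn(1)] ob[OF abn(2)] xW] e by simp
      qed
    qed
    then show "farr ?F a c m (scomp (DeltaN n) a b c m y x) =
      scomp C (fob ?F a) (fob ?F b) (fob ?F c) m (farr ?F b c m y) (farr ?F a b m x)"
      using abn by (simp add: DeltaN_def nerve_fun_def)
  next
    fix a assume a: "a \<in> sob (DeltaN n)"
    have "sidn C (ob a) 0 = sid C (ob a)"
      unfolding cst_sid[symmetric] using a ob by (intro cst_0 hom_sset id_closed) (auto simp: DeltaN_def)
    then show "farr ?F a a 0 (sid (DeltaN n) a) = sid C (fob ?F a)"
      using a by (auto simp: DeltaN_def nerve_fun_def simps_nerve_hom)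
  qed
  then show ?thesis by (auto simp: sfun_hom_def nerve_fun_def DeltaN_def)
qed

lemma nerve_simplex:
  assumes F: "F \<in> sfun_hom (DeltaN n) C" and a: "a \<le> n"
  shows "fob F a \<in> sob C"
    and "\<lbrakk>a \<le> b; b \<le> n\<rbrakk> \<Longrightarrow> natural_on {a<..<b} whole (shom C (fob F a) (fob F b)) (farr F a b)"
    and "\<lbrakk>a < b; b < c; c \<le> n; z \<in> simps (cube {a<..<c}) m; face b 0 m z\<rbrakk> \<Longrightarrow>
      farr F a c m z = scomp C (fob F a) (fob F b) (fob F c) m
        (farr F b c m (restrict z {b<..<c})) (farr F a b m (restrict z {a<..<b}))"
    and "z \<in> simps (nerve_hom a a) m \<Longrightarrow> farr F a a m z = sidn C (fob F a) m"
proof -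
  interpret F: simplicial_functor "DeltaN n" C F using F by (simp add: sfun_hom_def)
  have D: "sob (DeltaN n) = {..n}" "shom (DeltaN n) = nerve_hom" "scomp (DeltaN n) = nerve_comp"
    by (simp_all add: DeltaN_def)
  show "fob F a \<in> sob C" using F.ob_closed a by (simp add: D)
  show "natural_on {a<..<b} whole (shom C (fob F a) (fob F b)) (farr F a b)" if "a \<le> b" "b \<le> n"
    using F.arr_map[of a b] a that by (simp add: D nerve_hom_cube natural_on_whole)
  show "farr F a c m z = scomp C (fob F a) (fob F b) (fob F c) m
        (farr F b c m (restrict z {b<..<c})) (farr F a b m (restrict z {a<..<b}))"
    if abc: "a < b" "b < c" "c \<le> n" and z: "z \<in> simps (cube {a<..<c}) m" and f: "face b 0 m z"
  proof -
    have r: "restrict z {b<..<c} \<in> simps (nerve_hom b c) m" "restrict z {a<..<b} \<in> simps (nerve_hom a b) m"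
      using abc restrict_cube[OF z, of "{b<..<c}"] restrict_cube[OF z, of "{a<..<b}"]
      by (simp_all add: nerve_hom_cube subset_iff)
    have "z b = (\<lambda>i\<in>{..m}. 0)" using face_eq[OF f z] abc by (simp add: ct_def)
    then have "nerve_comp a b c m (restrict z {b<..<c}) (restrict z {a<..<b}) = z"
      using z abc by (auto simp: nerve_comp_def simps_cube fun_eq_iff PiE_iff extensional_def)
    then show ?thesis
      using F.arr_comp[of a b c "restrict z {b<..<c}" m "restrict z {a<..<b}"] r abc a by (simp add: D)
  qed
  show "farr F a a m z = sidn C (fob F a) m" if z: "z \<in> simps (nerve_hom a a) m"
  proof -
    have z': "z = sact (nerve_hom a a) m 0 (\<lambda>i\<in>{..m}. 0) (sid (DeltaN n) a)"
      using z by (auto simp: simps_nerve_hom sact_nerve_hom DeltaN_def)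
    show ?thesis
      using simplicial_map.map_natural[OF F.arr_map[of a a] zero_mono_maps F.C.id_closed[of a], of m]
        F.arr_id[of a] a z' by (simp add: D sidn_def)
  qed
qed

lemma nerve_act:
  assumes s: "s \<in> mono_maps m n"
  shows "a \<le> m \<Longrightarrow> fob (sact (nerve C) m n s F) a = fob F (s a)"
    and "\<lbrakk>a \<le> m; b \<le> m; z \<in> simps (nerve_hom a b) l\<rbrakk> \<Longrightarrow>
      farr (sact (nerve C) m n s F) a b l z = farr F (s a) (s b) l (DeltaN_map_arr s a b l z)"
  by (auto simp: nerve_def sfun_comp_def DeltaN_map_eq_explicit[OF s] DeltaN_map_explicit_def DeltaN_def)

subsection \<open>The vertices that a simplex of a mapping cube involves\<close>

text \<open>
  An arrow \<open>z\<close> of \<open>DeltaN n\<close> from \<open>a\<close> to \<open>b\<close> comes from the face of the simplex spanned by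
  \<open>supp a b m z\<close>, since a coordinate that is constantly \<open>1\<close> skips a vertex.
\<close>

definition supp :: "nat \<Rightarrow> nat \<Rightarrow> nat \<Rightarrow> (nat \<Rightarrow> nat \<Rightarrow> nat) \<Rightarrow> nat set" where
  "supp a b m z = insert a (insert b {c \<in> {a<..<b}. \<not> face c 1 m z})"

text \<open>
  A vertex outside the support is skipped by \<open>z\<close>, so it is irrelevant where \<open>t\<close> sends it.
\<close>

lemma DeltaN_map_arr_fix:
  assumes t: "t \<in> mono_maps n n" and ab: "a \<le> b" "b \<le> n" and z: "z \<in> simps (nerve_hom a b) m"
    and fx: "\<And>c. c \<in> supp a b m z \<Longrightarrow> t c = c"
  shows "t a = a" "t b = b" "DeltaN_map_arr t a b m z = z"
proof -
  show tab: "t a = a" "t b = b" using fx by (auto simp: supp_def)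
  show "DeltaN_map_arr t a b m z = z"
  proof (rule nerve_hom_ext[OF _ z])
    show "DeltaN_map_arr t a b m z \<in> simps (nerve_hom a b) m"
      using DeltaN_map_arr_closed[OF t _ ab(2) z] ab tab by simp
    fix d i assume d: "a < d" "d < b" and i: "i \<le> m"
    have z1: "z d i \<le> 1" using cube_le1[of z "{a<..<b}" m d i] z d i ab by (simp add: nerve_hom_cube)
    have c: "t c = c" if "a < c" "c < b" "z c i = 0" for c
      using that i by (intro fx) (auto simp: supp_def face_def)
    have "(\<exists>c\<in>{a<..<b}. t c = d \<and> z c i = 0) \<longleftrightarrow> z d i = 0"
      using c d by fastforce
    then show "DeltaN_map_arr t a b m z d i = z d i"
      using d i z1 tab by (auto simp: DeltaN_map_arr_def)
  qed
qed

lemma supp_DeltaN_map_arr: 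
  assumes t: "t \<in> mono_maps m n" and ab: "a \<le> m" "b \<le> m"
  shows "supp (t a) (t b) l (DeltaN_map_arr t a b l z) \<subseteq> t ` {..m}"
proof
  fix d assume "d \<in> supp (t a) (t b) l (DeltaN_map_arr t a b l z)"
  then consider "d = t a" | "d = t b" | "d \<in> {t a<..<t b}" "\<not> face d 1 l (DeltaN_map_arr t a b l z)"
    by (auto simp: supp_def)
  then show "d \<in> t ` {..m}"
  proof cases
    case 3
    then obtain i where "i \<le> l" "DeltaN_map_arr t a b l z d i \<noteq> 1" by (auto simp: face_def)
    then have "\<exists>c\<in>{a<..<b}. t c = d \<and> z c i = 0"
      using 3(1) by (auto simp: DeltaN_map_arr_def split: if_splits)
    then show ?thesis using ab by auto
  qed (use ab in auto)
qed

text \<open>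
  A monotone retraction of \<open>[n]\<close> onto \<open>V\<close>.  It represents the face of the \<open>n\<close>-simplex spanned by
  \<open>V\<close> by a degenerate \<open>n\<close>-simplex, which spares the renumbering of vertices.
\<close>

definition retr :: "nat \<Rightarrow> nat set \<Rightarrow> nat \<Rightarrow> nat" where
  "retr n V = (\<lambda>c\<in>{..n}. if \<exists>d\<in>V. d \<le> c then Max {d \<in> V. d \<le> c} else Min V)"

lemma retr:
  assumes V: "V \<subseteq> {..n}" "V \<noteq> {}"
  shows "retr n V \<in> mono_maps n n" and "c \<le> n \<Longrightarrow> retr n V c \<in> V" and "c \<in> V \<Longrightarrow> retr n V c = c"
proof -
  have fin: "finite V" using V(1) finite_subset by blast
  let ?r = "\<lambda>c. if \<exists>d\<in>V. d \<le> c then Max {d \<in> V. d \<le> c} else Min V"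
  have in': "Max {d \<in> V. d \<le> c} \<in> V \<and> Max {d \<in> V. d \<le> c} \<le> c" if "\<exists>d\<in>V. d \<le> c" for c
  proof -
    have "Max {d \<in> V. d \<le> c} \<in> {d \<in> V. d \<le> c}" using fin that by (intro Max_in) auto
    then show ?thesis by simp
  qed
  have r: "?r c \<in> V" for c using in'[of c] Min_in[OF fin V(2)] by auto
  then show "retr n V c \<in> V" if "c \<le> n" for c using that by (simp add: retr_def)
  show "retr n V c = c" if "c \<in> V" for c
  proof -
    have "Max {d \<in> V. d \<le> c} = c" using that fin by (intro Max_eqI) auto
    then show ?thesis using that V(1) by (auto simp: retr_def)
  qed
  show "retr n V \<in> mono_maps n n"
    unfolding retr_def
  proof (rule mono_mapsI)
    show "?r i \<le> n" for i using subsetD[OF V(1) r[of i]] by simp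
    show "?r i \<le> ?r j" if "i \<le> j" "j \<le> n" for i j
    proof (cases "\<exists>d\<in>V. d \<le> i")
      case True
      then have j: "\<exists>d\<in>V. d \<le> j" using that(1) le_trans by blast
      have "Max {d \<in> V. d \<le> i} \<le> Max {d \<in> V. d \<le> j}"
        using in'[OF True] fin that(1) by (intro Max_ge) auto
      then show ?thesis using True j by simp
    next
      case False
      then have "?r i = Min V" by (rule if_not_P)
      then show ?thesis using Min_le[OF fin r] by simp
    qed
  qed
qed

section \<open>The partial functor given by a horn in the nerve\<close>

locale horn_in_nerve = simplicial_category C for C :: "('o, 'a) scat" +
  fixes n k :: nat and u :: "nat \<Rightarrow> (nat \<Rightarrow> nat) \<Rightarrow> (nat, nat \<Rightarrow> nat \<Rightarrow> nat, 'o, 'a) sfun"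
  assumes u: "simplicial_map (horn n k) (nerve C) u"
begin

text \<open>
  The face of the simplex spanned by \<open>V\<close> belongs to the horn.
\<close>

definition known :: "nat set \<Rightarrow> bool" where
  "known V \<longleftrightarrow> (\<exists>i\<le>n. i \<noteq> k \<and> i \<notin> V)"

text \<open>
  The value of the horn on the arrow \<open>z\<close>, read off from the face spanned by the support of \<open>z\<close>.
  It is meaningful when this support is known; in general the arrows of \<open>DeltaN n\<close> on
  which the horn is defined do not form a subcategory.
\<close>

definition G :: "nat \<Rightarrow> nat \<Rightarrow> nat \<Rightarrow> (nat \<Rightarrow> nat \<Rightarrow> nat) \<Rightarrow> 'a" where
  "G a b m z = farr (u n (retr n (supp a b m z))) a b m z"

definition gob :: "nat \<Rightarrow> 'o" where
  "gob a = fob (u n (\<lambda>c\<in>{..n}. a)) a"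

lemma known_mono: "\<lbrakk>known V; W \<subseteq> V\<rbrakk> \<Longrightarrow> known W"
  by (auto simp: known_def)

lemma horn_mono: "s \<in> simps (horn n k) m \<Longrightarrow> s \<in> mono_maps m n"
  by (simp add: horn_def)

lemma u_hom: "s \<in> simps (horn n k) m \<Longrightarrow> u m s \<in> sfun_hom (DeltaN m) C"
  using simplicial_map.map_closed[OF u] by (auto simp: nerve_def)

lemma u_compose:
  "\<lbrakk>s \<in> simps (horn n k) m; t \<in> mono_maps l m\<rbrakk> \<Longrightarrow> u l (compose {..l} s t) = sact (nerve C) l m t (u m s)"
  using simplicial_map.map_natural[OF u] by (simp add: horn_def)

lemma retr_horn:
  assumes V: "V \<subseteq> {..n}" "V \<noteq> {}" "known V"
  shows "retr n V \<in> simps (horn n k) n"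
proof -
  obtain i where i: "i \<le> n" "i \<noteq> k" "i \<notin> V" using V(3) by (auto simp: known_def)
  then have "i \<notin> retr n V ` {..n}" using retr(2)[OF V(1,2)] by auto
  then show ?thesis using i retr(1)[OF V(1,2)] by (auto simp: horn_def)
qed

lemma compose_retr:
  assumes s: "s \<in> mono_maps n n" and V: "V \<subseteq> {..n}" "V \<noteq> {}" and fx: "\<And>c. c \<in> V \<Longrightarrow> s c = c"
  shows "compose {..n} s (retr n V) = retr n V"
  using retr[OF V] fx mono_maps_ext[OF mono_maps_compose[OF retr(1)[OF V] s] retr(1)[OF V]]
  by (simp add: compose_def)

lemma supp_bound: "\<lbrakk>a \<le> b; b \<le> n\<rbrakk> \<Longrightarrow> supp a b m z \<subseteq> {..n} \<and> supp a b m z \<noteq> {}"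
  by (auto simp: supp_def)

text \<open>
  The value of the horn on an arrow is independent of the simplex used to compute it: restricting a
  simplex \<open>s\<close> that fixes the support to the face spanned by the support leaves the value unchanged.
\<close>

lemma u_farr:
  assumes s: "s \<in> simps (horn n k) n" and ab: "a \<le> b" "b \<le> n" and z: "z \<in> simps (nerve_hom a b) m"
    and fx: "\<And>c. c \<in> supp a b m z \<Longrightarrow> s c = c"
  shows "farr (u n s) a b m z = G a b m z"
proof -
  let ?V = "supp a b m z"
  have V: "?V \<subseteq> {..n}" "?V \<noteq> {}" using supp_bound[OF ab] by auto
  note t = retr[OF V]
  have "farr (sact (nerve C) n n (retr n ?V) (u n s)) a b m z = farr (u n s) a b m z"
    using nerve_act(2)[OF t(1) _ ab(2) z, of C "u n s"] DeltaN_map_arr_fix[OF t(1) ab z t(3)] ab by simp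
  then show ?thesis
    using u_compose[OF s t(1)] compose_retr[OF horn_mono[OF s] V fx] by (simp add: G_def)
qed

lemma u_fob:
  assumes s: "s \<in> simps (horn n k) n" and a: "a \<le> n" "s a = a"
  shows "fob (u n s) a = gob a"
proof -
  have t: "(\<lambda>c\<in>{..n}. a) \<in> mono_maps n n" using a(1) by (intro mono_mapsI) auto
  have "compose {..n} s (\<lambda>c\<in>{..n}. a) = (\<lambda>c\<in>{..n}. a)" using a by (auto simp: compose_def fun_eq_iff)
  then show ?thesis using u_compose[OF s t] nerve_act(1)[OF t a(1), of C "u n s"] a by (simp add: gob_def)
qed

lemma supp_ends: "a \<in> supp a b m z" "b \<in> supp a b m z"
  by (auto simp: supp_def)

lemma supp_sact:
  assumes f: "f \<in> mono_maps l m"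
  shows "supp a b l (sact (cube {a<..<b}) l m f z) \<subseteq> supp a b m z"
proof -
  have "\<not> face c 1 m z" if "\<not> face c 1 l (sact (cube {a<..<b}) l m f z)" "c \<in> {a<..<b}" for c
    using face_sact[OF _ that(2) f] that(1) by blast
  then show ?thesis by (auto simp: supp_def)
qed

lemma supp_restrict:
  "\<lbrakk>a \<le> c; c < d; d \<le> b\<rbrakk> \<Longrightarrow> supp c d m (restrict z {c<..<d}) \<subseteq> insert c (insert d (supp a b m z))"
  by (auto simp: supp_def face_restrict)

lemma not_face_01: "face c 0 m z \<Longrightarrow> \<not> face c 1 m z"
  by (auto simp: face_def)

lemma supp_split:
  assumes "a < b" "b < c" "face b 0 m z"
  shows "supp a b m (restrict z {a<..<b}) \<subseteq> supp a c m z" "supp b c m (restrict z {b<..<c}) \<subseteq> supp a c m z"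
proof -
  have "b \<in> supp a c m z" using assms not_face_01 by (auto simp: supp_def)
  then have "insert a (insert b (supp a c m z)) = supp a c m z" "insert b (insert c (supp a c m z)) = supp a c m z"
    by (auto simp: supp_def)
  then show "supp a b m (restrict z {a<..<b}) \<subseteq> supp a c m z" "supp b c m (restrict z {b<..<c}) \<subseteq> supp a c m z"
    using supp_restrict[of a a b c m z] supp_restrict[of a b c c m z] assms by simp_all
qed

lemma gob_ob: "\<lbrakk>a \<le> n; known {a}\<rbrakk> \<Longrightarrow> gob a \<in> sob C"
proof -
  assume a: "a \<le> n" "known {a}"
  have s: "retr n {a} \<in> simps (horn n k) n" using retr_horn[of "{a}"] a by auto
  have "retr n {a} a = a" using retr(3)[of "{a}" n a] a by auto
  from u_fob[OF s a(1) this] show ?thesis using nerve_simplex(1)[OF u_hom[OF s] a(1)] by simp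
qed

lemma
  assumes ab: "a \<le> b" "b \<le> n" and z: "z \<in> simps (cube {a<..<b}) m" and kn: "known (supp a b m z)"
  shows G_closed: "G a b m z \<in> simps (shom C (gob a) (gob b)) m"
    and G_sact: "f \<in> mono_maps l m \<Longrightarrow>
      G a b l (sact (cube {a<..<b}) l m f z) = sact (shom C (gob a) (gob b)) l m f (G a b m z)"
    and G_id: "a = b \<Longrightarrow> G a b m z = sidn C (gob a) m"
    and G_comp: "\<lbrakk>a < c; c < b; face c 0 m z\<rbrakk> \<Longrightarrow> G a b m z = scomp C (gob a) (gob c) (gob b) m
      (G c b m (restrict z {c<..<b})) (G a c m (restrict z {a<..<c}))"
proof -
  let ?V = "supp a b m z" let ?s = "retr n ?V"
  have V: "?V \<subseteq> {..n}" "?V \<noteq> {}" using supp_bound[OF ab] by auto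
  note t = retr[OF V]
  have s: "?s \<in> simps (horn n k) n" by (rule retr_horn[OF V kn])
  note hom = u_hom[OF s]
  have an: "a \<le> n" using ab by simp
  have ob: "fob (u n ?s) c = gob c" if "c \<in> ?V" for c
    using u_fob[OF s _ t(3)[OF that]] V(1) that by auto
  have zn: "z \<in> simps (nerve_hom a b) m" using z by (simp add: nerve_hom_cube[OF ab(1)])
  note nat = nerve_simplex(2)[OF hom an ab, unfolded ob[OF supp_ends(1)] ob[OF supp_ends(2)]]
  show "G a b m z \<in> simps (shom C (gob a) (gob b)) m"
    unfolding G_def using natural_on_closed[OF nat, OF z] by simp
  show "G a b l (sact (cube {a<..<b}) l m f z) = sact (shom C (gob a) (gob b)) l m f (G a b m z)"
    if f: "f \<in> mono_maps l m"
  proof -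
    let ?z = "sact (cube {a<..<b}) l m f z"
    have zc: "?z \<in> simps (nerve_hom a b) l" using sact_cube_closed[OF f z] by (simp add: nerve_hom_cube[OF ab(1)])
    have "farr (u n ?s) a b l ?z = G a b l ?z"
      using supp_sact[OF f] by (intro u_farr[OF s ab zc] t(3)) auto
    then show ?thesis using natural_on_sact[OF nat, OF z TrueI f] by (simp add: G_def)
  qed
  show "G a b m z = sidn C (gob a) m" if "a = b"
    using nerve_simplex(4)[OF hom an, of z m] ob[OF supp_ends(1)] zn that by (simp add: G_def)
  show "G a b m z = scomp C (gob a) (gob c) (gob b) m (G c b m (restrict z {c<..<b})) (G a c m (restrict z {a<..<c}))"
    if c: "a < c" "c < b" "face c 0 m z"
  proof -
    have cV: "c \<in> ?V" using c not_face_01 by (auto simp: supp_def)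
    have zc: "restrict z {c<..<b} \<in> simps (nerve_hom c b) m" "restrict z {a<..<c} \<in> simps (nerve_hom a c) m"
      using c restrict_cube[OF z, of "{c<..<b}"] restrict_cube[OF z, of "{a<..<c}"]
      by (simp_all add: nerve_hom_cube subset_iff)
    have 1: "farr (u n ?s) c b m (restrict z {c<..<b}) = G c b m (restrict z {c<..<b})"
      using c ab subsetD[OF supp_split(2)[OF c]] by (intro u_farr[OF s _ _ zc(1)] t(3)) simp_all
    have 2: "farr (u n ?s) a c m (restrict z {a<..<c}) = G a c m (restrict z {a<..<c})"
      using c ab subsetD[OF supp_split(1)[OF c]] by (intro u_farr[OF s _ _ zc(2)] t(3)) simp_all
    show ?thesis
      using nerve_simplex(3)[OF hom an c(1,2) ab(2) z c(3)]
      unfolding 1 2 ob[OF supp_ends(1)] ob[OF supp_ends(2)] ob[OF cV] by (simp only: G_def)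
  qed
qed

text \<open>
  Maps out of the standard simplex are simplices of the nerve, that is, functors \<open>W\<close>; and \<open>W\<close> is a
  lift of the horn as soon as it extends the partial functor \<open>G\<close> and its image in \<open>D\<close> is the given one.
\<close>

lemma lift_from_functor:
  assumes F: "simplicial_functor C D F"
    and v: "simplicial_map (std_simplex n) (nerve D) v"
    and W: "W \<in> sfun_hom (DeltaN n) C"
    and Wob: "\<And>a. \<lbrakk>a \<le> n; known {a}\<rbrakk> \<Longrightarrow> fob W a = gob a"
    and WG: "\<And>a b m z. \<lbrakk>a \<le> b; b \<le> n; z \<in> simps (cube {a<..<b}) m; known (supp a b m z)\<rbrakk>
      \<Longrightarrow> farr W a b m z = G a b m z"
    and FW: "nerve_map F n W = v n (\<lambda>i\<in>{..n}. i)"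
  shows "\<exists>w. simplicial_map (std_simplex n) (nerve C) w \<and>
    (\<forall>m. \<forall>s\<in>simps (horn n k) m. w m s = u m s) \<and>
    (\<forall>m. \<forall>s\<in>simps (std_simplex n) m. nerve_map F m (w m s) = v m s)"
proof -
  have Wn: "W \<in> simps (nerve C) n" using W by (simp add: nerve_def)
  interpret N: simplicial_set "nerve C" by (rule simplicial_set_nerve)
  interpret p: simplicial_map "nerve C" "nerve D" "nerve_map F" by (rule simplicial_map_nerve_map[OF F])
  define w where "w m s = sact (nerve C) m n s W" for m s
  have w: "simplicial_map (std_simplex n) (nerve C) w"
  proof (intro simplicial_map.intro simplicial_map_axioms.intro simplicial_set_std_simplex N.simplicial_set_axioms)
    show "w m s \<in> simps (nerve C) m" if "s \<in> simps (std_simplex n) m" for m s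
      using N.act_closed[OF _ Wn] that by (simp add: w_def std_simplex_def)
    show "w l (sact (std_simplex n) l m t s) = sact (nerve C) l m t (w m s)"
      if "t \<in> mono_maps l m" "s \<in> simps (std_simplex n) m" for l m t s
      using N.act_comp[OF that(1) _ Wn] that(2) by (simp add: w_def std_simplex_def)
  qed
  have "nerve_map F m (w m s) = v m s" if s: "s \<in> mono_maps m n" for m s
  proof -
    have "compose {..m} (\<lambda>i\<in>{..n}. i) s = s"
      using s mono_maps_le[OF s] by (auto simp: compose_def mono_maps_def fun_eq_iff PiE_iff extensional_def)
    then have "sact (std_simplex n) m n s (\<lambda>i\<in>{..n}. i) = s" by (simp add: std_simplex_def)
    moreover have "(\<lambda>i\<in>{..n}. i) \<in> simps (std_simplex n) n" using mono_maps_id by (simp add: std_simplex_def)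
    ultimately have "v m s = sact (nerve D) m n s (v n (\<lambda>i\<in>{..n}. i))"
      using simplicial_map.map_natural[OF v s] by metis
    then show ?thesis unfolding w_def p.map_natural[OF s Wn] FW by (rule sym)
  qed
  moreover have "w m s = u m s" if s: "s \<in> simps (horn n k) m" for m s
  proof -
    obtain i where i: "i \<le> n" "i \<noteq> k" "i \<notin> s ` {..m}" and sm: "s \<in> mono_maps m n"
      using s by (auto simp: horn_def)
    let ?V = "s ` {..m}" let ?r = "retr n ?V"
    have V: "?V \<subseteq> {..n}" "?V \<noteq> {}" using mono_maps_le[OF sm] by auto
    have kn: "known ?V" using i by (auto simp: known_def)
    note r = retr[OF V]
    have rh: "?r \<in> simps (horn n k) n" by (rule retr_horn[OF V kn])
    \<comment> \<open>\<open>s\<close> factors through the idempotent \<open>?r\<close>, so it is enough to compare the values at \<open>?r\<close>.\<close>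
    have rs: "compose {..m} ?r s = s"
      using r(3) mono_maps_ext[OF mono_maps_compose[OF sm r(1)] sm] by (simp add: compose_def)
    have "sact (nerve C) n n ?r W = u n ?r"
    proof (rule sfun_hom_eqI)
      show "sact (nerve C) n n ?r W \<in> sfun_hom (DeltaN n) C"
        using N.act_closed[OF r(1) Wn] by (simp add: nerve_def)
      show hom: "u n ?r \<in> sfun_hom (DeltaN n) C" by (rule u_hom[OF rh])
      have idem: "u n ?r = sact (nerve C) n n ?r (u n ?r)"
        using u_compose[OF rh r(1)] compose_retr[OF r(1) V r(3)] by simp
      show "fob (sact (nerve C) n n ?r W) a = fob (u n ?r) a" if "a \<in> sob (DeltaN n)" for a
      proof -
        have a: "a \<le> n" using that by (simp add: DeltaN_def)
        have "known {?r a}" using known_mono[OF kn, of "{?r a}"] r(2)[OF a] by simp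
        then have "fob W (?r a) = gob (?r a)" using Wob mono_maps_le[OF r(1) a] by simp
        moreover have "fob (u n ?r) a = fob (u n ?r) (?r a)"
          using arg_cong[OF idem, of "\<lambda>F. fob F a"] nerve_act(1)[OF r(1) a, of C "u n ?r"] by simp
        moreover have "fob (u n ?r) (?r a) = gob (?r a)"
          using u_fob[OF rh mono_maps_le[OF r(1) a] r(3)[OF r(2)[OF a]]] .
        ultimately show ?thesis using nerve_act(1)[OF r(1) a, of C W] by simp
      qed
      show "farr (sact (nerve C) n n ?r W) a b l z = farr (u n ?r) a b l z"
        if ab: "a \<in> sob (DeltaN n)" "b \<in> sob (DeltaN n)" and z: "z \<in> simps (shom (DeltaN n) a b) l" for a b l z
      proof -
        have a: "a \<le> n" and b: "b \<le> n" and z': "z \<in> simps (nerve_hom a b) l" using ab z by (auto simp: DeltaN_def)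
        have le: "a \<le> b" using z' by (auto simp: simps_nerve_hom split: if_splits)
        let ?z = "DeltaN_map_arr ?r a b l z"
        have rle: "?r a \<le> ?r b" "?r b \<le> n" using mono_maps_mono[OF r(1) le b] mono_maps_le[OF r(1) b] by auto
        have zc: "?z \<in> simps (nerve_hom (?r a) (?r b)) l" by (rule DeltaN_map_arr_closed[OF r(1) a b z'])
        have sV: "supp (?r a) (?r b) l ?z \<subseteq> ?V"
          using supp_DeltaN_map_arr[OF r(1) a b, of l z] r(2) by auto
        have "farr W (?r a) (?r b) l ?z = G (?r a) (?r b) l ?z"
          using WG[OF rle _ known_mono[OF kn sV]] zc by (simp add: nerve_hom_cube[OF rle(1)])
        moreover have "farr (u n ?r) (?r a) (?r b) l ?z = G (?r a) (?r b) l ?z"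
          using sV by (intro u_farr[OF rh rle zc] r(3)) auto
        moreover have "farr (u n ?r) a b l z = farr (u n ?r) (?r a) (?r b) l ?z"
          using arg_cong[OF idem, of "\<lambda>F. farr F a b l z"] nerve_act(2)[OF r(1) a b z', of C "u n ?r"] by simp
        ultimately show ?thesis using nerve_act(2)[OF r(1) a b z', of C W] by simp
      qed
    qed
    then have "sact (nerve C) m n s W = u m s"
      using N.act_comp[OF sm r(1) Wn] u_compose[OF rh sm] rs by simp
    then show ?thesis by (simp add: w_def)
  qed
  ultimately show ?thesis using w by (intro exI[of _ w]) (auto simp: std_simplex_def)
qed

end

subsection \<open>Composites of arrows of the horn\<close>

context horn_in_nerve
begin

text \<open>
  The arrow \<open>z\<close> is a composite over \<open>c\<close> of two arrows on which the horn is defined; so its image under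
  a functor extending the horn is determined, even if the horn is not defined on \<open>z\<close>.
\<close>

definition split_at :: "nat \<Rightarrow> nat \<Rightarrow> nat \<Rightarrow> (nat \<Rightarrow> nat \<Rightarrow> nat) \<Rightarrow> nat \<Rightarrow> bool" where
  "split_at a b m z c \<longleftrightarrow> a < c \<and> c < b \<and> face c 0 m z \<and> known (supp a c m (restrict z {a<..<c})) \<and>
    known (supp c b m (restrict z {c<..<b}))"

definition comp_at :: "nat \<Rightarrow> nat \<Rightarrow> nat \<Rightarrow> (nat \<Rightarrow> nat \<Rightarrow> nat) \<Rightarrow> nat \<Rightarrow> 'a" where
  "comp_at a b m z c = scomp C (gob a) (gob c) (gob b) m (G c b m (restrict z {c<..<b})) (G a c m (restrict z {a<..<c}))"

text \<open>
  The values that the horn forces on an arrow, directly or as a composite; \<open>dom\<close> is the subcomplex on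
  which they are forced.  The choice of the splitting does not matter, by associativity.
\<close>

definition ext :: "nat \<Rightarrow> nat \<Rightarrow> nat \<Rightarrow> (nat \<Rightarrow> nat \<Rightarrow> nat) \<Rightarrow> 'a" where
  "ext a b m z = (if known (supp a b m z) then G a b m z else comp_at a b m z (SOME c. split_at a b m z c))"

definition dom :: "nat \<Rightarrow> nat \<Rightarrow> nat \<Rightarrow> (nat \<Rightarrow> nat \<Rightarrow> nat) \<Rightarrow> bool" where
  "dom a b m z \<longleftrightarrow> known (supp a b m z) \<or> (\<exists>c. split_at a b m z c)"

lemma restrict_sub:
  "\<lbrakk>a \<le> c; d \<le> b\<rbrakk> \<Longrightarrow> restrict (restrict z {a<..<b}) {c<..<d} = restrict z {c<..<d}" for z :: "nat \<Rightarrow> nat \<Rightarrow> nat"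
  by (auto simp: restrict_def fun_eq_iff)

lemma cube_sub:
  "\<lbrakk>z \<in> simps (cube {a<..<b}) m; a \<le> c; d \<le> b\<rbrakk> \<Longrightarrow> restrict z {c<..<d} \<in> simps (cube {c<..<d}) m"
  by (erule restrict_cube) auto

lemma face_sub: "c \<in> {a<..<b} \<Longrightarrow> face c e m (restrict z {a<..<b}) \<longleftrightarrow> face c e m z"
  by (rule face_restrict)

lemma known_end: "known (supp a b m z) \<Longrightarrow> known {a}" "known (supp a b m z) \<Longrightarrow> known {b}"
  by (auto simp: known_def supp_def)

text \<open>
  Both sides are the triple composite over \<open>c\<close> and \<open>d\<close>: the arrow from \<open>c\<close> to \<open>d\<close> involves only
  vertices of the known arrow from \<open>c\<close> to \<open>b\<close>.
\<close>

lemma comp_at_eq: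
  assumes b: "b \<le> n" and z: "z \<in> simps (cube {a<..<b}) m"
    and c: "split_at a b m z c" and d: "split_at a b m z d" and cd: "c < d"
  shows "comp_at a b m z c = comp_at a b m z d"
proof -
  have ac: "a < c" "c < b" "face c 0 m z" and db: "a < d" "d < b" "face d 0 m z"
    and k: "known (supp a c m (restrict z {a<..<c}))" "known (supp c b m (restrict z {c<..<b}))"
      "known (supp a d m (restrict z {a<..<d}))" "known (supp d b m (restrict z {d<..<b}))"
    using c d by (auto simp: split_at_def)
  have fd: "face d 0 m (restrict z {c<..<b})" and fc: "face c 0 m (restrict z {a<..<d})"
    using ac db cd by (simp_all add: face_sub)
  have s: "supp c d m (restrict z {c<..<d}) \<subseteq> supp c b m (restrict z {c<..<b})"
    using supp_split(1)[OF cd db(2) fd] ac db by (simp add: restrict_sub)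
  have kcd: "known (supp c d m (restrict z {c<..<d}))" by (rule known_mono[OF k(2) s])
  have 1: "G c b m (restrict z {c<..<b}) = scomp C (gob c) (gob d) (gob b) m
      (G d b m (restrict z {d<..<b})) (G c d m (restrict z {c<..<d}))"
    using G_comp[OF less_imp_le[OF ac(2)] b cube_sub[OF z] k(2) cd db(2) fd] ac db cd by (simp add: restrict_sub)
  have 2: "G a d m (restrict z {a<..<d}) = scomp C (gob a) (gob c) (gob d) m
      (G c d m (restrict z {c<..<d})) (G a c m (restrict z {a<..<c}))"
    using G_comp[OF less_imp_le[OF db(1)] _ cube_sub[OF z] k(3) ac(1) cd fc] ac db b cd by (simp add: restrict_sub)
  have o: "gob a \<in> sob C" "gob c \<in> sob C" "gob d \<in> sob C" "gob b \<in> sob C"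
    using gob_ob known_end[OF k(1)] known_end[OF k(4)] ac db b by simp_all
  have m: "G d b m (restrict z {d<..<b}) \<in> simps (shom C (gob d) (gob b)) m"
    "G c d m (restrict z {c<..<d}) \<in> simps (shom C (gob c) (gob d)) m"
    "G a c m (restrict z {a<..<c}) \<in> simps (shom C (gob a) (gob c)) m"
    using ac db b cd by (auto intro!: G_closed cube_sub[OF z] k kcd)
  show ?thesis unfolding comp_at_def 1 2 by (rule comp_assoc_right[OF o m])
qed

lemma ext_split:
  assumes ab: "a < b" "b \<le> n" and z: "z \<in> simps (cube {a<..<b}) m" and c: "split_at a b m z c"
  shows "ext a b m z = comp_at a b m z c"
proof (cases "known (supp a b m z)")
  case True
  then show ?thesis
    using G_comp[OF less_imp_le[OF ab(1)] ab(2) z True] c by (simp add: ext_def comp_at_def split_at_def)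
next
  case False
  define d where "d = (SOME c. split_at a b m z c)"
  have d: "split_at a b m z d" unfolding d_def using c by (rule someI)
  have "comp_at a b m z c = comp_at a b m z d"
    using comp_at_eq[OF ab(2) z c d] comp_at_eq[OF ab(2) z d c] by (metis linorder_cases)
  then show ?thesis using False by (simp add: ext_def d_def)
qed

lemma comp_at_closed:
  assumes ab: "a < b" "b \<le> n" and z: "z \<in> simps (cube {a<..<b}) m" and c: "split_at a b m z c"
  shows "gob a \<in> sob C" "gob c \<in> sob C" "gob b \<in> sob C"
    "G c b m (restrict z {c<..<b}) \<in> simps (shom C (gob c) (gob b)) m"
    "G a c m (restrict z {a<..<c}) \<in> simps (shom C (gob a) (gob c)) m"
proof -
  have ac: "a < c" "c < b"
    and k: "known (supp a c m (restrict z {a<..<c}))" "known (supp c b m (restrict z {c<..<b}))"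
    using c by (auto simp: split_at_def)
  show "gob a \<in> sob C" "gob c \<in> sob C" "gob b \<in> sob C"
    using gob_ob known_end[OF k(1)] known_end[OF k(2)] ac ab by simp_all
  show "G c b m (restrict z {c<..<b}) \<in> simps (shom C (gob c) (gob b)) m"
    "G a c m (restrict z {a<..<c}) \<in> simps (shom C (gob a) (gob c)) m"
    using ac ab by (auto intro!: G_closed cube_sub[OF z] k)
qed

lemma sact_restrict_sub:
  "\<lbrakk>a \<le> c; d \<le> b\<rbrakk> \<Longrightarrow> restrict (sact (cube {a<..<b}) l m f z) {c<..<d} = sact (cube {c<..<d}) l m f (restrict z {c<..<d})"
  by (rule sact_restrict) auto

lemma ext_natural:
  assumes ab: "a < b" "b \<le> n"
  shows "natural_on {a<..<b} (dom a b) (shom C (gob a) (gob b)) (ext a b)"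
  unfolding natural_on_def
proof (intro allI ballI impI)
  fix m z assume z: "z \<in> simps (cube {a<..<b}) m" and "dom a b m z"
  then consider "known (supp a b m z)" | c where "split_at a b m z c" by (auto simp: dom_def)
  then show "ext a b m z \<in> simps (shom C (gob a) (gob b)) m \<and>
    (\<forall>l. \<forall>f\<in>mono_maps l m. ext a b l (sact (cube {a<..<b}) l m f z) = sact (shom C (gob a) (gob b)) l m f (ext a b m z))"
  proof cases
    case 1
    then show ?thesis
      using G_closed[OF less_imp_le[OF ab(1)] ab(2) z 1] G_sact[OF less_imp_le[OF ab(1)] ab(2) z 1]
        known_mono[OF 1 supp_sact]
      by (simp add: ext_def)
  next
    case 2
    note cl = comp_at_closed[OF ab z 2]
    have ac: "a < c" "c < b" "face c 0 m z"
      and k: "known (supp a c m (restrict z {a<..<c}))" "known (supp c b m (restrict z {c<..<b}))"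
      using 2 by (auto simp: split_at_def)
    have "ext a b l (sact (cube {a<..<b}) l m f z) = sact (shom C (gob a) (gob b)) l m f (ext a b m z)"
      if f: "f \<in> mono_maps l m" for l f
    proof -
      let ?z = "sact (cube {a<..<b}) l m f z"
      have r: "restrict ?z {a<..<c} = sact (cube {a<..<c}) l m f (restrict z {a<..<c})"
        "restrict ?z {c<..<b} = sact (cube {c<..<b}) l m f (restrict z {c<..<b})"
        using ac by (simp_all add: sact_restrict_sub)
      have "split_at a b l ?z c"
        unfolding split_at_def r
        using ac face_sact[OF ac(3) _ f] known_mono[OF k(1) supp_sact[OF f]] known_mono[OF k(2) supp_sact[OF f]]
        by simp
      then have "ext a b l ?z = comp_at a b l ?z c" by (rule ext_split[OF ab sact_cube_closed[OF f z]])
      also have "\<dots> = sact (shom C (gob a) (gob b)) l m f (comp_at a b m z c)"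
        unfolding comp_at_def r
        using comp_natural[OF cl(1-3) f cl(4,5)] G_sact[OF _ _ cube_sub[OF z] k(1) f]
          G_sact[OF _ _ cube_sub[OF z] k(2) f] ac ab by simp
      finally show ?thesis using ext_split[OF ab z 2] by simp
    qed
    moreover have "ext a b m z \<in> simps (shom C (gob a) (gob b)) m"
      unfolding ext_split[OF ab z 2] comp_at_def by (rule comp_closed[OF cl])
    ultimately show ?thesis by blast
  qed
qed

text \<open>
  Forced values are compatible with composition with an arrow of the horn.  For a horn
  missing the facet opposite to its first vertex, this applies to the composition with the first
  edge, and dually in \<open>ext_comp_left\<close>.
\<close>

lemma ext_comp_right:
  assumes abc: "a < b" "b < c" "c \<le> n" and z: "z \<in> simps (cube {a<..<c}) m" and f: "face b 0 m z"
    and dm: "dom b c m (restrict z {b<..<c})"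
    and k: "known (supp a b m (restrict z {a<..<b}))"
      "\<And>d. \<lbrakk>b < d; d < c\<rbrakk> \<Longrightarrow> known (supp a d m (restrict z {a<..<d}))"
  shows "ext a c m z = scomp C (gob a) (gob b) (gob c) m (ext b c m (restrict z {b<..<c})) (G a b m (restrict z {a<..<b}))"
  using dm unfolding dom_def
proof (elim disjE exE)
  assume kn: "known (supp b c m (restrict z {b<..<c}))"
  then have "split_at a c m z b" using abc f k(1) by (simp add: split_at_def)
  from ext_split[OF _ abc(3) z this] show ?thesis using kn abc by (simp add: comp_at_def ext_def)
next
  fix d assume d: "split_at b c m (restrict z {b<..<c}) d"
  have z': "restrict z {b<..<c} \<in> simps (cube {b<..<c}) m" using cube_sub[OF z] abc by simp
  have bd: "b < d" "d < c" and kd: "known (supp d c m (restrict z {d<..<c}))"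
    using d by (auto simp: split_at_def restrict_sub)
  have fd: "face d 0 m z" using d bd by (simp add: split_at_def face_sub)
  have kad: "known (supp a d m (restrict z {a<..<d}))" by (rule k(2)[OF bd])
  have s: "split_at a c m z d" using bd abc fd kad kd by (simp add: split_at_def)
  note cl = comp_at_closed[OF abc(2,3) z' d]
  have fb: "face b 0 m (restrict z {a<..<d})" using f abc bd by (simp add: face_sub)
  have "G a d m (restrict z {a<..<d}) = scomp C (gob a) (gob b) (gob d) m (G b d m (restrict z {b<..<d})) (G a b m (restrict z {a<..<b}))"
    using G_comp[OF _ _ cube_sub[OF z] kad abc(1) bd(1) fb] abc bd by (simp add: restrict_sub)
  moreover have "ext a c m z = comp_at a c m z d" using ext_split[OF _ abc(3) z s] abc by simp
  moreover have "ext b c m (restrict z {b<..<c}) = comp_at b c m (restrict z {b<..<c}) d"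
    by (rule ext_split[OF abc(2,3) z' d])
  moreover have "gob a \<in> sob C" using gob_ob known_end[OF k(1)] abc by simp
  moreover have "G a b m (restrict z {a<..<b}) \<in> simps (shom C (gob a) (gob b)) m"
    using abc by (intro G_closed cube_sub[OF z] k(1)) auto
  ultimately show ?thesis
    using cl bd by (simp add: comp_at_def restrict_sub comp_assoc)
qed

lemma ext_comp_left:
  assumes abc: "a < b" "b < c" "c \<le> n" and z: "z \<in> simps (cube {a<..<c}) m" and f: "face b 0 m z"
    and dm: "dom a b m (restrict z {a<..<b})"
    and k: "known (supp b c m (restrict z {b<..<c}))"
      "\<And>d. \<lbrakk>a < d; d < b\<rbrakk> \<Longrightarrow> known (supp d c m (restrict z {d<..<c}))"
  shows "ext a c m z = scomp C (gob a) (gob b) (gob c) m (G b c m (restrict z {b<..<c})) (ext a b m (restrict z {a<..<b}))"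
  using dm unfolding dom_def
proof (elim disjE exE)
  assume kn: "known (supp a b m (restrict z {a<..<b}))"
  then have "split_at a c m z b" using abc f k(1) by (simp add: split_at_def)
  from ext_split[OF _ abc(3) z this] show ?thesis using kn abc by (simp add: comp_at_def ext_def)
next
  fix d assume d: "split_at a b m (restrict z {a<..<b}) d"
  have z': "restrict z {a<..<b} \<in> simps (cube {a<..<b}) m" using cube_sub[OF z] abc by simp
  have bd: "a < d" "d < b" and kd: "known (supp a d m (restrict z {a<..<d}))"
    using d by (auto simp: split_at_def restrict_sub)
  have fd: "face d 0 m z" using d bd by (simp add: split_at_def face_sub)
  have kdc: "known (supp d c m (restrict z {d<..<c}))" by (rule k(2)[OF bd])
  have s: "split_at a c m z d" using bd abc fd kdc kd by (simp add: split_at_def)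
  have bn: "b \<le> n" using abc by simp
  note cl = comp_at_closed[OF abc(1) bn z' d]
  have fb: "face b 0 m (restrict z {d<..<c})" using f abc bd by (simp add: face_sub)
  have "G d c m (restrict z {d<..<c}) = scomp C (gob d) (gob b) (gob c) m (G b c m (restrict z {b<..<c})) (G d b m (restrict z {d<..<b}))"
    using G_comp[OF _ _ cube_sub[OF z] kdc bd(2) abc(2) fb] abc bd by (simp add: restrict_sub)
  moreover have "ext a c m z = comp_at a c m z d" using ext_split[OF _ abc(3) z s] abc by simp
  moreover have "ext a b m (restrict z {a<..<b}) = comp_at a b m (restrict z {a<..<b}) d"
    by (rule ext_split[OF abc(1) bn z' d])
  moreover have "gob c \<in> sob C" using gob_ob known_end[OF k(1)] abc by simp
  moreover have "G b c m (restrict z {b<..<c}) \<in> simps (shom C (gob b) (gob c)) m"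
    using abc by (intro G_closed cube_sub[OF z] k(1)) auto
  ultimately show ?thesis
    using cl bd by (simp add: comp_at_def restrict_sub comp_assoc)
qed

end

subsection \<open>Horns over a simplex of the target\<close>

locale horn_over = simplicial_functor C D F + horn_in_nerve C n k u
  for C :: "('o, 'a) scat" and D :: "('p, 'b) scat" and F n k u +
  fixes v :: "nat \<Rightarrow> (nat \<Rightarrow> nat) \<Rightarrow> (nat, nat \<Rightarrow> nat \<Rightarrow> nat, 'p, 'b) sfun"
  assumes v: "simplicial_map (std_simplex n) (nerve D) v"
    and uv: "s \<in> simps (horn n k) m \<Longrightarrow> nerve_map F m (u m s) = v m s"
    and k: "k \<le> n"
begin

definition has_lift :: bool where
  "has_lift \<longleftrightarrow> (\<exists>w. simplicial_map (std_simplex n) (nerve C) w \<and>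
    (\<forall>m. \<forall>s\<in>simps (horn n k) m. w m s = u m s) \<and>
    (\<forall>m. \<forall>s\<in>simps (std_simplex n) m. nerve_map F m (w m s) = v m s))"

definition base :: "(nat, nat \<Rightarrow> nat \<Rightarrow> nat, 'p, 'b) sfun" where
  "base = v n (\<lambda>i\<in>{..n}. i)"

lemma base_hom: "base \<in> sfun_hom (DeltaN n) D"
proof -
  have "(\<lambda>i\<in>{..n}. i) \<in> simps (std_simplex n) n" using mono_maps_id by (simp add: std_simplex_def)
  from simplicial_map.map_closed[OF v this] show ?thesis by (simp add: nerve_def base_def)
qed

lemma v_base: "s \<in> mono_maps m n \<Longrightarrow> v m s = sact (nerve D) m n s base"
proof -
  assume s: "s \<in> mono_maps m n"
  have "compose {..m} (\<lambda>i\<in>{..n}. i) s = s"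
    using s mono_maps_le[OF s] by (auto simp: compose_def mono_maps_def fun_eq_iff PiE_iff extensional_def)
  then have "sact (std_simplex n) m n s (\<lambda>i\<in>{..n}. i) = s" by (simp add: std_simplex_def)
  moreover have "(\<lambda>i\<in>{..n}. i) \<in> simps (std_simplex n) n" using mono_maps_id by (simp add: std_simplex_def)
  ultimately show ?thesis using simplicial_map.map_natural[OF v s] unfolding base_def by metis
qed

lemma F_gob:
  assumes a: "a \<le> n" "known {a}"
  shows "fob F (gob a) = fob base a"
proof -
  let ?s = "retr n {a}"
  have V: "{a} \<subseteq> {..n}" "{a} \<noteq> {}" using a by auto
  have s: "?s \<in> simps (horn n k) n" by (rule retr_horn[OF V a(2)])
  have sa: "?s a = a" using retr(3)[OF V] by simp
  have "fob F (fob (u n ?s) a) = fob (nerve_map F n (u n ?s)) a"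
    using a by (simp add: nerve_map_def sfun_comp_def DeltaN_def)
  then show ?thesis
    using u_fob[OF s a(1) sa] uv[OF s] v_base[OF horn_mono[OF s]] nerve_act(1)[OF horn_mono[OF s] a(1), of D base] sa by simp
qed

lemma F_G:
  assumes ab: "a \<le> b" "b \<le> n" and z: "z \<in> simps (cube {a<..<b}) m" and kn: "known (supp a b m z)"
  shows "farr F (gob a) (gob b) m (G a b m z) = farr base a b m z"
proof -
  let ?V = "supp a b m z" let ?s = "retr n ?V"
  have V: "?V \<subseteq> {..n}" "?V \<noteq> {}" using supp_bound[OF ab] by auto
  note t = retr[OF V]
  have s: "?s \<in> simps (horn n k) n" by (rule retr_horn[OF V kn])
  have an: "a \<le> n" using ab by simp
  have zn: "z \<in> simps (nerve_hom a b) m" using z by (simp add: nerve_hom_cube[OF ab(1)])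
  have ob: "fob (u n ?s) a = gob a" "fob (u n ?s) b = gob b"
    using u_fob[OF s an t(3)[OF supp_ends(1)]] u_fob[OF s ab(2) t(3)[OF supp_ends(2)]] by auto
  have "farr F (gob a) (gob b) m (G a b m z) = farr (nerve_map F n (u n ?s)) a b m z"
    using an ab zn ob by (simp add: nerve_map_def sfun_comp_def DeltaN_def G_def)
  then show ?thesis
    using uv[OF s] v_base[OF t(1)] nerve_act(2)[OF t(1) an ab(2) zn, of D base]
      DeltaN_map_arr_fix[OF t(1) ab zn t(3)] by simp
qed

lemma F_ext:
  assumes ab: "a < b" "b \<le> n" and z: "z \<in> simps (cube {a<..<b}) m" and d: "dom a b m z"
  shows "farr F (gob a) (gob b) m (ext a b m z) = farr base a b m z"
  using d unfolding dom_def
proof (elim disjE exE)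
  assume "known (supp a b m z)"
  then show ?thesis using F_G ab z by (simp add: ext_def)
next
  fix c assume c: "split_at a b m z c"
  note cl = comp_at_closed[OF ab z c]
  have ac: "a < c" "c < b" "face c 0 m z"
    and kn: "known (supp a c m (restrict z {a<..<c}))" "known (supp c b m (restrict z {c<..<b}))"
    using c by (auto simp: split_at_def)
  have "farr F (gob a) (gob b) m (ext a b m z) = scomp D (fob F (gob a)) (fob F (gob c)) (fob F (gob b)) m
      (farr base c b m (restrict z {c<..<b})) (farr base a c m (restrict z {a<..<c}))"
    unfolding ext_split[OF ab z c] comp_at_def
    using arr_comp[OF cl] F_G[OF _ _ cube_sub[OF z] kn(1)] F_G[OF _ _ cube_sub[OF z] kn(2)] ac ab by simp
  then show ?thesis
    using nerve_simplex(3)[OF base_hom _ ac(1,2) ab(2) z ac(3)] F_gob known_end[OF kn(1)] known_end[OF kn(2)] ac ab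
    by simp
qed

text \<open>
  To lift the horn it is enough to find mapping cubes over those of the base that are compatible on
  the faces \<open>z\<^sub>b = 0\<close> and have the known values.
\<close>

lemma assemble:
  assumes ob: "\<And>a. a \<le> n \<Longrightarrow> ob a \<in> sob C" "\<And>a. \<lbrakk>a \<le> n; known {a}\<rbrakk> \<Longrightarrow> ob a = gob a"
      "\<And>a. a \<le> n \<Longrightarrow> fob F (ob a) = fob base a"
    and W: "\<And>a b. \<lbrakk>a < b; b \<le> n\<rbrakk> \<Longrightarrow> natural_on {a<..<b} whole (shom C (ob a) (ob b)) (W a b)"
    and comp: "\<And>a b c m z. \<lbrakk>a < b; b < c; c \<le> n; z \<in> simps (cube {a<..<c}) m; face b 0 m z\<rbrakk> \<Longrightarrow>
      W a c m z = scomp C (ob a) (ob b) (ob c) m (W b c m (restrict z {b<..<c})) (W a b m (restrict z {a<..<b}))"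
    and WG: "\<And>a b m z. \<lbrakk>a < b; b \<le> n; z \<in> simps (cube {a<..<b}) m; known (supp a b m z)\<rbrakk> \<Longrightarrow> W a b m z = G a b m z"
    and FW: "\<And>a b m z. \<lbrakk>a < b; b \<le> n; z \<in> simps (cube {a<..<b}) m\<rbrakk> \<Longrightarrow>
      farr F (ob a) (ob b) m (W a b m z) = farr base a b m z"
  shows has_lift
  unfolding has_lift_def
proof (rule lift_from_functor[OF simplicial_functor_axioms v])
  let ?W = "nerve_fun C n ob W"
  show W': "?W \<in> sfun_hom (DeltaN n) C" by (rule C.nerve_fun_hom[OF ob(1) W comp])
  show "fob ?W a = gob a" if "a \<le> n" "known {a}" for a using that ob(2) by (simp add: nerve_fun_def)
  show "farr ?W a b m z = G a b m z"
    if ab: "a \<le> b" "b \<le> n" and z: "z \<in> simps (cube {a<..<b}) m" and kn: "known (supp a b m z)" for a b m z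
  proof -
    have an: "a \<le> n" using ab by simp
    have "farr ?W a b m z = (if a = b then sidn C (ob a) m else W a b m z)"
      using an ab(2) z by (simp add: nerve_fun_def nerve_hom_cube[OF ab(1)])
    then show ?thesis
      using WG[OF _ ab(2) z kn] G_id[OF ab z kn] ab(1) ob(2)[OF an known_end(1)[OF kn]] by (cases "a = b") simp_all
  qed
  have "nerve_map F n ?W = base"
  proof (rule sfun_hom_eqI[OF _ base_hom])
    show "nerve_map F n ?W \<in> sfun_hom (DeltaN n) D"
      unfolding nerve_map_def
      using W' simplicial_functor_axioms by (intro sfun_comp_hom) (simp_all add: sfun_hom_def)
    show "fob (nerve_map F n ?W) a = fob base a" if "a \<in> sob (DeltaN n)" for a
      using that ob(3) by (simp add: nerve_map_def sfun_comp_def nerve_fun_def DeltaN_def)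
    show "farr (nerve_map F n ?W) a b m z = farr base a b m z"
      if a: "a \<in> sob (DeltaN n)" "b \<in> sob (DeltaN n)" and z: "z \<in> simps (shom (DeltaN n) a b) m" for a b m z
    proof -
      have ab: "a \<le> n" "b \<le> n" and z': "z \<in> simps (nerve_hom a b) m" using a z by (auto simp: DeltaN_def)
      have le: "a \<le> b" using z' by (auto simp: simps_nerve_hom split: if_splits)
      have zc: "z \<in> simps (cube {a<..<b}) m" using z' by (simp add: nerve_hom_cube[OF le])
      have *: "farr (nerve_map F n ?W) a b m z = farr F (ob a) (ob b) m (if a = b then sidn C (ob a) m else W a b m z)"
        using ab z' by (simp add: nerve_map_def sfun_comp_def nerve_fun_def DeltaN_def)
      show ?thesis
      proof (cases "a = b")
        case True
        have "farr F (ob a) (ob a) m (sidn C (ob a) m) = sidn D (fob F (ob a)) m"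
          using simplicial_map.map_natural[OF arr_map[OF ob(1)[OF ab(1)] ob(1)[OF ab(1)]] zero_mono_maps C.id_closed[OF ob(1)[OF ab(1)]]]
            arr_id[OF ob(1)[OF ab(1)]] by (simp add: sidn_def)
        then show ?thesis using * True nerve_simplex(4)[OF base_hom ab(1), of z m] z' ob(3)[OF ab(1)] by simp
      next
        case False
        then show ?thesis using * FW[OF _ ab(2) zc] le by simp
      qed
    qed
  qed
  then show "nerve_map F n ?W = v n (\<lambda>i\<in>{..n}. i)" by (simp add: base_def)
qed

end

section \<open>Filling horns of dimension at least two\<close>

context horn_over
begin

text \<open>
  Which part of the mapping cube from \<open>a\<close> to \<open>b\<close> the horn determines: everything, if a vertex other
  than \<open>k\<close> lies outside the interval from \<open>a\<close> to \<open>b\<close>, and otherwise the faces \<open>z\<^sub>i = 1\<close> with \<open>i \<noteq> k\<close>.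
\<close>

lemma known_supp_iff:
  assumes "a < b" "b \<le> n"
  shows "known (supp a b m z) \<longleftrightarrow> (\<exists>i\<le>n. i \<noteq> k \<and> (i < a \<or> b < i)) \<or> (\<exists>i\<in>{a<..<b}. i \<noteq> k \<and> face i 1 m z)"
proof -
  have 1: "i \<notin> supp a b m z \<longleftrightarrow> i < a \<or> b < i \<or> a < i \<and> i < b \<and> face i 1 m z" for i
    using assms by (auto simp: supp_def)
  have 2: "i < b \<Longrightarrow> i \<le> n" for i using assms by simp
  show ?thesis unfolding known_def 1 using 2 by (metis greaterThanLessThan_iff)
qed

lemma known_outside: "\<lbrakk>a < b; b \<le> n; i \<le> n; i \<noteq> k; i < a \<or> b < i\<rbrakk> \<Longrightarrow> known (supp a b m z)"
  using known_supp_iff by blast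

lemma known_vertex: "2 \<le> n \<Longrightarrow> known {a}"
proof -
  assume n: "2 \<le> n"
  have "\<exists>i\<in>{0, 1, 2}. i \<noteq> k \<and> i \<noteq> a" by auto
  then show ?thesis using n unfolding known_def by (metis dual_order.trans empty_iff insert_iff le0 one_le_numeral)
qed

lemma G_natural:
  assumes ab: "a < b" "b \<le> n" and kn: "\<And>m z. known (supp a b m z)"
  shows "natural_on {a<..<b} whole (shom C (gob a) (gob b)) (G a b)"
  unfolding natural_on_def
  using G_closed[OF less_imp_le[OF ab(1)] ab(2) _ kn] G_sact[OF less_imp_le[OF ab(1)] ab(2) _ kn] by simp

lemma base_natural:
  assumes n: "2 \<le> n" and ab: "a < b" "b \<le> n"
  shows "natural_on {a<..<b} whole (shom D (fob F (gob a)) (fob F (gob b))) (farr base a b)"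
  using nerve_simplex(2)[OF base_hom, of a b] ab F_gob[OF _ known_vertex[OF n]] by simp

text \<open>
  Between adjacent vertices the mapping cube is a point.
\<close>

lemma adjacent_G:
  assumes a: "Suc a \<le> n" and kn: "\<And>m z. known (supp a (Suc a) m z)"
  shows "G a (Suc a) m (restrict z {a<..<Suc a}) = cst (shom C (gob a) (gob (Suc a))) m (G a (Suc a) 0 (\<lambda>_. undefined))"
    and "G a (Suc a) 0 (\<lambda>_. undefined) \<in> simps (shom C (gob a) (gob (Suc a))) 0"
proof -
  have e: "{a<..<Suc a} = {}" by auto
  have pt: "(\<lambda>_. undefined) \<in> simps (cube {a<..<Suc a}) 0" unfolding e by (simp add: simps_cube)
  have le: "a \<le> Suc a" by simp
  show "G a (Suc a) 0 (\<lambda>_. undefined) \<in> simps (shom C (gob a) (gob (Suc a))) 0"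
    by (rule G_closed[OF le a pt kn])
  have "sact (cube {a<..<Suc a}) m 0 (\<lambda>i\<in>{..m}. 0 :: nat) (\<lambda>_. undefined) = (\<lambda>_. undefined)"
    unfolding e by (simp add: sact_cube restrict_def)
  moreover have "restrict z {a<..<Suc a} = (\<lambda>_. undefined)" unfolding e by (simp add: restrict_def)
  ultimately show "G a (Suc a) m (restrict z {a<..<Suc a}) = cst (shom C (gob a) (gob (Suc a))) m (G a (Suc a) 0 (\<lambda>_. undefined))"
    using G_sact[OF le a pt kn zero_mono_maps, of m] by (simp add: cst_def)
qed

text \<open>
  Only the mapping cube from \<open>0\<close> to \<open>n\<close> is incomplete.  Its faces \<open>z\<^sub>c = 0\<close> are composites and its
  faces \<open>z\<^sub>i = 1\<close> are known for \<open>i \<noteq> k\<close>, so it is an open box over a cube of the base.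
\<close>

theorem inner_horn:
  assumes fib: "\<And>x y. \<lbrakk>x \<in> sob C; y \<in> sob C\<rbrakk> \<Longrightarrow> kan_fibration (shom C x y) (shom D (fob F x) (fob F y)) (farr F x y)"
    and kn: "0 < k" "k < n"
  shows has_lift
proof -
  have n2: "2 \<le> n" "0 < n" using kn by auto
  have ob: "gob a \<in> sob C" "fob F (gob a) = fob base a" if "a \<le> n" for a
    using gob_ob F_gob known_vertex[OF n2(1)] that by auto
  let ?S = "{0<..<n}"
  have kout: "known (supp a b m z)" if "a < b" "b \<le> n" "\<not> (a = 0 \<and> b = n)" for a b m z
  proof (cases "a = 0")
    case True
    then show ?thesis using that kn by (intro known_outside[of a b n]) auto
  next
    case False
    then show ?thesis using that kn by (intro known_outside[of a b 0]) auto
  qed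
  have sp: "split_at 0 n m z c" if "0 < c" "c < n" "face c 0 m z" for c m z
    using that kout[of 0 c] kout[of c n] by (simp add: split_at_def)
  have dm: "dom 0 n m z \<longleftrightarrow> obox ?S k 1 m z" for m z
  proof -
    have "known (supp 0 n m z) \<longleftrightarrow> (\<exists>i\<in>?S - {k}. face i 1 m z)"
      unfolding known_supp_iff[OF n2(2) order_refl] using kn by auto
    moreover have "(\<exists>c. split_at 0 n m z c) \<longleftrightarrow> (\<exists>c\<in>?S. face c 0 m z)"
      using sp by (auto simp: split_at_def)
    ultimately show ?thesis using kn by (auto simp: dom_def obox_def bdry_def)
  qed
  have "\<exists>H. natural_on ?S whole (shom C (gob 0) (gob n)) H \<and> (\<forall>m. \<forall>z\<in>simps (cube ?S) m.
    farr F (gob 0) (gob n) m (H m z) = farr base 0 n m z \<and> (obox ?S k 1 m z \<longrightarrow> H m z = ext 0 n m z))"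
  proof (rule box_lift[OF fib])
    show "natural_on ?S (obox ?S k 1) (shom C (gob 0) (gob n)) (ext 0 n)"
      using ext_natural[OF n2(2) order_refl] by (rule natural_on_subset) (simp add: dm)
    show "natural_on ?S whole (shom D (fob F (gob 0)) (fob F (gob n))) (farr base 0 n)"
      by (rule base_natural[OF n2 order_refl])
    show "farr F (gob 0) (gob n) m (ext 0 n m z) = farr base 0 n m z"
      if "z \<in> simps (cube ?S) m" "obox ?S k 1 m z" for m z
      using F_ext[OF n2(2) order_refl that(1)] that(2) dm by simp
  qed (use ob kn in auto)
  then obtain H where H: "natural_on ?S whole (shom C (gob 0) (gob n)) H"
    and FH: "\<And>m z. z \<in> simps (cube ?S) m \<Longrightarrow> farr F (gob 0) (gob n) m (H m z) = farr base 0 n m z"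
    and He: "\<And>m z. z \<in> simps (cube ?S) m \<Longrightarrow> dom 0 n m z \<Longrightarrow> H m z = ext 0 n m z"
    unfolding dm by blast
  define W where "W a b = (if a = 0 \<and> b = n then H else G a b)" for a b
  show ?thesis
  proof (rule assemble[where ob = gob and W = W])
    show "natural_on {a<..<b} whole (shom C (gob a) (gob b)) (W a b)" if ab: "a < b" "b \<le> n" for a b
      using H G_natural[OF ab kout[OF ab]] by (cases "a = 0 \<and> b = n") (simp_all add: W_def)
    show "W a c m z = scomp C (gob a) (gob b) (gob c) m (W b c m (restrict z {b<..<c})) (W a b m (restrict z {a<..<b}))"
      if abc: "a < b" "b < c" "c \<le> n" and z: "z \<in> simps (cube {a<..<c}) m" and f: "face b 0 m z" for a b c m z
    proof (cases "a = 0 \<and> c = n")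
      case True
      have s: "split_at 0 n m z b" using sp abc f True by simp
      have zS: "z \<in> simps (cube ?S) m" using z True by simp
      show ?thesis
        using He[OF zS] ext_split[OF n2(2) order_refl zS s] s abc True
        by (auto simp: W_def dom_def comp_at_def)
    next
      case False
      then have ac: "\<not> (a = 0 \<and> b = n)" "\<not> (b = 0 \<and> c = n)" using abc by auto
      have W: "W a c = G a c" "W a b = G a b" "W b c = G b c" unfolding W_def using False ac by presburger+
      show ?thesis unfolding W using abc kout False by (intro G_comp z f) auto
    qed
    show "W a b m z = G a b m z"
      if ab: "a < b" "b \<le> n" and z: "z \<in> simps (cube {a<..<b}) m" and kw: "known (supp a b m z)" for a b m z
      using He[of z m] z kw by (auto simp: W_def dom_def ext_def)
    show "farr F (gob a) (gob b) m (W a b m z) = farr base a b m z"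
      if ab: "a < b" "b \<le> n" and z: "z \<in> simps (cube {a<..<b}) m" for a b m z
      using FH[of z m] z F_G[OF less_imp_le[OF ab(1)] ab(2) z kout[OF ab]] by (auto simp: W_def)
  qed (use ob in auto)
qed

text \<open>
  For \<open>k = 0\<close> two mapping cubes are incomplete: the one from \<open>1\<close> to \<open>n\<close>, of which only the boundary is
  forced, and the one from \<open>0\<close> to \<open>n\<close>, of which all faces but \<open>z\<^sub>1 = 0\<close> are forced.  The latter face
  has to be the composite of the former cube with the first edge \<open>\<alpha>\<close>, so both cubes are found
  together by extension along the homotopy equivalence \<open>\<alpha>\<close>.  The case \<open>k = n\<close> is dual, with the last
  edge.
\<close>

theorem outer_horn:
  assumes fib: "\<And>x y. \<lbrakk>x \<in> sob C; y \<in> sob C\<rbrakk> \<Longrightarrow> kan_fibration (shom C x y) (shom D (fob F x) (fob F y)) (farr F x y)"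
    and kan: "\<And>x y. \<lbrakk>x \<in> sob C; y \<in> sob C\<rbrakk> \<Longrightarrow> kan (shom C x y)"
    and inv: "\<And>x y \<alpha>. \<lbrakk>x \<in> sob C; y \<in> sob C; \<alpha> \<in> simps (shom C x y) 0\<rbrakk> \<Longrightarrow> \<exists>\<beta>. C.homotopy_inverse x y \<alpha> \<beta>"
    and n2: "2 \<le> n" and k0n: "k = 0 \<or> k = n"
  shows has_lift
proof -
  \<comment> \<open>The missing facet \<open>d\<^sub>k\<close> has first vertex \<open>p\<close> and last vertex \<open>q\<close>; \<open>t\<close> is the neighbour of the vertex \<open>k\<close>.\<close>
  obtain p q t :: nat where pq: "k = 0 \<and> p = 1 \<and> q = n \<and> t = 1 \<or> k = n \<and> p = 0 \<and> Suc q = n \<and> t = q"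
    using k0n n2 by (cases n) auto
  then have lt: "p < q" "q \<le> n" "0 < t" "t < n" "0 < n" "p \<le> n" "t \<le> n" "0 \<le> n" and pq0: "\<not> (p = 0 \<and> q = n)"
    using n2 by auto
  have ob: "gob a \<in> sob C" "fob F (gob a) = fob base a" if "a \<le> n" for a
    using gob_ob F_gob known_vertex[OF n2(1)] that by auto
  let ?S = "{p<..<q}" let ?T = "{0<..<n}"
  have ins: "insert t ?S = ?T" and tS: "t \<notin> ?S" and ST: "?S \<subseteq> ?T" using pq n2 by auto
  have kout: "known (supp a b m z)" if ab: "a < b" "b \<le> n" "\<not> (a = 0 \<and> b = n)" "\<not> (a = p \<and> b = q)" for a b m z
  proof -
    consider "k = 0" "b < n" | "k = 0" "1 < a" | "k = n" "0 < a" | "k = n" "b < q"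
      using ab pq n2 by linarith
    then show ?thesis
    proof cases
      case 1 then show ?thesis using ab n2 by (intro known_outside[of a b n]) auto
    next
      case 2 then show ?thesis using ab n2 by (intro known_outside[of a b 1]) auto
    next
      case 3 then show ?thesis using ab n2 by (intro known_outside[of a b 0]) auto
    next
      case 4 then show ?thesis using ab pq n2 by (intro known_outside[of a b q]) auto
    qed
  qed
  have sp: "split_at a b m z c"
    if "a < c" "c < b" "b \<le> n" "face c 0 m z" "c \<in> ?S" for a b m z c
    using that kout[of a c] kout[of c b] lt by (simp add: split_at_def)
  have dm1: "dom p q m z \<longleftrightarrow> bdry ?S m z" for m z
  proof -
    have "known (supp p q m z) \<longleftrightarrow> (\<exists>i\<in>?S. face i 1 m z)"
      unfolding known_supp_iff[OF lt(1,2)] using pq by auto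
    moreover have "split_at p q m z c \<longleftrightarrow> c \<in> ?S \<and> face c 0 m z" for c
      using sp[of p c q m z] lt by (auto simp: split_at_def)
    ultimately show ?thesis unfolding dom_def bdry_def by blast
  qed
  have dm0: "dom 0 n m z \<longleftrightarrow> obox ?T t 0 m z" for m z
  proof -
    have kk: "known (supp 0 n m z) \<longleftrightarrow> (\<exists>i\<in>?T. face i 1 m z)"
      unfolding known_supp_iff[OF lt(5) order_refl] using k0n by auto
    have "\<exists>i\<in>?S. face i 1 m z" if "split_at 0 n m z t"
    proof -
      have "known (supp p q m (restrict z ?S))" using that pq by (auto simp: split_at_def)
      then obtain i where "i \<in> ?S" "face i 1 m (restrict z ?S)"
        unfolding known_supp_iff[OF lt(1,2)] using pq by auto
      then show ?thesis using face_restrict by blast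
    qed
    moreover have "c \<in> ?S \<and> face c 0 m z" if "split_at 0 n m z c" "c \<noteq> t" for c
      using that ins by (auto simp: split_at_def)
    ultimately have split: "(\<exists>i\<in>?S. face i 1 m z) \<or> (\<exists>c\<in>?S. face c 0 m z)" if "split_at 0 n m z c" for c
      using that by (cases "c = t") blast+
    have comp: "split_at 0 n m z c" if "c \<in> ?S" "face c 0 m z" for c
      using sp[of 0 c n m z] that lt by simp
    have O: "obox ?T t 0 m z \<longleftrightarrow> (\<exists>i\<in>?T. face i 1 m z) \<or> (\<exists>c\<in>?S. face c 0 m z)"
      unfolding ins[symmetric] using tS by (auto simp: obox_insert bdry_def)
    show ?thesis unfolding O dom_def kk using split comp ST by blast
  qed
  have u: "natural_on ?S (bdry ?S) (shom C (gob p) (gob q)) (ext p q)"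
    using ext_natural[OF lt(1,2)] by (rule natural_on_subset) (simp add: dm1)
  have h: "natural_on ?T (obox ?T t 0) (shom C (gob 0) (gob n)) (ext 0 n)"
    using ext_natural[OF lt(5) order_refl] by (rule natural_on_subset) (simp add: dm0)
  note v = base_natural[OF n2 lt(1,2)] and g = base_natural[OF n2 lt(5) order_refl]
  have Fu: "farr F (gob p) (gob q) m (ext p q m z) = farr base p q m z" if "z \<in> simps (cube ?S) m" "bdry ?S m z" for m z
    using F_ext[OF lt(1,2) that(1)] that(2) by (simp add: dm1)
  have Fh: "farr F (gob 0) (gob n) m (ext 0 n m z) = farr base 0 n m z" if "z \<in> simps (cube ?T) m" "obox ?T t 0 m z" for m z
    using F_ext[OF lt(5) order_refl that(1)] that(2) by (simp add: dm0)
  define W' where "W' U a b = (if a = p \<and> b = q then U else G a b)" for U a b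
  have "\<exists>U H. natural_on ?S whole (shom C (gob p) (gob q)) U \<and>
      (\<forall>m. \<forall>z\<in>simps (cube ?S) m. farr F (gob p) (gob q) m (U m z) = farr base p q m z \<and>
        (bdry ?S m z \<longrightarrow> U m z = ext p q m z)) \<and>
      natural_on ?T whole (shom C (gob 0) (gob n)) H \<and>
      (\<forall>m. \<forall>z\<in>simps (cube ?T) m. farr F (gob 0) (gob n) m (H m z) = farr base 0 n m z \<and>
        (obox ?T t 0 m z \<longrightarrow> H m z = ext 0 n m z) \<and>
        (face t 0 m z \<longrightarrow> H m z = scomp C (gob 0) (gob t) (gob n) m
          (W' U t n m (restrict z {t<..<n})) (W' U 0 t m (restrict z {0<..<t}))))"
    using pq
  proof (elim disjE conjE)
    assume k: "k = 0" "p = 1" "q = n" "t = 1"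
    have kn: "known (supp 0 1 m z)" for m z using kout[of 0 1] k n2 by simp
    define \<alpha> where "\<alpha> = G 0 1 0 (\<lambda>_. undefined)"
    have \<alpha>: "G 0 1 m (restrict z {0<..<1}) = cst (shom C (gob 0) (gob 1)) m \<alpha>"
      "\<alpha> \<in> simps (shom C (gob 0) (gob 1)) 0" for m z
      using adjacent_G[of 0] kn lt unfolding \<alpha>_def One_nat_def by auto
    note o = ob(1)[OF lt(8)] ob(1)[OF lt(7), unfolded k(2-4)] ob(1)[OF order_refl]
    obtain \<beta> where \<beta>: "C.homotopy_inverse (gob 0) (gob 1) \<alpha> \<beta>" using inv[OF o(1,2) \<alpha>(2)] by blast
    have W: "W' U 1 n = U" "W' U 0 1 = G 0 1" for U using k n2 by (auto simp: W'_def)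
    show ?thesis
      unfolding ins[symmetric] unfolding k(2-4) W \<alpha>(1)
    proof (rule extend_along_equivalence[where \<beta> = \<beta>], unfold ins[unfolded k(2-4)])
      fix m z assume z: "z \<in> simps (cube ?T) m" "face 1 0 m z"
      have zc: "restrict z {0<..<1} \<in> simps (cube {0<..<1}) m" using cube_sub[OF z(1), of 0 1] n2 by simp
      show "ext 0 n m z = scomp C (gob 0) (gob 1) (gob n) m (ext 1 n m (restrict z {1<..<n})) (cst (shom C (gob 0) (gob 1)) m \<alpha>)"
        if "bdry {1<..<n} m z"
        unfolding \<alpha>(1)[of m z, symmetric]
        using z that n2 kn kout k dm1 by (intro ext_comp_right) (auto simp: bdry_restrict)
      show "farr base 0 n m z = scomp D (fob F (gob 0)) (fob F (gob 1)) (fob F (gob n)) m (farr base 1 n m (restrict z {1<..<n}))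
          (farr F (gob 0) (gob 1) m (cst (shom C (gob 0) (gob 1)) m \<alpha>))"
        unfolding \<alpha>(1)[of m z, symmetric]
        using nerve_simplex(3)[OF base_hom lt(8) _ _ order_refl z] F_G[OF _ _ zc kn] ob(2) n2 by simp
    qed (use o kan fib \<beta> u h v g Fu Fh k(2-4) in auto)
  next
    assume k: "k = n" "p = 0" "Suc q = n" "t = q"
    have kn: "known (supp q n m z)" for m z using kout[of q n] k n2 lt by simp
    define \<alpha> where "\<alpha> = G q n 0 (\<lambda>_. undefined)"
    have \<alpha>: "G q n m (restrict z {q<..<n}) = cst (shom C (gob q) (gob n)) m \<alpha>"
      "\<alpha> \<in> simps (shom C (gob q) (gob n)) 0" for m z
      using adjacent_G[of q] kn k unfolding \<alpha>_def by auto
    note o = ob(1)[OF lt(2)] ob(1)[OF order_refl] ob(1)[OF lt(8)]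
    obtain \<beta> where \<beta>: "C.homotopy_inverse (gob q) (gob n) \<alpha> \<beta>" using inv[OF o(1,2) \<alpha>(2)] by blast
    have W: "W' U 0 q = U" "W' U q n = G q n" for U using k lt by (auto simp: W'_def)
    show ?thesis
      unfolding ins[symmetric] unfolding k(2,4) W \<alpha>(1)
    proof (rule extend_along_equivalence_op[where \<beta> = \<beta>], unfold ins[unfolded k(2,4)])
      fix m z assume z: "z \<in> simps (cube ?T) m" "face q 0 m z"
      have q: "0 < q" "q < n" using k lt by auto
      have zc: "restrict z {q<..<n} \<in> simps (cube {q<..<n}) m" using cube_sub[OF z(1), of q n] q by simp
      show "ext 0 n m z = scomp C (gob 0) (gob q) (gob n) m (cst (shom C (gob q) (gob n)) m \<alpha>) (ext 0 q m (restrict z {0<..<q}))"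
        if "bdry {0<..<q} m z"
        unfolding \<alpha>(1)[of m z, symmetric]
        using z that q kn kout k(2) dm1 by (intro ext_comp_left) (auto simp: bdry_restrict)
      show "farr base 0 n m z = scomp D (fob F (gob 0)) (fob F (gob q)) (fob F (gob n)) m
          (farr F (gob q) (gob n) m (cst (shom C (gob q) (gob n)) m \<alpha>)) (farr base 0 q m (restrict z {0<..<q}))"
        unfolding \<alpha>(1)[of m z, symmetric]
        using nerve_simplex(3)[OF base_hom lt(8) q order_refl z] F_G[OF _ _ zc kn] ob(2) q by simp
    qed (use o kan fib \<beta> u h v g Fu Fh k(2,4) lt in auto)
  qed
  then obtain U H where U: "natural_on ?S whole (shom C (gob p) (gob q)) U"
    and FU: "\<And>m z. z \<in> simps (cube ?S) m \<Longrightarrow> farr F (gob p) (gob q) m (U m z) = farr base p q m z"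
    and Ue: "\<And>m z. z \<in> simps (cube ?S) m \<Longrightarrow> dom p q m z \<Longrightarrow> U m z = ext p q m z"
    and H: "natural_on ?T whole (shom C (gob 0) (gob n)) H"
    and FH: "\<And>m z. z \<in> simps (cube ?T) m \<Longrightarrow> farr F (gob 0) (gob n) m (H m z) = farr base 0 n m z"
    and He: "\<And>m z. z \<in> simps (cube ?T) m \<Longrightarrow> dom 0 n m z \<Longrightarrow> H m z = ext 0 n m z"
    and HU: "\<And>m z. z \<in> simps (cube ?T) m \<Longrightarrow> face t 0 m z \<Longrightarrow> H m z = scomp C (gob 0) (gob t) (gob n) m
      (W' U t n m (restrict z {t<..<n})) (W' U 0 t m (restrict z {0<..<t}))"
    unfolding dm0 dm1 by blast
  define W where "W a b = (if a = 0 \<and> b = n then H else W' U a b)" for a b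
  have W0: "W 0 n = H" and W1: "W p q = U"
    and WG: "\<lbrakk>\<not> (a = 0 \<and> b = n); \<not> (a = p \<and> b = q)\<rbrakk> \<Longrightarrow> W a b = G a b" for a b
    using pq0 by (auto simp: W_def W'_def)
  have ext: "W a b m z = ext a b m z" if ab: "a < b" "b \<le> n" "z \<in> simps (cube {a<..<b}) m" "dom a b m z" for a b m z
  proof -
    consider "a = 0" "b = n" | "a = p" "b = q" | "\<not> (a = 0 \<and> b = n)" "\<not> (a = p \<and> b = q)" by blast
    then show ?thesis
    proof cases
      case 3
      then show ?thesis using kout[OF ab(1,2)] WG by (simp add: ext_def)
    qed (use He Ue W0 W1 ab in simp_all)
  qed
  show ?thesis
  proof (rule assemble[where ob = gob and W = W])
    show "natural_on {a<..<b} whole (shom C (gob a) (gob b)) (W a b)" if ab: "a < b" "b \<le> n" for a b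
    proof -
      consider "a = 0" "b = n" | "a = p" "b = q" | "\<not> (a = 0 \<and> b = n)" "\<not> (a = p \<and> b = q)" by blast
      then show ?thesis using U H W0 W1 WG G_natural[OF ab kout[OF ab]] by cases simp_all
    qed
    show "farr F (gob a) (gob b) m (W a b m z) = farr base a b m z"
      if ab: "a < b" "b \<le> n" and z: "z \<in> simps (cube {a<..<b}) m" for a b m z
    proof -
      consider "a = 0" "b = n" | "a = p" "b = q" | "\<not> (a = 0 \<and> b = n)" "\<not> (a = p \<and> b = q)" by blast
      then show ?thesis using FU FH z W0 W1 WG F_G[OF less_imp_le[OF ab(1)] ab(2) z kout[OF ab]] by cases simp_all
    qed
    show "W a b m z = G a b m z"
      if "a < b" "b \<le> n" "z \<in> simps (cube {a<..<b}) m" "known (supp a b m z)" for a b m z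
      using ext[OF that(1-3)] that(4) by (simp add: dom_def ext_def)
    show "W a c m z = scomp C (gob a) (gob b) (gob c) m (W b c m (restrict z {b<..<c})) (W a b m (restrict z {a<..<b}))"
      if abc: "a < b" "b < c" "c \<le> n" and z: "z \<in> simps (cube {a<..<c}) m" and f: "face b 0 m z" for a b c m z
    proof (cases "a = 0 \<and> c = n \<and> b = t")
      case True
      have "W t n = W' U t n" "W 0 t = W' U 0 t" using lt by (auto simp: W_def)
      then show ?thesis using HU[of z m] z f True W0 by simp
    next
      case False
      have ns: "\<not> (a = p \<and> b = q)" "\<not> (b = p \<and> c = q)" "\<not> (a = 0 \<and> b = n)" "\<not> (b = 0 \<and> c = n)"
        using pq abc False by auto
      have s: "split_at a c m z b"
        using abc f kout[OF abc(1) _ ns(3,1)] kout[OF abc(2,3) ns(4,2)] by (simp add: split_at_def)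
      have ac: "a < c" using abc by simp
      have "W a c m z = comp_at a c m z b"
        using ext[OF ac abc(3) z] ext_split[OF ac abc(3) z s] s by (auto simp: dom_def)
      then show ?thesis using WG ns by (simp add: comp_at_def)
    qed
  qed (use ob in auto)
qed

end

section \<open>Lifting edges\<close>

lemma (in simplicial_category) homotopy_equivalence_groupoid:
  assumes gp: "groupoid (pi0_cat C)" and o: "x \<in> sob C" "y \<in> sob C" and \<alpha>: "\<alpha> \<in> simps (shom C x y) 0"
  shows "homotopy_equivalence C x y \<alpha>"
proof -
  have "pi0_rel (shom C x y) `` {\<alpha>} \<in> chom (pi0_cat C) x y"
    using \<alpha> by (simp add: pi0_cat_def pi0_def quotientI)
  then show ?thesis using gp o \<alpha> by (simp add: homotopy_equivalence_def groupoid_def pi0_cat_def)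
qed

lemma (in simplicial_category) homotopy_inverse_groupoid:
  assumes gp: "groupoid (pi0_cat C)" and o: "x \<in> sob C" "y \<in> sob C" and \<alpha>: "\<alpha> \<in> simps (shom C x y) 0"
  shows "\<exists>\<beta>. homotopy_inverse x y \<alpha> \<beta>"
proof -
  let ?A = "pi0_rel (shom C x y) `` {\<alpha>}"
  have "isomorphism (pi0_cat C) x y ?A"
    using homotopy_equivalence_groupoid[OF assms] by (simp add: homotopy_equivalence_def)
  then obtain B where B: "B \<in> chom (pi0_cat C) y x"
    and BA: "ccomp (pi0_cat C) x y x B ?A = cid (pi0_cat C) x" and AB: "ccomp (pi0_cat C) y x y ?A B = cid (pi0_cat C) y"
    unfolding isomorphism_def by blast
  obtain \<beta> where \<beta>: "\<beta> \<in> simps (shom C y x) 0" and Be: "B = pi0_rel (shom C y x) `` {\<beta>}"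
    using B by (auto simp: pi0_cat_def pi0_def elim: quotientE)
  have cid: "cid (pi0_cat C) z = pi0_rel (shom C z z) `` {sid C z}" for z by (simp add: pi0_cat_def)
  have "(scomp C x y x 0 \<beta> \<alpha>, sid C x) \<in> pi0_rel (shom C x x)"
    using BA unfolding Be cid pi0_comp_class[OF o o(1) \<beta> \<alpha>]
    by (rule eq_equiv_class[OF _ equiv_pi0_rel]) (rule id_closed[OF o(1)])
  moreover have "(scomp C y x y 0 \<alpha> \<beta>, sid C y) \<in> pi0_rel (shom C y y)"
    using AB unfolding Be cid pi0_comp_class[OF o(2,1,2) \<alpha> \<beta>]
    by (rule eq_equiv_class[OF _ equiv_pi0_rel]) (rule id_closed[OF o(2)])
  ultimately show ?thesis using \<alpha> \<beta> by (auto simp: homotopy_inverse_def)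
qed

lemma simplicial_map_pi0_rel:
  assumes p: "simplicial_map X Y p" and ab: "(a, b) \<in> pi0_rel X"
  shows "(p 0 a, p 0 b) \<in> pi0_rel Y"
proof -
  interpret p: simplicial_map X Y p by fact
  show ?thesis
  proof (rule pi0_rel_map[OF p.X.simplicial_set_axioms p.Y.simplicial_set_axioms _ _ ab])
    show "\<exists>e'\<in>simps Y 1. vertex Y 1 0 e' = p 0 (vertex X 1 0 e) \<and> vertex Y 1 1 e' = p 0 (vertex X 1 1 e)"
      if e: "e \<in> simps X 1" for e
    proof -
      have "(\<lambda>j\<in>{..0}. i) \<in> mono_maps 0 1" if "i \<le> 1" for i using that by (intro mono_mapsI) auto
      then show ?thesis
        using p.map_closed[OF e] p.map_natural[OF _ e] by (intro bexI[of _ "p 1 e"]) (auto simp: vertex_def)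
    qed
  qed (rule p.map_closed)
qed

lemma simplicial_map_cst:
  assumes p: "simplicial_map X Y p" and a: "a \<in> simps X 0"
  shows "p m (cst X m a) = cst Y m (p 0 a)"
  unfolding cst_def by (rule simplicial_map.map_natural[OF p zero_mono_maps a])

text \<open>
  The path from \<open>p c\<close> to \<open>b\<close> lifts to a path that starts at \<open>c\<close>, and this path ends over \<open>b\<close>.
\<close>

lemma kan_fibration_lift_component:
  assumes fib: "kan_fibration E B p" and kan: "kan B"
    and c: "c \<in> simps E 0" and cb: "(p 0 c, b) \<in> pi0_rel B"
  shows "\<exists>a\<in>simps E 0. p 0 a = b"
proof -
  note p = kan_fibration_simplicial[OF fib]
  obtain \<gamma> where \<gamma>: "path B \<gamma>" "\<And>m. \<gamma> m (ct 0 m) = cst B m (p 0 c)" "\<And>m. \<gamma> m (ct 1 m) = cst B m b"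
    using kan_path[OF kan cb] by blast
  have b: "b \<in> simps B 0" using cb by (auto simp: pi0_rel_def)
  let ?T = "{0 :: nat}"
  have ob: "obox ?T 0 1 m z \<longleftrightarrow> face 0 0 m z" for m z by (simp add: obox_def bdry_def)
  have "\<exists>w. natural_on ?T whole E w \<and> (\<forall>m. \<forall>z\<in>simps (cube ?T) m.
      p m (w m z) = \<gamma> m (z 0) \<and> (obox ?T 0 1 m z \<longrightarrow> w m z = cst E m c))"
  proof (rule box_lift[OF fib])
    show "natural_on ?T (obox ?T 0 1) E (\<lambda>m z. cst E m c)" by (rule natural_on_cst[OF p(2) c])
    show "natural_on ?T whole B (\<lambda>m z. \<gamma> m (z 0))" by (rule natural_on_path[OF \<gamma>(1)]) simp
    show "p m (cst E m c) = \<gamma> m (z 0)" if "z \<in> simps (cube ?T) m" "obox ?T 0 1 m z" for m z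
      using face_eq[of 0 0 m z ?T] that \<gamma>(2) simplicial_map_cst[OF p(1) c] by (simp add: ob)
  qed auto
  then obtain w where w: "natural_on ?T whole E w" "\<And>m z. z \<in> simps (cube ?T) m \<Longrightarrow> p m (w m z) = \<gamma> m (z 0)"
    by blast
  let ?z = "\<lambda>c\<in>?T. ct 1 0"
  have z: "?z \<in> simps (cube ?T) 0" by (simp add: simps_cube)
  show ?thesis
    using natural_on_closed[OF w(1), OF z] w(2)[OF z] \<gamma>(3)[of 0] cst_0[OF p(3) b] by auto
qed

context horn_over
begin

text \<open>
  A horn of dimension \<open>1\<close> is an object, and a lift is an arrow \<open>a\<close> over the given edge that has this
  object at the vertex \<open>k\<close>.
\<close>

lemma edge_horn:
  assumes n1: "n = 1" and x: "x 0 \<in> sob C" "x 1 \<in> sob C" and a: "a \<in> simps (shom C (x 0) (x 1)) 0"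
    and Fx: "fob F (x 0) = fob base 0" "fob F (x 1) = fob base 1"
    and Fa: "farr F (x 0) (x 1) 0 a = farr base 0 1 0 (\<lambda>_. undefined)"
    and xk: "x k = gob k"
  shows has_lift
proof -
  have le: "a = 0 \<and> b = 1" if "a < b" "b \<le> n" for a b using that n1 by auto
  have le': "a = 0 \<or> a = 1" if "a \<le> n" for a using that n1 by auto
  have S: "{0<..<1 :: nat} = {}" by auto
  note hs = C.hom_sset[OF x]
  let ?X = "shom C (x 0) (x 1)"
  have kn: "a = k" if "a \<le> n" "known {a}" for a
    using that n1 k unfolding known_def by (metis le_0_eq le_Suc_eq One_nat_def singletonI)
  have nk: "\<not> known (supp 0 1 m z)" for m z
    unfolding known_def supp_def using n1 by (auto simp: le_Suc_eq One_nat_def)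
  have b1: "farr base 0 1 m z = cst (shom D (fob base 0) (fob base 1)) m (farr base 0 1 0 (\<lambda>_. undefined))"
    if z: "z \<in> simps (cube {}) m" for m z
  proof -
    have "natural_on {0<..<1} whole (shom D (fob base 0) (fob base 1)) (farr base 0 1)"
      using nerve_simplex(2)[OF base_hom, of 0 1] n1 by simp
    then have nat: "natural_on {} whole (shom D (fob base 0) (fob base 1)) (farr base 0 1)" unfolding S .
    have pt: "(\<lambda>_. undefined) \<in> simps (cube {}) 0" by (simp add: simps_cube)
    have "sact (cube {}) m 0 (\<lambda>i\<in>{..m}. 0) (\<lambda>_. undefined) = z"
      using z by (auto simp: simps_cube sact_cube restrict_def)
    then show ?thesis using natural_on_sact[OF nat, OF pt TrueI zero_mono_maps, of m] by (simp add: cst_def)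
  qed
  show ?thesis
  proof (rule assemble[where ob = x and W = "\<lambda>_ _ m _. cst ?X m a"])
    show "x c \<in> sob C" if "c \<le> n" for c using le'[OF that] x by auto
    show "x c = gob c" if "c \<le> n" "known {c}" for c using kn[OF that] xk by simp
    show "fob F (x c) = fob base c" if "c \<le> n" for c using le'[OF that] Fx by auto
    show "natural_on {c<..<d} whole (shom C (x c) (x d)) (\<lambda>m _. cst ?X m a)" if "c < d" "d \<le> n" for c d
      using le[OF that] natural_on_cst[OF hs a] by simp
    show "farr F (x c) (x d) m (cst ?X m a) = farr base c d m z"
      if "c < d" "d \<le> n" "z \<in> simps (cube {c<..<d}) m" for c d m z
      using le[OF that(1,2)] that(3) b1[of z m] simplicial_map_cst[OF arr_map[OF x] a] Fa Fx S by simp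
    show "cst ?X m a = G c d m z" if "c < d" "d \<le> n" "known (supp c d m z)" for c d m z
      using le[OF that(1,2)] that(3) nk by simp
    show "cst ?X m a = scomp C (x b) (x c) (x d) m (cst ?X m a) (cst ?X m a)"
      if "b < c" "c < d" "d \<le> n" for b c d m
      using that n1 by simp
  qed
qed

end

context horn_over
begin

text \<open>
  Inner horns are lifted by the Kan fibrations between mapping spaces.  Outer horns use that every
  edge of \<open>C\<close> is a homotopy equivalence, and dimension \<open>1\<close> uses that every edge of \<open>D\<close> is one and
  so can be lifted.
\<close>

theorem horn_lift:
  assumes gC: "fibrant_groupoid C" and gD: "fibrant_groupoid D" and wf: "weak_fibration C D F" and n: "1 \<le> n"
  shows has_lift
proof -
  have kanC: "kan (shom C x y)" if "x \<in> sob C" "y \<in> sob C" for x y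
    using gC that by (simp add: fibrant_groupoid_def fibrant_def)
  have kanD: "kan (shom D x y)" if "x \<in> sob D" "y \<in> sob D" for x y
    using gD that by (simp add: fibrant_groupoid_def fibrant_def)
  have gpC: "groupoid (pi0_cat C)" and gpD: "groupoid (pi0_cat D)" using gC gD by (simp_all add: fibrant_groupoid_def)
  have fib: "kan_fibration (shom C x y) (shom D (fob F x) (fob F y)) (farr F x y)" if "x \<in> sob C" "y \<in> sob C" for x y
    using wf that by (simp add: weak_fibration_def)
  have lift: "\<exists>y\<in>sob C. \<exists>a\<in>simps (shom C x y) 0. fob F y = z \<and> farr F x y 0 a = b"
    if xz: "x \<in> sob C" "z \<in> sob D" "homotopy_equivalence D (fob F x) z b" for x z b
  proof -
    obtain y a where "y \<in> sob C" "homotopy_equivalence C x y a" "fob F y = z" "farr F x y 0 a = b"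
      using wf xz unfolding weak_fibration_def by blast
    then show ?thesis by (auto simp: homotopy_equivalence_def)
  qed
  note inv = C.homotopy_inverse_groupoid[OF gpC]
  consider "2 \<le> n" "0 < k" "k < n" | "2 \<le> n" "k = 0 \<or> k = n" | "n = 1"
    using n k by linarith
  then show ?thesis
  proof cases
    case 1
    then show ?thesis using inner_horn[OF fib] by blast
  next
    case 2
    then show ?thesis using outer_horn[OF fib kanC inv] by blast
  next
    case 3
    define b where "b = farr base 0 1 0 (\<lambda>_. undefined)"
    have ob: "fob base 0 \<in> sob D" "fob base 1 \<in> sob D"
      using nerve_simplex(1)[OF base_hom] 3 by simp_all
    have "natural_on {0<..<1} whole (shom D (fob base 0) (fob base 1)) (farr base 0 1)"
      using nerve_simplex(2)[OF base_hom, of 0 1] 3 by simp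
    moreover have "(\<lambda>_. undefined) \<in> simps (cube {0<..<1}) 0" by (auto simp: simps_cube PiE_iff extensional_def)
    ultimately have b: "b \<in> simps (shom D (fob base 0) (fob base 1)) 0"
      unfolding b_def using natural_on_closed by blast
    have "1 - k \<le> n" "1 - k \<noteq> k" using 3 k by arith+
    then have kn: "known {k}" unfolding known_def by blast
    have g: "gob k \<in> sob C" "fob F (gob k) = fob base k" using gob_ob[OF k kn] F_gob[OF k kn] by auto
    have "k = 0 \<or> k = 1" using k 3 by auto
    then show ?thesis
    proof
      assume k0: "k = 0"
      have "homotopy_equivalence D (fob F (gob 0)) (fob base 1) b"
        using D.homotopy_equivalence_groupoid[OF gpD ob b] g(2) k0 by simp
      then obtain y a where y: "y \<in> sob C" "fob F y = fob base 1" "farr F (gob 0) y 0 a = b"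
        and a: "a \<in> simps (shom C (gob 0) y) 0"
        using lift[of "gob 0"] g(1) ob(2) k0 by blast
      show ?thesis
        using edge_horn[OF 3, of "\<lambda>i. if i = 0 then gob 0 else y" a] y a g k0 by (simp add: b_def)
    next
      assume k1: "k = 1"
      note g = g[unfolded k1]
      have bF: "b \<in> simps (shom D (fob base 0) (fob F (gob 1))) 0" using b g(2) by simp
      note o1 = ob_closed[OF g(1)]
      obtain \<beta> where \<beta>: "D.homotopy_inverse (fob base 0) (fob F (gob 1)) b \<beta>"
        using D.homotopy_inverse_groupoid[OF gpD ob(1) o1 bF] by blast
      have \<beta>0: "\<beta> \<in> simps (shom D (fob F (gob 1)) (fob base 0)) 0" using \<beta> by (simp add: D.homotopy_inverse_def)
      \<comment> \<open>Homotopy equivalences lift only with given source.  So an inverse \<open>\<beta>\<close> of \<open>b\<close> is lifted to \<open>a\<close>, and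
        the inverse \<open>c\<close> of \<open>a\<close> has the given target.  It lies over \<open>b\<close> up to homotopy, and is corrected by
        lifting the homotopy.\<close>
      have "homotopy_equivalence D (fob F (gob 1)) (fob base 0) \<beta>"
        by (rule D.homotopy_equivalence_groupoid[OF gpD o1 ob(1) \<beta>0])
      then obtain y a where y: "y \<in> sob C" "fob F y = fob base 0" "farr F (gob 1) y 0 a = \<beta>"
        and a: "a \<in> simps (shom C (gob 1) y) 0"
        using lift[OF g(1) ob(1)] by blast
      obtain c where c: "C.homotopy_inverse (gob 1) y a c" using inv[OF g(1) y(1) a] by blast
      have c0: "c \<in> simps (shom C y (gob 1)) 0" using c by (simp add: C.homotopy_inverse_def)
      let ?x = "fob base 0" let ?z = "fob F (gob 1)"
      let ?R = "pi0_rel (shom D ?x ?z)"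
      let ?Fc = "farr F y (gob 1) 0 c"
      have Fc: "?Fc \<in> simps (shom D ?x ?z) 0"
        using simplicial_map.map_closed[OF arr_map[OF y(1) g(1)] c0] y(2) by simp
      have refl: "(e, e) \<in> pi0_rel X" if "e \<in> simps X 0" for e and X :: "'b sset"
        using that by (simp add: pi0_rel_def)
      \<comment> \<open>\<open>F c\<close> and \<open>b\<close> are both inverse to \<open>\<beta>\<close>, so \<open>F c = (F c) \<beta> b = b\<close> in the groupoid of components.\<close>
      have id0: "sidn D w 0 = sid D w" if "w \<in> sob D" for w
        unfolding D.cst_sid[symmetric] using that by (intro cst_0 D.hom_sset D.id_closed)
      have "(scomp D ?x ?x ?z 0 ?Fc (scomp D ?x ?z ?x 0 \<beta> b), scomp D ?x ?x ?z 0 ?Fc (sid D ?x)) \<in> ?R"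
        using \<beta> by (intro D.comp_pi0_rel ob(1) o1 refl Fc) (simp add: D.homotopy_inverse_def)
      then have 1: "(scomp D ?x ?x ?z 0 ?Fc (scomp D ?x ?z ?x 0 \<beta> b), ?Fc) \<in> ?R"
        using D.comp_id_right[OF ob(1) o1 Fc] id0[OF ob(1)] by simp
      have "(farr F (gob 1) (gob 1) 0 (scomp C (gob 1) y (gob 1) 0 c a), farr F (gob 1) (gob 1) 0 (sid C (gob 1)))
          \<in> pi0_rel (shom D ?z ?z)"
        using c by (intro simplicial_map_pi0_rel[OF arr_map[OF g(1) g(1)]]) (simp add: C.homotopy_inverse_def)
      then have "(scomp D ?z ?x ?z 0 ?Fc \<beta>, sid D ?z) \<in> pi0_rel (shom D ?z ?z)"
        using arr_comp[OF g(1) y(1) g(1) c0 a] arr_id[OF g(1)] y by simp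
      then have "(scomp D ?x ?z ?z 0 (scomp D ?z ?x ?z 0 ?Fc \<beta>) b, scomp D ?x ?z ?z 0 (sid D ?z) b) \<in> ?R"
        by (intro D.comp_pi0_rel ob(1) o1 refl bF)
      then have 2: "(scomp D ?x ?x ?z 0 ?Fc (scomp D ?x ?z ?x 0 \<beta> b), b) \<in> ?R"
        using D.comp_id_left[OF ob(1) o1 bF] id0[OF o1] D.comp_assoc[OF ob(1) o1 ob(1) o1 Fc \<beta>0 bF] by simp
      have "(?Fc, b) \<in> ?R"
        using 1 2 equiv_pi0_rel[of "shom D ?x ?z"] by (meson equivE symD transD)
      then obtain a' where a': "a' \<in> simps (shom C y (gob 1)) 0" "farr F y (gob 1) 0 a' = b"
        using kan_fibration_lift_component[OF fib[OF y(1) g(1)] _ c0, of b] kanD[OF ob(1) o1] y(2) by auto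
      show ?thesis
        using edge_horn[OF 3, of "\<lambda>i. if i = 0 then y else gob 1" a'] y a' g k1 by (simp add: b_def)
    qed
  qed
qed

end

theorem proposition2p5p2:
  fixes X :: "('o, 'a) scat" and Y :: "('p, 'b) scat"
    and f :: "('o, 'a, 'p, 'b) sfun"
  assumes "fibrant_groupoid X" and "fibrant_groupoid Y"
    and "weak_fibration X Y f"
  shows "kan_fibration (nerve X) (nerve Y) (nerve_map f)"
  unfolding kan_fibration_def
proof (intro conjI allI impI, goal_cases)
  have f: "simplicial_functor X Y f" using assms(3) by (simp add: weak_fibration_def)
  case 1
  show ?case by (rule simplicial_map_nerve_map[OF f])
  case (2 n k u v)
  interpret f: simplicial_functor X Y f by (rule f)
  interpret horn_over X Y f n k u v
    using 2 by (intro horn_over.intro horn_over_axioms.intro horn_in_nerve.intro horn_in_nerve_axioms.intro f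
        f.C.simplicial_category_axioms) auto
  show ?case using horn_lift[OF assms] 2 unfolding has_lift_def by blast
qed

end
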